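(* Let $\tau>0$, let $\beta>0$ be a real constant, let $V\in L^\infty(\mathcal D)$ with $V(x)\ge 0$ for all $x\in\mathcal D$, and let $\kappa\ge\|V\|_\infty+3\beta M^2$. Then $$\min_{\|\phi\|_2\le1}\widetilde E^{1,\tau}(\phi)=\min_{\|\phi\|_2=1}\widetilde E^{1,\tau}(\phi).$$
   Context: $\mathcal D\subset\mathbb R^d$, $d\in\{1,2,3\}$, is a bounded domain (an interval for $d=1$, a rectangle for $d=2$, a box for $d=3$), with periodic boundary conditions imposed on all functions. Functions $\phi\in L^2(\mathcal D)$ are complex-valued, and $\|\cdot\|_2$, $\|\cdot\|_\infty$ are the norms of $L^2(\mathcal D)$, $L^\infty(\mathcal D)$. $e^{t\Delta}$, $t\ge 0$, denotes the heat semigroup on $L^2(\mathcal D)$ generated by the Laplacian with periodic boundary conditions. Let $$M=\sqrt{\frac{\beta+2\int_{\mathcal D}V(x)\,dx}{\beta|\mathcal D|}},$$ where $|\mathcal D|$ is the Lebesgue measure of $\mathcal D$. The truncated nonlinearity is $$\widetilde F(\phi)=\begin{cases}|\phi|^4,&|\phi|\le M,\\ 6M^2|\phi|^2-8M^3|\phi|+3M^4,&|\phi|>M,\end{cases}$$ and the truncated energy is $$\widetilde E^{1,\tau}(\phi)=\frac1{2\tau}+\int_{\mathcal D}\Big(-\frac1{2\tau}\big|e^{\frac\tau2\Delta}\phi\big|^2+V(x)|\phi|^2+\frac\beta2\widetilde F(\phi)-\kappa|\phi|^2\Big)\,dx+\kappa.$$ *)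

theory Defs
  imports "HOL-Analysis.Analysis" "HOL-Probability.Essential_Supremum"
begin

section \<open>Lebesgue spaces on a domain\<close>

text \<open>Elements of \<open>L\<^sup>2(D)\<close> are represented by functions; everything outside \<open>D\<close> is irrelevant, and
  all notions below are invariant under changing a function on a null set.\<close>

definition L2 :: "'a::euclidean_space set \<Rightarrow> ('a \<Rightarrow> complex) set" where
  "L2 D = {\<phi>. \<phi> \<in> borel_measurable (lebesgue_on D)
              \<and> integrable (lebesgue_on D) (\<lambda>x. (cmod (\<phi> x))\<^sup>2)}"

definition L2_norm :: "'a::euclidean_space set \<Rightarrow> ('a \<Rightarrow> complex) \<Rightarrow> real" where
  "L2_norm D \<phi> = sqrt (LINT x|lebesgue_on D. (cmod (\<phi> x))\<^sup>2)"

definition Linf_norm :: "'a::euclidean_space set \<Rightarrow> ('a \<Rightarrow> real) \<Rightarrow> ereal" where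
  "Linf_norm D V = esssup (lebesgue_on D) (\<lambda>x. ereal \<bar>V x\<bar>)"

definition Linf :: "'a::euclidean_space set \<Rightarrow> ('a \<Rightarrow> real) set" where
  "Linf D = {V. V \<in> borel_measurable (lebesgue_on D) \<and> Linf_norm D V < \<infinity>}"

section \<open>The periodic Laplacian\<close>

definition partial_deriv :: "'a::euclidean_space \<Rightarrow> ('a \<Rightarrow> complex) \<Rightarrow> 'a \<Rightarrow> complex" where
  "partial_deriv i f x = vector_derivative (\<lambda>s. f (x + s *\<^sub>R i)) (at 0)"

text \<open>\<open>C\<^sup>\<infinity>\<close>: all iterated partial derivatives exist and are continuous. Here
  \<open>foldr partial_deriv bs f\<close> is the iterated derivative of \<open>f\<close> along the list \<open>bs\<close> of
  coordinate directions.\<close>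

definition smooth_fun :: "('a::euclidean_space \<Rightarrow> complex) \<Rightarrow> bool" where
  "smooth_fun f \<longleftrightarrow>
     (\<forall>bs \<in> lists Basis.
        continuous_on UNIV (foldr partial_deriv bs f) \<and>
        (\<forall>i\<in>Basis. \<forall>x. (\<lambda>s. foldr partial_deriv bs f (x + s *\<^sub>R i)) differentiable (at (0::real))))"

definition classical_laplacian :: "('a::euclidean_space \<Rightarrow> complex) \<Rightarrow> 'a \<Rightarrow> complex" where
  "classical_laplacian f x = (\<Sum>i\<in>Basis. partial_deriv i (partial_deriv i f) x)"

definition box_periodic :: "'a::euclidean_space \<Rightarrow> 'a \<Rightarrow> ('a \<Rightarrow> complex) \<Rightarrow> bool" where
  "box_periodic a b f \<longleftrightarrow> (\<forall>i\<in>Basis. \<forall>x. f (x + ((b - a) \<bullet> i) *\<^sub>R i) = f x)"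

text \<open>The graph of the Laplacian on \<open>L\<^sup>2(box a b)\<close> with periodic boundary conditions:
  \<open>\<phi>\<close> belongs to the domain and \<open>\<Delta>\<phi> = f\<close>. The Laplacian is taken in the sense of distributions on
  the torus, i.e. tested against smooth periodic functions, so the domain is \<open>H\<^sup>2\<close> with periodic
  boundary conditions.\<close>

definition periodic_laplacian ::
    "'a::euclidean_space \<Rightarrow> 'a \<Rightarrow> ('a \<Rightarrow> complex) \<Rightarrow> ('a \<Rightarrow> complex) \<Rightarrow> bool" where
  "periodic_laplacian a b \<phi> f \<longleftrightarrow>
     \<phi> \<in> L2 (box a b) \<and> f \<in> L2 (box a b) \<and>
     (\<forall>\<eta>. smooth_fun \<eta> \<and> box_periodic a b \<eta> \<longrightarrow>
        (LINT x|lebesgue_on (box a b). \<phi> x * classical_laplacian \<eta> x) =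
        (LINT x|lebesgue_on (box a b). f x * \<eta> x))"

section \<open>Strongly continuous semigroups and the heat semigroup\<close>

text \<open>Strongly continuous semigroups of bounded linear operators on \<open>L\<^sup>2(D)\<close>. As the elements of
  \<open>L\<^sup>2(D)\<close> are represented by functions, operator identities hold almost everywhere. Linearity and
  boundedness force each operator to respect equality almost everywhere.\<close>

definition strongly_continuous_semigroup ::
    "'a::euclidean_space set \<Rightarrow> (real \<Rightarrow> ('a \<Rightarrow> complex) \<Rightarrow> 'a \<Rightarrow> complex) \<Rightarrow> bool" where
  "strongly_continuous_semigroup D T \<longleftrightarrow>
     (\<forall>t\<ge>0. \<forall>\<phi>\<in>L2 D. T t \<phi> \<in> L2 D) \<and>
     (\<forall>t\<ge>0. \<forall>\<phi>\<in>L2 D. \<forall>\<psi>\<in>L2 D. \<forall>c.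
        AE x in lebesgue_on D. T t (\<lambda>y. c * \<phi> y + \<psi> y) x = c * T t \<phi> x + T t \<psi> x) \<and>
     (\<forall>t\<ge>0. \<exists>C. \<forall>\<phi>\<in>L2 D. L2_norm D (T t \<phi>) \<le> C * L2_norm D \<phi>) \<and>
     (\<forall>\<phi>\<in>L2 D. AE x in lebesgue_on D. T 0 \<phi> x = \<phi> x) \<and>
     (\<forall>s\<ge>0. \<forall>t\<ge>0. \<forall>\<phi>\<in>L2 D. AE x in lebesgue_on D. T (s + t) \<phi> x = T s (T t \<phi>) x) \<and>
     (\<forall>\<phi>\<in>L2 D. ((\<lambda>t. L2_norm D (\<lambda>x. T t \<phi> x - \<phi> x)) \<longlongrightarrow> 0) (at_right 0))"

definition has_generator ::
    "'a::euclidean_space set \<Rightarrow> (real \<Rightarrow> ('a \<Rightarrow> complex) \<Rightarrow> 'a \<Rightarrow> complex)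
      \<Rightarrow> (('a \<Rightarrow> complex) \<Rightarrow> ('a \<Rightarrow> complex) \<Rightarrow> bool) \<Rightarrow> bool" where
  "has_generator D T A \<longleftrightarrow>
     (\<forall>\<phi>\<in>L2 D. \<forall>f\<in>L2 D.
        A \<phi> f \<longleftrightarrow>
        ((\<lambda>h. L2_norm D (\<lambda>x. (T h \<phi> x - \<phi> x) / of_real h - f x)) \<longlongrightarrow> 0) (at_right 0))"

text \<open>\<open>T t\<close> is \<open>e\<^bsup>t\<Delta>\<^esup>\<close> on \<open>L\<^sup>2(box a b)\<close>. A semigroup is determined by its generator, so this
  determines \<open>T t \<phi>\<close> almost everywhere, for all \<open>t \<ge> 0\<close> and all \<open>\<phi>\<close> in \<open>L\<^sup>2\<close>.\<close>

definition periodic_heat_semigroup ::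
    "'a::euclidean_space \<Rightarrow> 'a \<Rightarrow> (real \<Rightarrow> ('a \<Rightarrow> complex) \<Rightarrow> 'a \<Rightarrow> complex) \<Rightarrow> bool" where
  "periodic_heat_semigroup a b T \<longleftrightarrow>
     strongly_continuous_semigroup (box a b) T \<and>
     has_generator (box a b) T (periodic_laplacian a b)"

section \<open>The truncated energy\<close>

definition trunc_level :: "'a::euclidean_space set \<Rightarrow> real \<Rightarrow> ('a \<Rightarrow> real) \<Rightarrow> real" where
  "trunc_level D \<beta> V =
     sqrt ((\<beta> + 2 * (LINT x|lebesgue_on D. V x)) / (\<beta> * measure lebesgue D))"

definition trunc_F :: "real \<Rightarrow> complex \<Rightarrow> real" where
  "trunc_F M z =
     (if cmod z \<le> M then cmod z ^ 4
      else 6 * M\<^sup>2 * (cmod z)\<^sup>2 - 8 * M ^ 3 * cmod z + 3 * M ^ 4)"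

definition trunc_energy ::
    "'a::euclidean_space set \<Rightarrow> (real \<Rightarrow> ('a \<Rightarrow> complex) \<Rightarrow> 'a \<Rightarrow> complex)
      \<Rightarrow> ('a \<Rightarrow> real) \<Rightarrow> real \<Rightarrow> real \<Rightarrow> real \<Rightarrow> ('a \<Rightarrow> complex) \<Rightarrow> real" where
  "trunc_energy D T V \<beta> \<kappa> \<tau> \<phi> =
     1 / (2 * \<tau>)
     + (LINT x|lebesgue_on D.
          - (1 / (2 * \<tau>)) * (cmod (T (\<tau> / 2) \<phi> x))\<^sup>2
          + V x * (cmod (\<phi> x))\<^sup>2
          + \<beta> / 2 * trunc_F (trunc_level D \<beta> V) (\<phi> x)
          - \<kappa> * (cmod (\<phi> x))\<^sup>2)
     + \<kappa>"

end

theory Submission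
  imports Defs "HOL-Real_Asymp.Real_Asymp"
begin

text \<open>
  A single function minimises the energy over the ball and over the sphere at once. Write \<open>S\<close> for
  \<open>e\<^bsup>\<tau>\<Delta>/2\<^esup>\<close>, \<open>M\<close> for the truncation level, \<open>F\<close> for the truncated nonlinearity and \<open>|D|\<close> for the
  volume of the domain.

  From the ball to the sphere (\<open>energy_ball_ge_sphere\<close>): let \<open>\<parallel>u\<parallel>\<^sup>2 = 1 - d\<close> and spread the missing mass
  evenly, \<open>w = (|u|\<^sup>2 + d/|D|)\<^bsup>1/2\<^esup>\<close>. As a function of the density \<open>|\<phi>|\<^sup>2\<close>, the nonlinearity has slope at
  most \<open>6M\<^sup>2\<close> and the potential at most the essential supremum of \<open>V\<close>, so this costs at most
  \<open>d\<parallel>V\<parallel>\<^sub>\<infinity> + 3\<beta>M\<^sup>2d\<close>, which the term \<open>-\<kappa>\<parallel>\<phi>\<parallel>\<^sup>2\<close> pays for. The heat term does not get worse, because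
  \<open>\<parallel>S\<phi>\<parallel>\<^sup>2\<close> is superadditive in the density (\<open>T_norm_sqrt_sum_squares\<close>): this is positivity of \<open>S\<close>
  applied to \<open>f + ig\<close>.

  On the sphere the difficulty is existence: \<open>F\<close> grows only quadratically, so mass could concentrate
  along a minimising sequence. This is excluded by cutting the function off at height \<open>M\<close> and spreading
  the mass \<open>d\<close> that was cut off evenly (\<open>quartic_energy_le_energy\<close>). Above \<open>M\<close> the slope of \<open>F\<close> in the density is
  at least \<open>2M\<^sup>2\<close>, which saves \<open>\<beta>M\<^sup>2d\<close>; and since \<open>F\<close> is at most the quartic, spreading costs at most
  \<open>d(\<integral>V + \<beta>)/|D|\<close>. The value of \<open>M\<close> makes the saving at least as large as the cost. The heat term improves because
  \<open>\<parallel>\<phi>\<parallel>\<^sup>2 - \<parallel>S\<phi>\<parallel>\<^sup>2\<close> decreases under truncation, \<open>S\<close> being Markovian (\<open>T_truncation\<close>).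

  So it suffices to minimise the energy with the exact quartic term over nonnegative functions of norm
  one below a fixed height. In terms of the density that energy is convex, and the quartic term is
  quadratic, so the parallelogram identity makes every minimising sequence Cauchy (\<open>quartic_energy_midpoint\<close>);
  dominated convergence finishes the argument (\<open>quartic_energy_minimizer\<close>).

  What is used of \<open>S\<close> is positivity, contractivity, conservation of mass and \<open>S1 = 1\<close>. They follow from
  \<open>e\<^bsup>t\<Delta>\<^esup>e\<^bsup>i\<omega>x\<^esup> = e\<^bsup>-t|\<omega>|\<^sup>2\<^esup>e\<^bsup>i\<omega>x\<^esup>\<close> (\<open>T_character\<close>) and the density of trigonometric polynomials. For
  positivity, the multiplier \<open>e\<^bsup>-t|\<omega>|\<^sup>2\<^esup>\<close> is a limit of multipliers of averages of translations
  (\<open>positive_multiplier_heat\<close>), and nonnegative functions are limits of nonnegative trigonometric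
  polynomials (\<open>trig_poly_dense_nonneg\<close>).
\<close>

section \<open>Square-integrable functions\<close>

lemma L2_measurable [measurable_dest]: "f \<in> L2 D \<Longrightarrow> f \<in> borel_measurable (lebesgue_on D)"
  by (simp add: L2_def)

lemma L2_integrable: "f \<in> L2 D \<Longrightarrow> integrable (lebesgue_on D) (\<lambda>x. (cmod (f x))\<^sup>2)"
  by (simp add: L2_def)

lemma L2_norm_nonneg [simp]: "0 \<le> L2_norm D f"
  by (simp add: L2_norm_def)

lemma L2_norm_sq: "(L2_norm D f)\<^sup>2 = (LINT x|lebesgue_on D. (cmod (f x))\<^sup>2)"
  by (simp add: L2_norm_def)

lemma L2_dominated:
  assumes g: "g \<in> L2 D" and f: "f \<in> borel_measurable (lebesgue_on D)"
    and le: "AE x in lebesgue_on D. cmod (f x) \<le> cmod (g x)"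
  shows "f \<in> L2 D"
proof -
  have "integrable (lebesgue_on D) (\<lambda>x. (cmod (f x))\<^sup>2)"
    by (rule Bochner_Integration.integrable_bound[OF L2_integrable[OF g]])
      (use f le in \<open>auto intro: power_mono elim!: eventually_mono\<close>)
  then show ?thesis using f by (simp add: L2_def)
qed

lemma L2_norm_mono:
  assumes "g \<in> L2 D" "f \<in> borel_measurable (lebesgue_on D)"
    and le: "AE x in lebesgue_on D. cmod (f x) \<le> cmod (g x)"
  shows "L2_norm D f \<le> L2_norm D g"
  unfolding L2_norm_def
  by (intro real_sqrt_le_mono integral_mono_AE L2_integrable L2_dominated[OF assms] assms)
    (use le in \<open>auto intro: power_mono elim!: eventually_mono\<close>)

lemma L2_cong_AE:
  assumes "f \<in> borel_measurable (lebesgue_on D)" "g \<in> L2 D"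
    and "AE x in lebesgue_on D. f x = g x"
  shows "f \<in> L2 D"
  by (rule L2_dominated[OF assms(2,1)]) (use assms(3) in \<open>auto elim!: eventually_mono\<close>)

lemma L2_norm_cong_AE:
  assumes [measurable]: "f \<in> borel_measurable (lebesgue_on D)" "g \<in> borel_measurable (lebesgue_on D)"
    and "AE x in lebesgue_on D. f x = g x"
  shows "L2_norm D f = L2_norm D g"
  unfolding L2_norm_def
  by (intro arg_cong[where f=sqrt] integral_cong_AE) (use assms(3) in \<open>auto elim!: eventually_mono\<close>)

lemma L2_cmult [intro]: "f \<in> L2 D \<Longrightarrow> (\<lambda>x. c * f x) \<in> L2 D"
  by (auto simp: L2_def norm_mult power_mult_distrib)

lemma L2_norm_cmult: "L2_norm D (\<lambda>x. c * f x) = cmod c * L2_norm D f"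
  by (simp add: L2_norm_def norm_mult power_mult_distrib real_sqrt_mult)

lemma norm_add_sq_le: "(cmod (u + v))\<^sup>2 \<le> 2 * (cmod u)\<^sup>2 + 2 * (cmod v)\<^sup>2"
proof -
  have "(cmod (u + v))\<^sup>2 \<le> (cmod u + cmod v)\<^sup>2"
    by (intro power_mono norm_triangle_ineq) auto
  also have "\<dots> \<le> 2 * (cmod u)\<^sup>2 + 2 * (cmod v)\<^sup>2"
    using zero_le_power2[of "cmod u - cmod v"] by (simp add: power2_eq_square algebra_simps)
  finally show ?thesis .
qed

lemma L2_add [intro]:
  assumes "f \<in> L2 D" "g \<in> L2 D"
  shows "(\<lambda>x. f x + g x) \<in> L2 D"
proof -
  have [measurable]: "f \<in> borel_measurable (lebesgue_on D)" "g \<in> borel_measurable (lebesgue_on D)"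
    using assms by (auto simp: L2_def)
  have "integrable (lebesgue_on D) (\<lambda>x. 2 * (cmod (f x))\<^sup>2 + 2 * (cmod (g x))\<^sup>2)"
    using assms by (auto simp: L2_def)
  then have "integrable (lebesgue_on D) (\<lambda>x. (cmod (f x + g x))\<^sup>2)"
    by (rule Bochner_Integration.integrable_bound) (auto simp: norm_add_sq_le)
  then show ?thesis by (simp add: L2_def)
qed

lemma L2_diff [intro]:
  assumes "f \<in> L2 D" "g \<in> L2 D"
  shows "(\<lambda>x. f x - g x) \<in> L2 D"
  using L2_add[OF assms(1) L2_cmult[OF assms(2), of "-1"]] by simp

lemma L2_zero [simp]: "(\<lambda>x. 0) \<in> L2 D"
  by (simp add: L2_def)

lemma L2_sum [intro]:
  "(\<And>i. i \<in> I \<Longrightarrow> f i \<in> L2 D) \<Longrightarrow> (\<lambda>x. \<Sum>i\<in>I. f i x) \<in> L2 D"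
  by (induction I rule: infinite_finite_induct) auto

lemma L2_cmod [intro]: "f \<in> L2 D \<Longrightarrow> (\<lambda>x. of_real (cmod (f x))) \<in> L2 D"
  by (auto simp: L2_def)

lemma L2_cnj [intro]: "f \<in> L2 D \<Longrightarrow> (\<lambda>x. cnj (f x)) \<in> L2 D"
  by (auto simp: L2_def intro!: borel_measurable_continuous_on[OF continuous_on_cnj[OF continuous_on_id]])

lemma L2_mult_integrable:
  assumes "f \<in> L2 D" "g \<in> L2 D"
  shows "integrable (lebesgue_on D) (\<lambda>x. f x * g x)"
proof -
  have [measurable]: "f \<in> borel_measurable (lebesgue_on D)" "g \<in> borel_measurable (lebesgue_on D)"
    using assms by (auto simp: L2_def)
  have "integrable (lebesgue_on D) (\<lambda>x. (cmod (f x))\<^sup>2 + (cmod (g x))\<^sup>2)"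
    using assms by (auto simp: L2_def)
  moreover have "cmod (f x * g x) \<le> norm ((cmod (f x))\<^sup>2 + (cmod (g x))\<^sup>2)" for x
    using sum_squares_bound[of "cmod (f x)" "cmod (g x)"]
      mult_nonneg_nonneg[OF norm_ge_zero[of "f x"] norm_ge_zero[of "g x"]]
    unfolding norm_mult real_norm_def by linarith
  ultimately show ?thesis
    by (intro Bochner_Integration.integrable_bound[of _ _ "\<lambda>x. f x * g x"]) auto
qed

lemma L2_norm_eq_0_iff:
  assumes "f \<in> L2 D"
  shows "L2_norm D f = 0 \<longleftrightarrow> (AE x in lebesgue_on D. f x = 0)"
  using integral_nonneg_eq_0_iff_AE[OF L2_integrable[OF assms]]
  by (simp add: L2_norm_def)

text \<open>Young's inequality with weight \<open>\<parallel>g\<parallel>/\<parallel>f\<parallel>\<close> is integrated; when a norm vanishes, so does the integrand.\<close>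

lemma L2_Cauchy_Schwarz:
  assumes f: "f \<in> L2 D" and g: "g \<in> L2 D"
  shows "(LINT x|lebesgue_on D. cmod (f x) * cmod (g x)) \<le> L2_norm D f * L2_norm D g"
proof -
  note [measurable] = L2_measurable[OF f] L2_measurable[OF g]
  have int: "integrable (lebesgue_on D) (\<lambda>x. cmod (f x) * cmod (g x))"
    using integrable_norm[OF L2_mult_integrable[OF f g]] by (simp add: norm_mult)
  show ?thesis
  proof (cases "L2_norm D f = 0 \<or> L2_norm D g = 0")
    case True
    then have "AE x in lebesgue_on D. cmod (f x) * cmod (g x) = 0"
      using L2_norm_eq_0_iff[OF f] L2_norm_eq_0_iff[OF g] by (auto elim!: eventually_mono)
    then have "(LINT x|lebesgue_on D. cmod (f x) * cmod (g x)) = 0"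
      by (rule integral_eq_zero_AE)
    then show ?thesis by simp
  next
    case False
    define A where "A = L2_norm D f"
    define B where "B = L2_norm D g"
    have pos: "A > 0" "B > 0"
      using False by (auto simp: A_def B_def less_le)
    have pt: "cmod (f x) * cmod (g x) \<le> (B / A * (cmod (f x))\<^sup>2 + A / B * (cmod (g x))\<^sup>2) / 2" for x
    proof -
      have "0 \<le> (B * cmod (f x) - A * cmod (g x))\<^sup>2 / (2 * A * B)"
        using pos by simp
      also have "\<dots> = (B / A * (cmod (f x))\<^sup>2 + A / B * (cmod (g x))\<^sup>2) / 2 - cmod (f x) * cmod (g x)"
        using pos by (simp add: power2_eq_square field_simps)
      finally show ?thesis by simp
    qed
    have "(LINT x|lebesgue_on D. cmod (f x) * cmod (g x))
        \<le> (LINT x|lebesgue_on D. (B / A * (cmod (f x))\<^sup>2 + A / B * (cmod (g x))\<^sup>2) / 2)"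
      by (rule integral_mono[OF int]) (use pt L2_integrable[OF f] L2_integrable[OF g] in auto)
    also have "\<dots> = (B / A * A\<^sup>2 + A / B * B\<^sup>2) / 2"
      unfolding A_def B_def L2_norm_sq using L2_integrable[OF f] L2_integrable[OF g] by simp
    also have "\<dots> = A * B"
      using pos by (simp add: power2_eq_square)
    finally show ?thesis by (simp add: A_def B_def)
  qed
qed

lemma L2_integral_mult_le:
  assumes f: "f \<in> L2 D" and g: "g \<in> L2 D"
  shows "cmod (LINT x|lebesgue_on D. f x * g x) \<le> L2_norm D f * L2_norm D g"
proof -
  have "cmod (LINT x|lebesgue_on D. f x * g x) \<le> (LINT x|lebesgue_on D. cmod (f x * g x))"
    by (rule integral_norm_bound)
  then show ?thesis using L2_Cauchy_Schwarz[OF f g] by (simp add: norm_mult)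
qed

lemma L2_norm_triangle:
  assumes f: "f \<in> L2 D" and g: "g \<in> L2 D"
  shows "L2_norm D (\<lambda>x. f x + g x) \<le> L2_norm D f + L2_norm D g"
proof (rule power2_le_imp_le)
  have int: "integrable (lebesgue_on D) (\<lambda>x. cmod (f x) * cmod (g x))"
    using integrable_norm[OF L2_mult_integrable[OF f g]] by (simp add: norm_mult)
  note ints = int L2_integrable[OF f] L2_integrable[OF g]
  have "(L2_norm D (\<lambda>x. f x + g x))\<^sup>2
      \<le> (LINT x|lebesgue_on D. (cmod (f x))\<^sup>2 + (2 * (cmod (f x) * cmod (g x)) + (cmod (g x))\<^sup>2))"
    unfolding L2_norm_sq
  proof (rule integral_mono)
    show "(cmod (f x + g x))\<^sup>2 \<le> (cmod (f x))\<^sup>2 + (2 * (cmod (f x) * cmod (g x)) + (cmod (g x))\<^sup>2)" for x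
      using power_mono[OF norm_triangle_ineq[of "f x" "g x"], of 2]
      by (simp add: power2_eq_square algebra_simps)
  qed (use ints L2_integrable[OF L2_add[OF f g]] in auto)
  also have "\<dots> = (L2_norm D f)\<^sup>2 + (2 * (LINT x|lebesgue_on D. cmod (f x) * cmod (g x)) + (L2_norm D g)\<^sup>2)"
    using ints by (simp add: L2_norm_sq)
  also have "\<dots> \<le> (L2_norm D f + L2_norm D g)\<^sup>2"
    using L2_Cauchy_Schwarz[OF f g] by (simp add: power2_eq_square algebra_simps)
  finally show "(L2_norm D (\<lambda>x. f x + g x))\<^sup>2 \<le> (L2_norm D f + L2_norm D g)\<^sup>2" .
qed auto

lemma L2_norm_minus_commute: "L2_norm D (\<lambda>x. f x - g x) = L2_norm D (\<lambda>x. g x - f x)"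
  by (simp add: L2_norm_def norm_minus_commute)

lemma L2_norm_triangle_diff:
  assumes "f \<in> L2 D" "g \<in> L2 D" "h \<in> L2 D"
  shows "L2_norm D (\<lambda>x. f x - h x) \<le> L2_norm D (\<lambda>x. f x - g x) + L2_norm D (\<lambda>x. g x - h x)"
  using L2_norm_triangle[OF L2_diff[OF assms(1,2)] L2_diff[OF assms(2,3)]] by simp

lemma L2_norm_sum_le:
  assumes "\<And>i. i \<in> I \<Longrightarrow> f i \<in> L2 D"
  shows "L2_norm D (\<lambda>x. \<Sum>i\<in>I. f i x) \<le> (\<Sum>i\<in>I. L2_norm D (f i))"
  using assms
proof (induction I rule: infinite_finite_induct)
  case (insert i I)
  have "L2_norm D (\<lambda>x. f i x + (\<Sum>i\<in>I. f i x)) \<le> L2_norm D (f i) + L2_norm D (\<lambda>x. \<Sum>i\<in>I. f i x)"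
    using insert by (intro L2_norm_triangle) auto
  then show ?case using insert by auto
qed (auto simp: L2_norm_def)

lemma L2_bounded:
  assumes "D \<in> lmeasurable" "f \<in> borel_measurable (lebesgue_on D)"
    and "\<And>x. x \<in> D \<Longrightarrow> cmod (f x) \<le> B"
  shows "f \<in> L2 D"
proof -
  interpret finite_measure "lebesgue_on D"
    using assms(1) by (rule finite_measure_lebesgue_on)
  have "integrable (lebesgue_on D) (\<lambda>x. (cmod (f x))\<^sup>2)"
    by (rule integrable_const_bound[where B="B\<^sup>2"])
      (use assms in \<open>auto intro!: AE_I2 power_mono\<close>)
  then show ?thesis using assms(2) by (simp add: L2_def)
qed

section \<open>Integrals of periodic functions over a box\<close>

text \<open>The shifted box sticks out by a slab of width \<open>s\<close>; one period back, that slab is exactly what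
  the shift left uncovered.\<close>

lemma integral_cbox_shift_periodic:
  fixes f :: "'a::euclidean_space \<Rightarrow> complex"
  assumes i: "i \<in> Basis" and cont: "continuous_on UNIV f"
    and per: "\<And>x. f (x + ((b - a) \<bullet> i) *\<^sub>R i) = f x"
    and s: "0 \<le> s" "s \<le> (b - a) \<bullet> i"
  shows "integral (cbox a b) (\<lambda>x. f (x + s *\<^sub>R i)) = integral (cbox a b) f"
proof -
  define L where "L = (b - a) \<bullet> i"
  define c where "c = b + (a \<bullet> i + s - b \<bullet> i) *\<^sub>R i"
  have intf: "f integrable_on cbox u v" for u v
    by (rule integrable_continuous) (rule continuous_on_subset[OF cont], simp)
  have inner: "j \<in> Basis \<Longrightarrow> i \<bullet> j = (if i = j then 1 else 0)" for j
    using i by (simp add: inner_Basis)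
  have shift: "integral (cbox u v) (\<lambda>x. f (x + w)) = integral (cbox (u + w) (v + w)) f" for u v w
    using integral_shift_cbox_plus[of u v f w] by (simp add: o_def add.commute)
  have set1: "cbox (a + s *\<^sub>R i) (b + s *\<^sub>R i) \<inter> {x. x \<bullet> i \<le> b \<bullet> i} = cbox a b \<inter> {x. a \<bullet> i + s \<le> x \<bullet> i}"
    using s i by (fastforce simp: mem_box inner inner_left_distrib inner_diff_left split: if_splits)
  have set2: "cbox (a + s *\<^sub>R i) (b + s *\<^sub>R i) \<inter> {x. b \<bullet> i \<le> x \<bullet> i} = cbox (a + L *\<^sub>R i) (c + L *\<^sub>R i)"
    using s i by (fastforce simp: mem_box inner inner_left_distrib inner_diff_left c_def L_def split: if_splits)
  have set3: "cbox a b \<inter> {x. x \<bullet> i \<le> a \<bullet> i + s} = cbox a c"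
    using s i by (fastforce simp: mem_box inner inner_left_distrib inner_diff_left c_def split: if_splits)
  have "integral (cbox a b) (\<lambda>x. f (x + s *\<^sub>R i)) = integral (cbox (a + s *\<^sub>R i) (b + s *\<^sub>R i)) f"
    by (rule shift)
  also have "\<dots> = integral (cbox a b \<inter> {x. a \<bullet> i + s \<le> x \<bullet> i}) f
      + integral (cbox (a + L *\<^sub>R i) (c + L *\<^sub>R i)) f"
    unfolding set1[symmetric] set2[symmetric] by (rule integral_split[OF intf i])
  also have "integral (cbox (a + L *\<^sub>R i) (c + L *\<^sub>R i)) f = integral (cbox a c) f"
    unfolding shift[symmetric] using per by (simp add: L_def)
  also have "integral (cbox a b \<inter> {x. a \<bullet> i + s \<le> x \<bullet> i}) f + integral (cbox a c) f
      = integral (cbox a b) f"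
    unfolding set3[symmetric] using integral_split[OF intf i, of a b "a \<bullet> i + s"] by simp
  finally show ?thesis .
qed

text \<open>The integral of \<open>x \<mapsto> f (x + s i)\<close> over the box does not depend on \<open>s\<close>; differentiate at \<open>0\<close>.
  Integration by parts on the torus and the orthogonality of characters are instances.\<close>

lemma integral_partial_deriv_periodic:
  fixes f :: "'a::euclidean_space \<Rightarrow> complex"
  assumes i: "i \<in> Basis" and L: "a \<bullet> i < b \<bullet> i"
    and cont: "continuous_on UNIV f" and cont': "continuous_on UNIV f'"
    and der: "\<And>x. ((\<lambda>s. f (x + s *\<^sub>R i)) has_vector_derivative f' x) (at 0)"
    and per: "\<And>x. f (x + ((b - a) \<bullet> i) *\<^sub>R i) = f x"
  shows "integral (cbox a b) f' = 0"
proof -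
  define U where "U = {0..(b - a) \<bullet> i}"
  have pos: "0 < (b - a) \<bullet> i" using L by (simp add: inner_diff_left)
  have der': "((\<lambda>s. f (x + s *\<^sub>R i)) has_vector_derivative f' (x + t *\<^sub>R i)) (at t within U)" for x t
  proof (rule has_vector_derivative_at_within)
    have "((\<lambda>s. f ((x + t *\<^sub>R i) + s *\<^sub>R i)) has_vector_derivative f' (x + t *\<^sub>R i)) (at (t - t))"
      using der[of "x + t *\<^sub>R i"] by simp
    then have "(((\<lambda>s. f ((x + t *\<^sub>R i) + s *\<^sub>R i)) \<circ> (\<lambda>s. s - t)) has_vector_derivative
        1 *\<^sub>R f' (x + t *\<^sub>R i)) (at t)"
      by (intro vector_diff_chain_at) (auto intro!: derivative_eq_intros)
    then show "((\<lambda>s. f (x + s *\<^sub>R i)) has_vector_derivative f' (x + t *\<^sub>R i)) (at t)"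
      by (simp add: o_def algebra_simps)
  qed
  have cc: "continuous_on S (\<lambda>x. f (x + s *\<^sub>R i))" for s S
    by (rule continuous_on_compose2[OF cont]) (auto intro!: continuous_intros)
  have "((\<lambda>s. integral (cbox a b) (\<lambda>x. f (x + s *\<^sub>R i))) has_vector_derivative
      integral (cbox a b) (\<lambda>x. f' (x + 0 *\<^sub>R i))) (at 0 within U)"
  proof (rule leibniz_rule_vector_derivative[where fx="\<lambda>s x. f' (x + s *\<^sub>R i)"])
    show "continuous_on (U \<times> cbox a b) (\<lambda>(s, x). f' (x + s *\<^sub>R i))"
      unfolding case_prod_unfold
      by (rule continuous_on_compose2[OF cont']) (auto intro!: continuous_intros)
  qed (use der' pos in \<open>auto simp: U_def intro!: integrable_continuous cc\<close>)
  then have D: "((\<lambda>s. integral (cbox a b) (\<lambda>x. f (x + s *\<^sub>R i))) has_vector_derivative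
      integral (cbox a b) f') (at 0 within U)"
    by simp
  have eq: "integral (cbox a b) f = integral (cbox a b) (\<lambda>x. f (x + s *\<^sub>R i))" if "s \<in> U" for s
    using that integral_cbox_shift_periodic[OF i cont per, of s] by (simp add: U_def)
  have "0 \<in> U" using pos by (simp add: U_def)
  then have "((\<lambda>s::real. integral (cbox a b) f) has_vector_derivative integral (cbox a b) f') (at 0 within U)"
    by (rule has_vector_derivative_transform[OF _ eq D])
  moreover have "((\<lambda>s::real. integral (cbox a b) f) has_vector_derivative 0) (at 0 within U)"
    by (rule has_vector_derivative_const)
  moreover have "at 0 within U \<noteq> bot"
    unfolding U_def using pos by (simp add: at_within_Icc_at_right)
  ultimately show ?thesis
    by (metis vector_derivative_unique_within)
qed

lemma continuous_UNIV_integrable_on_cbox: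
  fixes f :: "'a::euclidean_space \<Rightarrow> complex"
  shows "continuous_on UNIV f \<Longrightarrow> f integrable_on cbox a b"
  by (rule integrable_continuous) (rule continuous_on_subset, auto)

lemma LINT_box_eq_integral:
  fixes f :: "'a::euclidean_space \<Rightarrow> complex"
  assumes "continuous_on UNIV f"
  shows "integrable (lebesgue_on (box a b)) f"
    and "(LINT x|lebesgue_on (box a b). f x) = integral (cbox a b) f"
proof -
  interpret finite_measure "lebesgue_on (box a b)"
    by (rule finite_measure_lebesgue_on) simp
  have cont: "continuous_on S f" for S
    using assms by (rule continuous_on_subset) simp
  have "compact (f ` cbox a b)"
    by (rule compact_continuous_image[OF cont compact_cbox])
  then obtain B where "\<And>x. x \<in> cbox a b \<Longrightarrow> norm (f x) \<le> B"
    using compact_imp_bounded bounded_iff by (metis imageI)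
  then show int: "integrable (lebesgue_on (box a b)) f"
    using box_subset_cbox[of a b]
    by (intro integrable_const_bound[where B=B] AE_I2 continuous_imp_measurable_on_sets_lebesgue cont) auto
  show "(LINT x|lebesgue_on (box a b). f x) = integral (cbox a b) f"
    using lebesgue_integral_eq_integral[OF int] by (simp add: integral_open_interval)
qed

section \<open>Characters of the torus\<close>

text \<open>Frequencies are vectors rather than tuples of integers, so that the eigenvalue of the Laplacian
  is minus the squared norm of the frequency.\<close>

definition dual_lattice :: "'a::euclidean_space \<Rightarrow> 'a \<Rightarrow> 'a set" where
  "dual_lattice a b = {\<omega>. \<forall>i\<in>Basis. \<exists>n::int. (\<omega> \<bullet> i) * ((b - a) \<bullet> i) = 2 * pi * of_int n}"

definition character :: "'a::euclidean_space \<Rightarrow> 'a \<Rightarrow> complex" where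
  "character \<omega> x = cis (\<omega> \<bullet> x)"

lemma sum_inner_Basis_sq: "(\<Sum>i\<in>Basis. (x \<bullet> i)\<^sup>2) = (norm x)\<^sup>2"
proof -
  have "(norm x)\<^sup>2 = x \<bullet> x" by (rule power2_norm_eq_inner)
  also have "\<dots> = (\<Sum>i\<in>Basis. (x \<bullet> i) * (x \<bullet> i))" by (rule euclidean_inner)
  finally show ?thesis by (simp add: power2_eq_square)
qed

lemma character_0 [simp]: "character 0 x = 1"
  by (simp add: character_def)

lemma cmod_character [simp]: "cmod (character \<omega> x) = 1"
  by (simp add: character_def)

lemma character_mult: "character \<omega> x * character \<nu> x = character (\<omega> + \<nu>) x"
  by (simp add: character_def cis_mult inner_left_distrib)

lemma character_add: "character \<omega> (x + y) = character \<omega> x * character \<omega> y"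
  by (simp add: character_def cis_mult inner_right_distrib)

lemma cnj_character: "cnj (character \<omega> x) = character (- \<omega>) x"
  by (simp add: character_def cis_cnj)

lemma continuous_character [continuous_intros]: "continuous_on S (character \<omega>)"
  unfolding character_def cis_conv_exp by (intro continuous_intros)

lemma measurable_character [measurable]: "character \<omega> \<in> borel_measurable (lebesgue_on D)"
proof -
  have "character \<omega> \<in> borel_measurable lborel"
    by (simp add: borel_measurable_continuous_onI continuous_character)
  then show ?thesis
    by (intro measurable_restrict_space1 measurable_completion)
qed

lemma dual_lattice_0 [simp]: "0 \<in> dual_lattice a b"
  by (auto simp: dual_lattice_def intro: exI[of _ 0])

lemma dual_lattice_minus: "\<omega> \<in> dual_lattice a b \<Longrightarrow> - \<omega> \<in> dual_lattice a b"
  unfolding dual_lattice_def by (auto, metis of_int_minus mult_minus_right)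

lemma dual_lattice_add:
  "\<omega> \<in> dual_lattice a b \<Longrightarrow> \<nu> \<in> dual_lattice a b \<Longrightarrow> \<omega> + \<nu> \<in> dual_lattice a b"
  unfolding dual_lattice_def by (auto simp: inner_left_distrib distrib_right, metis of_int_add distrib_left)

lemma dual_lattice_diff:
  "\<omega> \<in> dual_lattice a b \<Longrightarrow> \<nu> \<in> dual_lattice a b \<Longrightarrow> \<omega> - \<nu> \<in> dual_lattice a b"
  using dual_lattice_add[OF _ dual_lattice_minus] by fastforce

lemma character_periodic:
  assumes "\<omega> \<in> dual_lattice a b"
  shows "box_periodic a b (character \<omega>)"
  unfolding box_periodic_def
proof (intro ballI allI)
  fix i :: 'a and x :: 'a assume i: "i \<in> Basis"
  obtain n :: int where n: "(\<omega> \<bullet> i) * ((b - a) \<bullet> i) = 2 * pi * of_int n"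
    using assms i by (auto simp: dual_lattice_def)
  have "character \<omega> (((b - a) \<bullet> i) *\<^sub>R i) = cis (2 * pi * of_int n)"
    using n by (simp add: character_def mult.commute)
  also have "\<dots> = 1" by (rule cis_multiple_2pi) simp
  finally show "character \<omega> (x + ((b - a) \<bullet> i) *\<^sub>R i) = character \<omega> x"
    by (simp add: character_add)
qed

lemma character_has_vector_derivative:
  "((\<lambda>s. character \<omega> (x + s *\<^sub>R i)) has_vector_derivative \<i> * of_real (\<omega> \<bullet> i) * character \<omega> x) (at 0)"
proof -
  have "((\<lambda>z. exp (\<i> * (of_real (\<omega> \<bullet> x) + z * of_real (\<omega> \<bullet> i)))) has_field_derivative
      \<i> * of_real (\<omega> \<bullet> i) * exp (\<i> * of_real (\<omega> \<bullet> x))) (at (of_real 0))"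
    by (auto intro!: derivative_eq_intros)
  from has_vector_derivative_real_field[OF this] show ?thesis
    by (simp add: character_def cis_conv_exp inner_right_distrib)
qed

lemma partial_deriv_character:
  "partial_deriv i (\<lambda>x. c * character \<omega> x) = (\<lambda>x. (c * (\<i> * of_real (\<omega> \<bullet> i))) * character \<omega> x)"
proof
  fix x
  show "partial_deriv i (\<lambda>x. c * character \<omega> x) x = (c * (\<i> * of_real (\<omega> \<bullet> i))) * character \<omega> x"
    unfolding partial_deriv_def
    using vector_derivative_at[OF has_vector_derivative_mult_right[OF character_has_vector_derivative, of c \<omega> x i]]
    by (simp add: mult.assoc)
qed

lemma smooth_character: "smooth_fun (character \<omega>)"
proof -
  have fold: "\<exists>c. foldr partial_deriv bs (character \<omega>) = (\<lambda>x. c * character \<omega> x)" for bs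
  proof (induction bs)
    case Nil
    show ?case by (auto intro!: exI[of _ 1])
  next
    case (Cons i bs)
    then show ?case by (auto simp: partial_deriv_character)
  qed
  show ?thesis
    unfolding smooth_fun_def
  proof (intro ballI conjI allI)
    fix bs :: "'a list" and i x :: 'a
    obtain c where c: "foldr partial_deriv bs (character \<omega>) = (\<lambda>x. c * character \<omega> x)"
      using fold by blast
    show "continuous_on UNIV (foldr partial_deriv bs (character \<omega>))"
      unfolding c by (intro continuous_on_mult_left continuous_character)
    have "((\<lambda>s. c * character \<omega> (x + s *\<^sub>R i)) has_vector_derivative
        c * (\<i> * of_real (\<omega> \<bullet> i) * character \<omega> x)) (at 0)"
      by (rule has_vector_derivative_mult_right[OF character_has_vector_derivative])
    then show "(\<lambda>s. foldr partial_deriv bs (character \<omega>) (x + s *\<^sub>R i)) differentiable at 0"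
      unfolding c by (rule differentiableI_vector)
  qed
qed

lemma classical_laplacian_character:
  "classical_laplacian (character \<omega>) x = - of_real ((norm \<omega>)\<^sup>2) * character \<omega> x"
proof -
  have "partial_deriv i (partial_deriv i (character \<omega>)) x
      = (\<i> * of_real (\<omega> \<bullet> i)) * (\<i> * of_real (\<omega> \<bullet> i)) * character \<omega> x" for i
    using partial_deriv_character[of i 1 \<omega>] partial_deriv_character[of i "\<i> * of_real (\<omega> \<bullet> i)" \<omega>]
    by simp
  then have eq: "partial_deriv i (partial_deriv i (character \<omega>)) x
      = - of_real ((\<omega> \<bullet> i)\<^sup>2) * character \<omega> x" for i
    by (simp add: power2_eq_square algebra_simps)
  have "classical_laplacian (character \<omega>) x = (\<Sum>i\<in>Basis. - of_real ((\<omega> \<bullet> i)\<^sup>2) * character \<omega> x)"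
    unfolding classical_laplacian_def
    by (simp only: eq)
  also have "\<dots> = - of_real (\<Sum>i\<in>Basis. (\<omega> \<bullet> i)\<^sup>2) * character \<omega> x"
    by (simp add: sum_distrib_right sum_negf)
  also have "(\<Sum>i\<in>Basis. (\<omega> \<bullet> i)\<^sup>2) = (norm \<omega>)\<^sup>2"
    by (rule sum_inner_Basis_sq)
  finally show ?thesis .
qed

lemma smooth_fun_partial_deriv:
  assumes "smooth_fun f" "i \<in> Basis"
  shows "smooth_fun (partial_deriv i f)"
  unfolding smooth_fun_def
proof (intro ballI)
  fix bs :: "'a list" assume "bs \<in> lists Basis"
  then have "bs @ [i] \<in> lists Basis" using assms by auto
  then have "continuous_on UNIV (foldr partial_deriv (bs @ [i]) f) \<and>
        (\<forall>j\<in>Basis. \<forall>x. (\<lambda>s. foldr partial_deriv (bs @ [i]) f (x + s *\<^sub>R j)) differentiable (at (0::real)))"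
    using assms(1) unfolding smooth_fun_def by blast
  then show "continuous_on UNIV (foldr partial_deriv bs (partial_deriv i f)) \<and>
        (\<forall>j\<in>Basis. \<forall>x. (\<lambda>s. foldr partial_deriv bs (partial_deriv i f) (x + s *\<^sub>R j)) differentiable (at (0::real)))"
    by simp
qed

lemma smooth_fun_continuous: "smooth_fun f \<Longrightarrow> continuous_on UNIV f"
  unfolding smooth_fun_def by (auto dest: bspec[of _ _ "[]"])

lemma smooth_fun_has_partial_deriv:
  assumes "smooth_fun f" "i \<in> Basis"
  shows "((\<lambda>s. f (x + s *\<^sub>R i)) has_vector_derivative partial_deriv i f x) (at 0)"
proof -
  have "(\<lambda>s. foldr partial_deriv [] f (x + s *\<^sub>R i)) differentiable (at 0)"
    using assms unfolding smooth_fun_def by blast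
  then show ?thesis
    unfolding partial_deriv_def by (simp add: vector_derivative_works)
qed

lemma box_periodic_partial_deriv:
  assumes "box_periodic a b f"
  shows "box_periodic a b (partial_deriv i f)"
  unfolding box_periodic_def partial_deriv_def
proof (intro ballI allI)
  fix j x :: 'a assume j: "j \<in> Basis"
  have "f (x + ((b - a) \<bullet> j) *\<^sub>R j + s *\<^sub>R i) = f (x + s *\<^sub>R i)" for s
    using assms j unfolding box_periodic_def by (metis add.assoc add.commute)
  then show "vector_derivative (\<lambda>s. f (x + ((b - a) \<bullet> j) *\<^sub>R j + s *\<^sub>R i)) (at 0)
      = vector_derivative (\<lambda>s. f (x + s *\<^sub>R i)) (at 0)"
    by simp
qed

text \<open>The integral of the partial derivative of the product vanishes.\<close>

lemma integral_character_partial_deriv: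
  assumes \<omega>: "\<omega> \<in> dual_lattice a b" and i: "i \<in> Basis" and ab: "a \<bullet> i < b \<bullet> i"
    and f: "smooth_fun f" "box_periodic a b f"
  shows "integral (cbox a b) (\<lambda>x. character \<omega> x * partial_deriv i f x)
       = - (\<i> * of_real (\<omega> \<bullet> i)) * integral (cbox a b) (\<lambda>x. character \<omega> x * f x)"
proof -
  note cf = smooth_fun_continuous[OF f(1)]
    smooth_fun_continuous[OF smooth_fun_partial_deriv[OF f(1) i]]
  have c1: "continuous_on UNIV (\<lambda>x. character \<omega> x * f x)"
    and c2: "continuous_on UNIV (\<lambda>x. character \<omega> x * partial_deriv i f x)"
    using cf by (auto intro!: continuous_intros)
  have "integral (cbox a b) (\<lambda>x. character \<omega> x * partial_deriv i f x
      + \<i> * of_real (\<omega> \<bullet> i) * (character \<omega> x * f x)) = 0"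
  proof (rule integral_partial_deriv_periodic[OF i ab c1])
    fix x
    show "((\<lambda>s. character \<omega> (x + s *\<^sub>R i) * f (x + s *\<^sub>R i)) has_vector_derivative
        character \<omega> x * partial_deriv i f x + \<i> * of_real (\<omega> \<bullet> i) * (character \<omega> x * f x)) (at 0)"
      using has_vector_derivative_mult[OF character_has_vector_derivative[of \<omega> x i]
          smooth_fun_has_partial_deriv[OF f(1) i, of x]]
      by (simp add: mult.assoc)
    show "character \<omega> (x + ((b - a) \<bullet> i) *\<^sub>R i) * f (x + ((b - a) \<bullet> i) *\<^sub>R i) = character \<omega> x * f x"
      using character_periodic[OF \<omega>] f(2) i by (simp add: box_periodic_def)
  qed (use c1 c2 in \<open>auto intro!: continuous_intros\<close>)
  moreover have "(\<lambda>x. character \<omega> x * partial_deriv i f x) integrable_on cbox a b"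
    "(\<lambda>x. \<i> * of_real (\<omega> \<bullet> i) * (character \<omega> x * f x)) integrable_on cbox a b"
    by (intro continuous_UNIV_integrable_on_cbox c2 continuous_on_mult_left c1)+
  ultimately show ?thesis
    by (simp add: Henstock_Kurzweil_Integration.integral_add eq_neg_iff_add_eq_0)
qed

text \<open>A coordinate direction in which \<open>\<omega>\<close> does not vanish makes the character a multiple of its own
  partial derivative.\<close>

lemma character_orthogonal:
  assumes \<omega>: "\<omega> \<in> dual_lattice a b" "\<omega> \<noteq> 0" and ab: "\<And>i. i \<in> Basis \<Longrightarrow> a \<bullet> i < b \<bullet> i"
  shows "(LINT x|lebesgue_on (box a b). character \<omega> x) = 0"
proof -
  obtain i where i: "i \<in> Basis" "\<omega> \<bullet> i \<noteq> 0"
    using \<omega>(2) by (metis euclidean_all_zero_iff)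
  have per: "box_periodic a b (character 0)" by (rule character_periodic) simp
  have "partial_deriv i (character 0) = (\<lambda>x. 0)"
    using partial_deriv_character[of i 1 0] by (simp del: character_0)
  then have "integral (cbox a b) (character \<omega>) = 0"
    using integral_character_partial_deriv[OF \<omega>(1) i(1) ab[OF i(1)] smooth_character per] i(2)
    by simp
  then show ?thesis
    by (simp add: LINT_box_eq_integral continuous_character)
qed

lemma L2_character: "character \<omega> \<in> L2 (box a b)"
  by (rule L2_bounded[where B=1]) auto

text \<open>The distributional Laplacian is tested against smooth periodic functions, so both derivatives
  are moved onto the character.\<close>

lemma periodic_laplacian_character:
  assumes \<omega>: "\<omega> \<in> dual_lattice a b" and ab: "\<And>i. i \<in> Basis \<Longrightarrow> a \<bullet> i < b \<bullet> i"
  shows "periodic_laplacian a b (character \<omega>) (\<lambda>x. - of_real ((norm \<omega>)\<^sup>2) * character \<omega> x)"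
  unfolding periodic_laplacian_def
proof (intro conjI allI impI L2_character L2_cmult)
  fix f :: "'a \<Rightarrow> complex" assume "smooth_fun f \<and> box_periodic a b f"
  then have f: "smooth_fun f" "box_periodic a b f" by auto
  define I where "I = integral (cbox a b) (\<lambda>x. character \<omega> x * f x)"
  have "integral (cbox a b) (\<lambda>x. character \<omega> x * partial_deriv i (partial_deriv i f) x)
      = - of_real ((\<omega> \<bullet> i)\<^sup>2) * I" if i: "i \<in> Basis" for i
    unfolding I_def using f i
    by (simp add: integral_character_partial_deriv[OF \<omega> i ab[OF i]] smooth_fun_partial_deriv
        box_periodic_partial_deriv power2_eq_square algebra_simps)
  moreover have cont: "continuous_on UNIV (\<lambda>x. character \<omega> x * partial_deriv i (partial_deriv i f) x)"
    if "i \<in> Basis" for i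
    using f that by (intro continuous_intros smooth_fun_continuous smooth_fun_partial_deriv) auto
  ultimately have "integral (cbox a b) (\<lambda>x. \<Sum>i\<in>Basis. character \<omega> x * partial_deriv i (partial_deriv i f) x)
      = (\<Sum>i\<in>Basis. - of_real ((\<omega> \<bullet> i)\<^sup>2) * I)"
    by (subst integral_sum) (auto intro!: continuous_UNIV_integrable_on_cbox cont)
  also have "\<dots> = - of_real (\<Sum>i\<in>Basis. (\<omega> \<bullet> i)\<^sup>2) * I"
    by (simp add: sum_distrib_right sum_negf)
  also have "(\<Sum>i\<in>Basis. (\<omega> \<bullet> i)\<^sup>2) = (norm \<omega>)\<^sup>2"
    by (rule sum_inner_Basis_sq)
  finally have eq: "integral (cbox a b) (\<lambda>x. \<Sum>i\<in>Basis. character \<omega> x * partial_deriv i (partial_deriv i f) x)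
      = - of_real ((norm \<omega>)\<^sup>2) * I" .
  have "(LINT x|lebesgue_on (box a b). character \<omega> x * classical_laplacian f x)
      = integral (cbox a b) (\<lambda>x. \<Sum>i\<in>Basis. character \<omega> x * partial_deriv i (partial_deriv i f) x)"
    unfolding classical_laplacian_def sum_distrib_left
    by (rule LINT_box_eq_integral) (intro continuous_on_sum cont)
  moreover have "(LINT x|lebesgue_on (box a b). - of_real ((norm \<omega>)\<^sup>2) * character \<omega> x * f x)
      = - of_real ((norm \<omega>)\<^sup>2) * I"
  proof -
    have "continuous_on UNIV (\<lambda>x. character \<omega> x * f x)"
      using f by (intro continuous_intros smooth_fun_continuous)
    then show ?thesis
      unfolding I_def mult.assoc by (simp add: LINT_box_eq_integral)
  qed
  ultimately show "(LINT x|lebesgue_on (box a b). character \<omega> x * classical_laplacian f x)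
      = (LINT x|lebesgue_on (box a b). - of_real ((norm \<omega>)\<^sup>2) * character \<omega> x * f x)"
    using eq by simp
qed

section \<open>Density of trigonometric polynomials\<close>

definition trig_poly :: "'a::euclidean_space \<Rightarrow> 'a \<Rightarrow> ('a \<Rightarrow> complex) \<Rightarrow> bool" where
  "trig_poly a b p \<longleftrightarrow>
     (\<exists>K c. finite K \<and> K \<subseteq> dual_lattice a b \<and> p = (\<lambda>x. \<Sum>\<omega>\<in>K. c \<omega> * character \<omega> x))"

lemma trig_poly_cmult_character:
  assumes "\<omega> \<in> dual_lattice a b"
  shows "trig_poly a b (\<lambda>x. z * character \<omega> x)"
  unfolding trig_poly_def
  by (rule exI[of _ "{\<omega>}"], rule exI[of _ "\<lambda>_. z"]) (use assms in auto)

lemma trig_poly_const: "trig_poly a b (\<lambda>x. z)"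
  using trig_poly_cmult_character[OF dual_lattice_0, of a b z] by simp

lemma trig_poly_add:
  assumes "trig_poly a b p" "trig_poly a b q"
  shows "trig_poly a b (\<lambda>x. p x + q x)"
proof -
  obtain K c where K: "finite K" "K \<subseteq> dual_lattice a b" "p = (\<lambda>x. \<Sum>\<omega>\<in>K. c \<omega> * character \<omega> x)"
    using assms(1) unfolding trig_poly_def by blast
  obtain J d where J: "finite J" "J \<subseteq> dual_lattice a b" "q = (\<lambda>x. \<Sum>\<omega>\<in>J. d \<omega> * character \<omega> x)"
    using assms(2) unfolding trig_poly_def by blast
  define e where "e \<omega> = (if \<omega> \<in> K then c \<omega> else 0) + (if \<omega> \<in> J then d \<omega> else 0)" for \<omega>
  have "p x = (\<Sum>\<omega>\<in>K \<union> J. (if \<omega> \<in> K then c \<omega> else 0) * character \<omega> x)" for x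
    unfolding K(3) by (rule sum.mono_neutral_cong_left) (use K J in auto)
  moreover have "q x = (\<Sum>\<omega>\<in>K \<union> J. (if \<omega> \<in> J then d \<omega> else 0) * character \<omega> x)" for x
    unfolding J(3) by (rule sum.mono_neutral_cong_left) (use K J in auto)
  ultimately have "(\<lambda>x. p x + q x) = (\<lambda>x. \<Sum>\<omega>\<in>K \<union> J. e \<omega> * character \<omega> x)"
    by (simp add: e_def distrib_right sum.distrib)
  then show ?thesis
    unfolding trig_poly_def using K J by (intro exI[of _ "K \<union> J"] exI[of _ e]) auto
qed

lemma trig_poly_sum:
  "(\<And>i. i \<in> I \<Longrightarrow> trig_poly a b (p i)) \<Longrightarrow> trig_poly a b (\<lambda>x. \<Sum>i\<in>I. p i x)"
  by (induction I rule: infinite_finite_induct) (auto intro: trig_poly_const trig_poly_add)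

lemma trig_poly_cmult: "trig_poly a b p \<Longrightarrow> trig_poly a b (\<lambda>x. z * p x)"
  unfolding trig_poly_def
proof (elim exE conjE)
  fix K c assume "finite K" "K \<subseteq> dual_lattice a b" "p = (\<lambda>x. \<Sum>\<omega>\<in>K. c \<omega> * character \<omega> x)"
  then show "\<exists>K c. finite K \<and> K \<subseteq> dual_lattice a b \<and> (\<lambda>x. z * p x) = (\<lambda>x. \<Sum>\<omega>\<in>K. c \<omega> * character \<omega> x)"
    by (intro exI[of _ K] exI[of _ "\<lambda>\<omega>. z * c \<omega>"]) (auto simp: sum_distrib_left mult.assoc)
qed

lemma trig_poly_mult:
  assumes "trig_poly a b p" "trig_poly a b q"
  shows "trig_poly a b (\<lambda>x. p x * q x)"
proof -
  obtain K c where K: "finite K" "K \<subseteq> dual_lattice a b" "p = (\<lambda>x. \<Sum>\<omega>\<in>K. c \<omega> * character \<omega> x)"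
    using assms(1) unfolding trig_poly_def by blast
  obtain J d where J: "finite J" "J \<subseteq> dual_lattice a b" "q = (\<lambda>x. \<Sum>\<omega>\<in>J. d \<omega> * character \<omega> x)"
    using assms(2) unfolding trig_poly_def by blast
  have "(\<lambda>x. p x * q x) = (\<lambda>x. \<Sum>\<omega>\<in>K. \<Sum>\<nu>\<in>J. (c \<omega> * d \<nu>) * character (\<omega> + \<nu>) x)"
    unfolding K(3) J(3) sum_product character_mult[symmetric] by (simp add: algebra_simps)
  moreover have "trig_poly a b (\<lambda>x. \<Sum>\<omega>\<in>K. \<Sum>\<nu>\<in>J. (c \<omega> * d \<nu>) * character (\<omega> + \<nu>) x)"
    using K(2) J(2) by (intro trig_poly_sum trig_poly_cmult_character dual_lattice_add) auto
  ultimately show ?thesis by simp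
qed

lemma trig_poly_L2: "trig_poly a b p \<Longrightarrow> p \<in> L2 (box a b)"
  unfolding trig_poly_def by (auto intro!: L2_sum L2_cmult L2_character)

text \<open>The product of the circles \<open>x\<^sub>i mod (b\<^sub>i - a\<^sub>i)\<close>. Real polynomials on its image pull back to
  trigonometric polynomials, which brings density within reach of the Stone-Weierstrass theorem.\<close>

definition torus_map :: "'a::euclidean_space \<Rightarrow> 'a \<Rightarrow> 'a \<Rightarrow> 'a \<times> 'a" where
  "torus_map a b x =
     (\<Sum>i\<in>Basis. cos (2 * pi / ((b - a) \<bullet> i) * (x \<bullet> i)) *\<^sub>R i,
      \<Sum>i\<in>Basis. sin (2 * pi / ((b - a) \<bullet> i) * (x \<bullet> i)) *\<^sub>R i)"

lemma continuous_torus_map [continuous_intros]: "continuous_on S (torus_map a b)"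
  unfolding torus_map_def by (intro continuous_intros)

lemma torus_map_eq_iff:
  assumes ab: "\<And>i. i \<in> Basis \<Longrightarrow> a \<bullet> i < b \<bullet> i"
  shows "torus_map a b x = torus_map a b y \<longleftrightarrow>
    (\<forall>i\<in>Basis. \<exists>n::int. x \<bullet> i = y \<bullet> i + n * ((b - a) \<bullet> i))"
proof -
  have eq: "(\<Sum>i\<in>Basis. u i *\<^sub>R i) = (\<Sum>i\<in>Basis. v i *\<^sub>R i) \<longleftrightarrow> (\<forall>i\<in>Basis. u i = v i)"
    for u v :: "'a \<Rightarrow> real"
    by (subst euclidean_eq_iff) simp
  have "torus_map a b x = torus_map a b y \<longleftrightarrow> (\<forall>i\<in>Basis. \<exists>n::int.
      2 * pi / ((b - a) \<bullet> i) * (x \<bullet> i) = 2 * pi / ((b - a) \<bullet> i) * (y \<bullet> i) + 2 * pi * n)"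
    unfolding torus_map_def prod.inject eq using sin_cos_eq_iff by blast
  also have "\<dots> \<longleftrightarrow> (\<forall>i\<in>Basis. \<exists>n::int. x \<bullet> i = y \<bullet> i + n * ((b - a) \<bullet> i))"
  proof (intro ball_cong refl ex_cong1)
    fix i :: 'a and n :: int assume "i \<in> Basis"
    then have L: "(b - a) \<bullet> i > 0" using ab by (simp add: inner_diff_left)
    have "2 * pi / L * X = 2 * pi / L * Y + 2 * pi * n \<longleftrightarrow> X = Y + n * L" if "L > 0" for L X Y :: real
    proof -
      have "2 * pi / L * X = 2 * pi / L * Y + 2 * pi * n \<longleftrightarrow> 2 * pi / L * X = 2 * pi / L * (Y + n * L)"
        using that by (simp add: field_simps)
      also have "\<dots> \<longleftrightarrow> X = Y + n * L" using that by simp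
      finally show ?thesis .
    qed
    from this[OF L] show "2 * pi / ((b - a) \<bullet> i) * (x \<bullet> i) = 2 * pi / ((b - a) \<bullet> i) * (y \<bullet> i) + 2 * pi * n
      \<longleftrightarrow> x \<bullet> i = y \<bullet> i + n * ((b - a) \<bullet> i)" .
  qed
  finally show ?thesis .
qed

lemma torus_map_surj:
  assumes ab: "\<And>i. i \<in> Basis \<Longrightarrow> a \<bullet> i < b \<bullet> i"
  shows "\<exists>y\<in>cbox a b. torus_map a b x = torus_map a b y"
proof -
  define r where "r i = (x \<bullet> i - a \<bullet> i) / ((b - a) \<bullet> i)" for i
  define y where "y = (\<Sum>i\<in>Basis. (a \<bullet> i + frac (r i) * ((b - a) \<bullet> i)) *\<^sub>R i)"
  have y: "y \<bullet> i = a \<bullet> i + frac (r i) * ((b - a) \<bullet> i)" if "i \<in> Basis" for i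
    unfolding y_def using that by simp
  have L: "(b - a) \<bullet> i > 0" if "i \<in> Basis" for i
    using ab[OF that] by (simp add: inner_diff_left)
  have "y \<in> cbox a b"
    unfolding mem_box
  proof (intro ballI conjI)
    fix i :: 'a assume i: "i \<in> Basis"
    have "0 \<le> frac (r i) * ((b - a) \<bullet> i)"
      using L[OF i] by simp
    then show "a \<bullet> i \<le> y \<bullet> i" using y[OF i] by simp
    have "frac (r i) * ((b - a) \<bullet> i) \<le> 1 * ((b - a) \<bullet> i)"
      using L[OF i] less_imp_le[OF frac_lt_1[of "r i"]] by (intro mult_right_mono) auto
    then show "y \<bullet> i \<le> b \<bullet> i" using y[OF i] by (simp add: inner_diff_left)
  qed
  moreover have "x \<bullet> i = y \<bullet> i + of_int \<lfloor>r i\<rfloor> * ((b - a) \<bullet> i)" if i: "i \<in> Basis" for i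
  proof -
    have "y \<bullet> i + of_int \<lfloor>r i\<rfloor> * ((b - a) \<bullet> i) = a \<bullet> i + r i * ((b - a) \<bullet> i)"
      unfolding y[OF i] frac_def by (simp add: algebra_simps)
    also have "\<dots> = x \<bullet> i" using L[OF i] by (simp add: r_def)
    finally show ?thesis ..
  qed
  ultimately show ?thesis
    using torus_map_eq_iff[OF ab] by blast
qed

text \<open>Only boundary points of the box are identified with other points of it, so a function that
  vanishes on the boundary descends to the torus.\<close>

lemma torus_map_fibre:
  assumes ab: "\<And>i. i \<in> Basis \<Longrightarrow> a \<bullet> i < b \<bullet> i"
    and xy: "x \<in> cbox a b" "y \<in> cbox a b" "torus_map a b x = torus_map a b y"
    and x: "x \<in> box a b"
  shows "x = y"
proof (rule euclidean_eqI)
  fix i :: 'a assume i: "i \<in> Basis"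
  obtain n :: int where n: "x \<bullet> i = y \<bullet> i + n * ((b - a) \<bullet> i)"
    using xy(3) torus_map_eq_iff[OF ab] i by blast
  have L: "(b - a) \<bullet> i > 0" using ab[OF i] by (simp add: inner_diff_left)
  have "\<bar>x \<bullet> i - y \<bullet> i\<bar> < (b - a) \<bullet> i"
    using xy(2) x i by (fastforce simp: mem_box inner_diff_left)
  then have "\<bar>of_int n\<bar> * ((b - a) \<bullet> i) < 1 * ((b - a) \<bullet> i)"
    using n L by (simp add: abs_mult)
  then have "\<bar>of_int n :: real\<bar> < 1"
    using L mult_less_cancel_right_pos by blast
  then have "n = 0" by linarith
  then show "x \<bullet> i = y \<bullet> i" using n by simp
qed

lemma trig_poly_cos_sin:
  assumes ab: "\<And>i. i \<in> Basis \<Longrightarrow> a \<bullet> i < b \<bullet> i" and i: "i \<in> Basis"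
  shows "trig_poly a b (\<lambda>x. of_real (cos (2 * pi / ((b - a) \<bullet> i) * (x \<bullet> i))))"
    and "trig_poly a b (\<lambda>x. of_real (sin (2 * pi / ((b - a) \<bullet> i) * (x \<bullet> i))))"
proof -
  define \<omega> where "\<omega> = (2 * pi / ((b - a) \<bullet> i)) *\<^sub>R i"
  have L: "(b - a) \<bullet> i \<noteq> 0" using ab[OF i] by (simp add: inner_diff_left)
  have "(\<omega> \<bullet> j) * ((b - a) \<bullet> j) = 2 * pi * of_int (if i = j then 1 else 0)" if "j \<in> Basis" for j
    unfolding \<omega>_def using that i L by (cases "i = j") (simp_all add: inner_Basis)
  then have \<omega>: "\<omega> \<in> dual_lattice a b"
    unfolding dual_lattice_def by blast
  note \<omega>' = dual_lattice_minus[OF \<omega>]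
  have ch: "character \<omega> x = cis (2 * pi / ((b - a) \<bullet> i) * (x \<bullet> i))"
    "character (-\<omega>) x = cis (- (2 * pi / ((b - a) \<bullet> i) * (x \<bullet> i)))" for x
    by (simp_all add: character_def \<omega>_def inner_commute)
  have "trig_poly a b (\<lambda>x. 1/2 * character \<omega> x + 1/2 * character (-\<omega>) x)"
    by (intro trig_poly_add trig_poly_cmult_character \<omega> \<omega>')
  also have "(\<lambda>x. 1/2 * character \<omega> x + 1/2 * character (-\<omega>) x)
      = (\<lambda>x. of_real (cos (2 * pi / ((b - a) \<bullet> i) * (x \<bullet> i))))"
    unfolding ch by (auto simp: complex_eq_iff)
  finally show "trig_poly a b (\<lambda>x. of_real (cos (2 * pi / ((b - a) \<bullet> i) * (x \<bullet> i))))" .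
  have "trig_poly a b (\<lambda>x. (-\<i>/2) * character \<omega> x + (\<i>/2) * character (-\<omega>) x)"
    by (intro trig_poly_add trig_poly_cmult_character \<omega> \<omega>')
  also have "(\<lambda>x. (-\<i>/2) * character \<omega> x + (\<i>/2) * character (-\<omega>) x)
      = (\<lambda>x. of_real (sin (2 * pi / ((b - a) \<bullet> i) * (x \<bullet> i))))"
    unfolding ch by (auto simp: complex_eq_iff)
  finally show "trig_poly a b (\<lambda>x. of_real (sin (2 * pi / ((b - a) \<bullet> i) * (x \<bullet> i))))" .
qed

lemma trig_poly_polynomial_torus_map:
  assumes ab: "\<And>i. i \<in> Basis \<Longrightarrow> a \<bullet> i < b \<bullet> i" and q: "real_polynomial_function q"
  shows "trig_poly a b (\<lambda>x. of_real (q (torus_map a b x)))"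
  using q
proof induction
  case (linear f)
  then interpret bounded_linear f .
  have "f (torus_map a b x) = (\<Sum>i\<in>Basis. cos (2 * pi / ((b - a) \<bullet> i) * (x \<bullet> i)) * f (i, 0))
      + (\<Sum>i\<in>Basis. sin (2 * pi / ((b - a) \<bullet> i) * (x \<bullet> i)) * f (0, i))" for x
  proof -
    have eq: "torus_map a b x = (\<Sum>i\<in>Basis. cos (2 * pi / ((b - a) \<bullet> i) * (x \<bullet> i)) *\<^sub>R (i, 0))
      + (\<Sum>i\<in>Basis. sin (2 * pi / ((b - a) \<bullet> i) * (x \<bullet> i)) *\<^sub>R (0, i))"
      unfolding torus_map_def by (simp add: prod_eq_iff fst_sum snd_sum)
    show ?thesis unfolding eq add sum scaleR by simp
  qed
  moreover have "trig_poly a b (\<lambda>x. (\<Sum>i\<in>Basis. of_real (f (i, 0)) * of_real (cos (2 * pi / ((b - a) \<bullet> i) * (x \<bullet> i))))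
      + (\<Sum>i\<in>Basis. of_real (f (0, i)) * of_real (sin (2 * pi / ((b - a) \<bullet> i) * (x \<bullet> i)))))"
    by (intro trig_poly_add trig_poly_sum trig_poly_cmult trig_poly_cos_sin ab)
  ultimately show ?case by (simp add: mult.commute)
qed (auto intro: trig_poly_const trig_poly_add trig_poly_mult)

text \<open>The function descends to a continuous function on the compact image of the torus map. A polynomial
  within \<open>e/2\<close> of it is lifted by \<open>e/2\<close>, which makes it nonnegative on the box and by periodicity everywhere.\<close>

lemma trig_poly_uniform_approx:
  fixes h :: "'a::euclidean_space \<Rightarrow> real"
  assumes ab: "\<And>i. i \<in> Basis \<Longrightarrow> a \<bullet> i < b \<bullet> i"
    and cont: "continuous_on UNIV h" and h0: "\<And>x. 0 \<le> h x" and supp: "\<And>x. x \<notin> box a b \<Longrightarrow> h x = 0"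
    and e: "0 < e"
  obtains p where "trig_poly a b p" "\<And>x. p x \<in> \<real>\<^sub>\<ge>\<^sub>0"
    "\<And>x. x \<in> cbox a b \<Longrightarrow> cmod (of_real (h x) - p x) \<le> e"
proof -
  define S where "S = torus_map a b ` cbox a b"
  have fib: "h x = h y" if "x \<in> cbox a b" "y \<in> cbox a b" "torus_map a b x = torus_map a b y" for x y
    using torus_map_fibre[OF ab that] torus_map_fibre[OF ab that(2,1) that(3)[symmetric]] supp by metis
  define g where "g z = h (SOME x. x \<in> cbox a b \<and> torus_map a b x = z)" for z
  have g: "g (torus_map a b x) = h x" if "x \<in> cbox a b" for x
  proof -
    have "\<exists>y. y \<in> cbox a b \<and> torus_map a b y = torus_map a b x" using that by blast
    from someI_ex[OF this] show ?thesis
      unfolding g_def using fib that by blast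
  qed
  have S: "compact S"
    unfolding S_def by (intro compact_continuous_image continuous_torus_map compact_cbox)
  have contg: "continuous_on S g"
    unfolding continuous_on_closed_vimage[OF compact_imp_closed[OF S]]
  proof (intro allI impI)
    fix C :: "real set" assume "closed C"
    then have "closed (h -` C)"
      by (rule continuous_closed_vimage) (use cont in \<open>simp add: continuous_on_eq_continuous_at\<close>)
    then have "compact (cbox a b \<inter> h -` C)"
      by (intro compact_Int_closed compact_cbox)
    then have "compact (torus_map a b ` (cbox a b \<inter> h -` C))"
      by (intro compact_continuous_image continuous_torus_map)
    also have "torus_map a b ` (cbox a b \<inter> h -` C) = g -` C \<inter> S"
      unfolding S_def using g by auto
    finally show "closed (g -` C \<inter> S)" by (rule compact_imp_closed)
  qed
  obtain q where q: "real_polynomial_function q" "\<And>z. z \<in> S \<Longrightarrow> \<bar>g z - q z\<bar> < e / 2"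
    using Stone_Weierstrass_real_polynomial_function[OF S contg, of "e / 2"] e by auto
  have q': "\<bar>h x - q (torus_map a b x)\<bar> < e / 2" if "x \<in> cbox a b" for x
    using q(2)[of "torus_map a b x"] g[OF that] that by (auto simp: S_def)
  show ?thesis
  proof
    show "trig_poly a b (\<lambda>x. of_real (q (torus_map a b x)) + of_real (e / 2))"
      by (intro trig_poly_add trig_poly_const trig_poly_polynomial_torus_map ab q)
    show "of_real (q (torus_map a b x)) + of_real (e / 2) \<in> \<real>\<^sub>\<ge>\<^sub>0" for x
    proof -
      obtain y where "y \<in> cbox a b" "torus_map a b x = torus_map a b y"
        using torus_map_surj[OF ab] by blast
      then have "q (torus_map a b x) + e / 2 \<ge> 0"
        using q'[of y] h0[of y] abs_less_iff[of "h y - q (torus_map a b y)" "e / 2"] by simp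
      then show ?thesis
        unfolding of_real_add[symmetric] by (subst nonneg_Reals_of_real_iff)
    qed
    show "cmod (of_real (h x) - (of_real (q (torus_map a b x)) + of_real (e / 2))) \<le> e" if "x \<in> cbox a b" for x
      using q'[OF that] unfolding of_real_add[symmetric] of_real_diff[symmetric] norm_of_real by linarith
  qed
qed

lemma L2_dominated_convergence:
  assumes g: "\<And>n. g n \<in> borel_measurable (lebesgue_on D)" and f: "f \<in> borel_measurable (lebesgue_on D)"
    and w: "w \<in> L2 D" and le: "\<And>n. AE x in lebesgue_on D. cmod (g n x) \<le> cmod (w x)"
    and lim: "AE x in lebesgue_on D. (\<lambda>n. g n x) \<longlonglongrightarrow> f x"
  shows "f \<in> L2 D" and "(\<lambda>n. L2_norm D (\<lambda>x. g n x - f x)) \<longlonglongrightarrow> 0"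
proof -
  note [measurable] = g f L2_measurable[OF w]
  have "AE x in lebesgue_on D. \<forall>n. cmod (g n x) \<le> cmod (w x)"
    using le by (simp add: AE_all_countable)
  with lim have le_f: "AE x in lebesgue_on D. cmod (f x) \<le> cmod (w x)"
  proof eventually_elim
    case (elim x)
    then show ?case by (intro LIMSEQ_le_const2[OF tendsto_norm[OF elim(1)]]) auto
  qed
  then show "f \<in> L2 D" by (intro L2_dominated[OF w f])
  have "(\<lambda>n. LINT x|lebesgue_on D. (cmod (g n x - f x))\<^sup>2) \<longlonglongrightarrow> (LINT x|lebesgue_on D. 0)"
  proof (rule integral_dominated_convergence[where w="\<lambda>x. 4 * (cmod (w x))\<^sup>2"])
    show "integrable (lebesgue_on D) (\<lambda>x. 4 * (cmod (w x))\<^sup>2)"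
      using L2_integrable[OF w] by simp
    show "AE x in lebesgue_on D. (\<lambda>n. (cmod (g n x - f x))\<^sup>2) \<longlonglongrightarrow> 0"
      using lim
    proof eventually_elim
      case (elim x)
      have "(\<lambda>n. (cmod (g n x - f x))\<^sup>2) \<longlonglongrightarrow> (cmod (f x - f x))\<^sup>2"
        by (intro tendsto_intros elim)
      then show ?case by simp
    qed
    show "AE x in lebesgue_on D. norm ((cmod (g n x - f x))\<^sup>2) \<le> 4 * (cmod (w x))\<^sup>2" for n
      using le[of n] le_f
    proof eventually_elim
      case (elim x)
      have "cmod (g n x - f x) \<le> 2 * cmod (w x)"
        using norm_triangle_ineq4[of "g n x" "f x"] elim by linarith
      then have "(cmod (g n x - f x))\<^sup>2 \<le> (2 * cmod (w x))\<^sup>2"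
        by (intro power_mono) auto
      then show ?case by (simp add: power_mult_distrib)
    qed
  qed measurable
  then have "(\<lambda>n. sqrt (LINT x|lebesgue_on D. (cmod (g n x - f x))\<^sup>2)) \<longlonglongrightarrow> sqrt 0"
    by (intro tendsto_real_sqrt) simp
  then show "(\<lambda>n. L2_norm D (\<lambda>x. g n x - f x)) \<longlonglongrightarrow> 0"
    by (simp add: L2_norm_def)
qed

lemma L2_approx_bounded:
  fixes f :: "'a::euclidean_space \<Rightarrow> real"
  assumes f: "(\<lambda>x. of_real (f x)) \<in> L2 D" "\<And>x. 0 \<le> f x" and e: "0 < e"
  obtains B :: real where "0 \<le> B" "L2_norm D (\<lambda>x. of_real (f x) - of_real (min (f x) B)) < e"
proof -
  note [measurable] = L2_measurable[OF f(1)]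
  have [measurable]: "f \<in> borel_measurable (lebesgue_on D)"
    using measurable_compose[OF L2_measurable[OF f(1)] borel_measurable_Re] by simp
  have "(\<lambda>n. L2_norm D (\<lambda>x. of_real (min (f x) (real n)) - of_real (f x))) \<longlonglongrightarrow> 0"
  proof (rule L2_dominated_convergence[OF _ _ f(1)])
    show "AE x in lebesgue_on D. (\<lambda>n. complex_of_real (min (f x) (real n))) \<longlonglongrightarrow> of_real (f x)"
    proof (intro AE_I2 tendsto_of_real)
      fix x
      have "eventually (\<lambda>n. min (f x) (real n) = f x) sequentially"
        using eventually_ge_at_top[of "nat \<lceil>f x\<rceil>"] by eventually_elim linarith
      then show "(\<lambda>n. min (f x) (real n)) \<longlonglongrightarrow> f x"
        by (rule tendsto_eventually)
    qed
  qed (use f(2) in auto)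
  then have "eventually (\<lambda>n. L2_norm D (\<lambda>x. of_real (min (f x) (real n)) - of_real (f x)) < e) sequentially"
    using e by (rule order_tendstoD)
  then obtain n where "L2_norm D (\<lambda>x. of_real (min (f x) (real n)) - of_real (f x)) < e"
    by (auto simp: eventually_sequentially)
  then show ?thesis
    by (intro that[of "real n"]) (auto simp: L2_norm_minus_commute)
qed

text \<open>A measurable function is an almost everywhere limit of continuous functions. Clipping these to
  \<open>[0, B]\<close> and cutting them off near the boundary keeps the limit and provides a dominating constant.\<close>

lemma L2_approx_continuous:
  fixes f :: "'a::euclidean_space \<Rightarrow> real"
  assumes D: "open D" "D \<in> lmeasurable" "D \<noteq> UNIV"
    and f: "f \<in> borel_measurable (lebesgue_on D)" "\<And>x. 0 \<le> f x" "\<And>x. f x \<le> B" and e: "0 < e"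
  obtains h :: "'a \<Rightarrow> real" where "continuous_on UNIV h" "\<And>x. 0 \<le> h x" "\<And>x. x \<notin> D \<Longrightarrow> h x = 0"
    "L2_norm D (\<lambda>x. of_real (f x) - of_real (h x)) < e"
proof -
  have Dm: "D \<in> sets lebesgue" using D(2) by (simp add: fmeasurableD)
  note [measurable] = f(1)
  obtain N and g :: "nat \<Rightarrow> 'a \<Rightarrow> real" where g: "negligible N" "\<And>n. continuous_on UNIV (g n)"
    "\<And>x. x \<notin> N \<Longrightarrow> (\<lambda>n. g n x) \<longlonglongrightarrow> (if x \<in> D then f x else 0)"
    using measurable_on_iff_borel_measurable[OF Dm, THEN iffD2, OF f(1)]
    unfolding measurable_on_def by blast
  define h where "h n x = min (real n * infdist x (- D)) 1 * min (max (g n x) 0) B" for n x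
  have ne: "- D \<noteq> {}" using D(3) by blast
  have conth: "continuous_on UNIV (h n)" for n
    unfolding h_def by (intro continuous_intros g(2))
  have B: "0 \<le> B" using f(2,3) order_trans by blast
  have h0: "0 \<le> h n x" for n x
    unfolding h_def using B by (intro mult_nonneg_nonneg) (auto simp: infdist_nonneg)
  have hB: "h n x \<le> B" for n x
  proof -
    have "h n x \<le> 1 * B"
      unfolding h_def using B by (intro mult_mono) (auto simp: infdist_nonneg)
    then show ?thesis by simp
  qed
  have hm [measurable]: "h n \<in> borel_measurable (lebesgue_on D)" for n
    by (rule continuous_imp_measurable_on_sets_lebesgue[OF continuous_on_subset[OF conth] Dm]) simp
  have N: "AE x in lebesgue_on D. x \<notin> N"
    using g(1) Dm AE_not_in[of N lebesgue]
    by (auto simp: negligible_iff_null_sets AE_restrict_space_iff elim!: eventually_mono)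
  have lim: "AE x in lebesgue_on D. (\<lambda>n. complex_of_real (h n x)) \<longlonglongrightarrow> of_real (f x)"
    using N AE_space
  proof eventually_elim
    case (elim x)
    then have x: "x \<in> D" by simp
    then have pos: "0 < infdist x (- D)"
      using in_closed_iff_infdist_zero[of "- D" x] D(1) ne infdist_nonneg[of x "- D"]
      by (auto simp: closed_def less_le)
    have "(\<lambda>n. min (real n * infdist x (- D)) 1) \<longlonglongrightarrow> 1"
    proof (rule tendsto_eventually)
      show "eventually (\<lambda>n. min (real n * infdist x (- D)) 1 = 1) sequentially"
        using eventually_ge_at_top[of "nat \<lceil>1 / infdist x (- D)\<rceil>"]
      proof eventually_elim
        case (elim n)
        then have "1 / infdist x (- D) \<le> real n" by linarith
        then show ?case using pos by (simp add: field_simps)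
      qed
    qed
    moreover have "(\<lambda>n. min (max (g n x) 0) B) \<longlonglongrightarrow> min (max (f x) 0) B"
      using g(3)[of x] elim x by (intro tendsto_min tendsto_max tendsto_const) auto
    ultimately have "(\<lambda>n. h n x) \<longlonglongrightarrow> 1 * min (max (f x) 0) B"
      unfolding h_def by (rule tendsto_mult)
    then have "(\<lambda>n. h n x) \<longlonglongrightarrow> f x"
      using f(2)[of x] f(3)[of x] by (simp add: max_absorb1 min_absorb1)
    then show ?case by (rule tendsto_of_real)
  qed
  have "(\<lambda>n. L2_norm D (\<lambda>x. of_real (h n x) - of_real (f x))) \<longlonglongrightarrow> 0"
    by (rule L2_dominated_convergence(2)[where w="\<lambda>_. of_real B"])
      (use h0 hB B lim in \<open>auto intro!: L2_bounded[OF D(2), where B=B]\<close>)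
  then have "eventually (\<lambda>n. L2_norm D (\<lambda>x. of_real (h n x) - of_real (f x)) < e) sequentially"
    using e by (rule order_tendstoD)
  then obtain n where "L2_norm D (\<lambda>x. of_real (h n x) - of_real (f x)) < e"
    by (auto simp: eventually_sequentially)
  then show ?thesis
    using conth h0 by (intro that[of "h n"]) (auto simp: L2_norm_minus_commute h_def)
qed

lemma L2_norm_le_bound:
  assumes D: "D \<in> lmeasurable" and B: "0 \<le> B" and f: "\<And>x. x \<in> D \<Longrightarrow> cmod (f x) \<le> B"
    and fm: "f \<in> borel_measurable (lebesgue_on D)"
  shows "L2_norm D f \<le> B * sqrt (measure lebesgue D)"
proof -
  have "L2_norm D f \<le> L2_norm D (\<lambda>x. of_real B * 1)"
    by (rule L2_norm_mono[OF _ fm]) (use f B in \<open>auto intro!: AE_I2 L2_bounded[OF D, where B=B]\<close>)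
  also have "\<dots> = B * sqrt (measure lebesgue D)"
    unfolding L2_norm_cmult using B D by (simp add: L2_norm_def measure_restrict_space fmeasurableD)
  finally show ?thesis .
qed

text \<open>Truncation, approximation by a continuous function vanishing outside the box, and uniform
  approximation of that by a polynomial. Keeping the polynomial nonnegative is what allows positivity
  of the heat semigroup to be checked on trigonometric polynomials.\<close>

lemma trig_poly_dense_nonneg:
  fixes f :: "'a::euclidean_space \<Rightarrow> real"
  assumes ab: "\<And>i. i \<in> Basis \<Longrightarrow> a \<bullet> i < b \<bullet> i"
    and f: "(\<lambda>x. of_real (f x)) \<in> L2 (box a b)" "\<And>x. 0 \<le> f x" and e: "0 < e"
  obtains p where "trig_poly a b p" "\<And>x. p x \<in> \<real>\<^sub>\<ge>\<^sub>0"
    "L2_norm (box a b) (\<lambda>x. of_real (f x) - p x) < e"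
proof -
  have D: "open (box a b)" "box a b \<in> lmeasurable" "box a b \<noteq> UNIV"
    using bounded_box[of a b] by (auto simp: open_box)
  obtain B where B: "0 \<le> B" "L2_norm (box a b) (\<lambda>x. of_real (f x) - of_real (min (f x) B)) < e / 3"
    using L2_approx_bounded[OF f, of "e / 3"] e by auto
  have fm [measurable]: "f \<in> borel_measurable (lebesgue_on (box a b))"
    using measurable_compose[OF L2_measurable[OF f(1)] borel_measurable_Re] by simp
  obtain h :: "'a \<Rightarrow> real" where h: "continuous_on UNIV h" "\<And>x. 0 \<le> h x" "\<And>x. x \<notin> box a b \<Longrightarrow> h x = 0"
    "L2_norm (box a b) (\<lambda>x. of_real (min (f x) B) - of_real (h x)) < e / 3"
    using L2_approx_continuous[OF D, of "\<lambda>x. min (f x) B" B "e / 3"] e f(2) B(1) by auto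
  define m where "m = sqrt (measure lebesgue (box a b))"
  define d where "d = e / (3 * (m + 1))"
  have m: "0 \<le> m" by (simp add: m_def)
  then have d: "0 < d" "d * m < e / 3" using e by (auto simp: d_def field_simps)
  obtain p where p: "trig_poly a b p" "\<And>x. p x \<in> \<real>\<^sub>\<ge>\<^sub>0"
    "\<And>x. x \<in> cbox a b \<Longrightarrow> cmod (of_real (h x) - p x) \<le> d"
    using trig_poly_uniform_approx[OF ab h(1-3) d(1)] by blast
  have hm: "(\<lambda>x. complex_of_real (h x)) \<in> borel_measurable (lebesgue_on (box a b))"
    by (rule continuous_imp_measurable_on_sets_lebesgue)
      (use continuous_on_subset[OF h(1)] in \<open>auto intro!: continuous_intros\<close>)
  have h2: "(\<lambda>x. complex_of_real (h x)) \<in> L2 (box a b)"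
  proof -
    have "bounded ((\<lambda>x. complex_of_real (h x)) ` cbox a b)"
      by (intro compact_imp_bounded compact_continuous_image continuous_intros
          continuous_on_subset[OF h(1)]) auto
    then obtain C where "\<And>x. x \<in> cbox a b \<Longrightarrow> cmod (of_real (h x)) \<le> C"
      unfolding bounded_iff by blast
    then show ?thesis
      using box_subset_cbox[of a b] by (intro L2_bounded[OF D(2) hm]) blast
  qed
  have f2: "(\<lambda>x. complex_of_real (min (f x) B)) \<in> L2 (box a b)"
    by (rule L2_dominated[OF f(1)]) (use f(2) B(1) in auto)
  have "L2_norm (box a b) (\<lambda>x. of_real (h x) - p x) \<le> d * m"
    unfolding m_def using d(1) p(3) box_subset_cbox[of a b] L2_measurable[OF L2_diff[OF h2 trig_poly_L2[OF p(1)]]]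
    by (intro L2_norm_le_bound D) auto
  moreover have "L2_norm (box a b) (\<lambda>x. of_real (f x) - p x)
      \<le> L2_norm (box a b) (\<lambda>x. of_real (f x) - of_real (min (f x) B))
      + (L2_norm (box a b) (\<lambda>x. of_real (min (f x) B) - of_real (h x))
      + L2_norm (box a b) (\<lambda>x. of_real (h x) - p x))"
    using L2_norm_triangle_diff[OF f(1) f2 trig_poly_L2[OF p(1)]]
      L2_norm_triangle_diff[OF f2 h2 trig_poly_L2[OF p(1)]] by linarith
  ultimately have "L2_norm (box a b) (\<lambda>x. of_real (f x) - p x) < e"
    using B(2) h(4) d(2) by linarith
  then show ?thesis using p that by blast
qed

text \<open>Split into the positive and negative parts of the real and imaginary parts: with \<open>s\<^sub>k\<close> running through
  \<open>1, -1, i, -i\<close>, \<open>f\<close> is the sum of the \<open>s\<^sub>k\<close> times the positive part of the real part of \<open>cnj s\<^sub>k f\<close>.\<close>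

lemma trig_poly_dense:
  assumes ab: "\<And>i. i \<in> Basis \<Longrightarrow> a \<bullet> i < b \<bullet> i" and f: "f \<in> L2 (box a b)" and e: "0 < e"
  obtains p where "trig_poly a b p" "L2_norm (box a b) (\<lambda>x. f x - p x) < e"
proof -
  note [measurable] = L2_measurable[OF f]
  \<comment> \<open>The value at indices from \<open>4\<close> on only has to have modulus at most \<open>1\<close>.\<close>
  define s :: "nat \<Rightarrow> complex" where "s = (\<lambda>_. 0)(0 := 1, 1 := -1, 2 := \<i>, 3 := -\<i>)"
  define u where "u k x = max (Re (cnj (s k) * f x)) 0" for k x
  have s: "cmod (s k) \<le> 1" for k by (simp add: s_def)
  have u2: "(\<lambda>x. of_real (u k x)) \<in> L2 (box a b)" for k
  proof (rule L2_dominated[OF f])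
    have "cmod (of_real (u k x)) \<le> cmod (f x)" for x
    proof -
      have "\<bar>Re (cnj (s k) * f x)\<bar> \<le> cmod (cnj (s k) * f x)" by (rule abs_Re_le_cmod)
      also have "\<dots> \<le> 1 * cmod (f x)"
        unfolding norm_mult using s[of k] by (intro mult_right_mono) auto
      finally show ?thesis by (simp add: u_def)
    qed
    then show "AE x in lebesgue_on (box a b). cmod (of_real (u k x)) \<le> cmod (f x)" by simp
  qed (unfold u_def, measurable)
  have "\<exists>p. trig_poly a b p \<and> L2_norm (box a b) (\<lambda>x. of_real (u k x) - p x) < e / 5" for k
  proof -
    have "0 \<le> u k x" for x by (simp add: u_def)
    moreover have "0 < e / 5" using e by simp
    ultimately obtain p where "trig_poly a b p" "L2_norm (box a b) (\<lambda>x. of_real (u k x) - p x) < e / 5"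
      using trig_poly_dense_nonneg[OF ab u2] by blast
    then show ?thesis by blast
  qed
  then obtain p where p: "\<And>k. trig_poly a b (p k)"
    "\<And>k. L2_norm (box a b) (\<lambda>x. of_real (u k x) - p k x) < e / 5"
    by metis
  have four: "(\<Sum>k<4. w k) = w 0 + w 1 + w 2 + w 3" for w :: "nat \<Rightarrow> complex"
    by (simp add: eval_nat_numeral)
  have f_eq: "f x = (\<Sum>k<4. s k * of_real (u k x))" for x
    unfolding four by (auto simp: s_def u_def complex_eq_iff max_def)
  let ?q = "\<lambda>x. \<Sum>k<4. s k * p k x"
  have "L2_norm (box a b) (\<lambda>x. f x - ?q x) = L2_norm (box a b) (\<lambda>x. \<Sum>k<4. s k * (of_real (u k x) - p k x))"
    by (simp add: f_eq sum_subtractf right_diff_distrib)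
  also have "\<dots> \<le> (\<Sum>k<4. L2_norm (box a b) (\<lambda>x. s k * (of_real (u k x) - p k x)))"
    by (intro L2_norm_sum_le L2_cmult L2_diff u2 trig_poly_L2 p)
  also have "\<dots> \<le> (\<Sum>k<(4::nat). e / 5)"
  proof (rule sum_mono)
    fix k
    have "cmod (s k) * L2_norm (box a b) (\<lambda>x. of_real (u k x) - p k x) \<le> 1 * (e / 5)"
      using s p(2)[of k] by (intro mult_mono) auto
    then show "L2_norm (box a b) (\<lambda>x. s k * (of_real (u k x) - p k x)) \<le> e / 5"
      by (simp add: L2_norm_cmult)
  qed
  also have "\<dots> < e" using e by simp
  finally have "L2_norm (box a b) (\<lambda>x. f x - ?q x) < e" .
  moreover have "trig_poly a b ?q" by (intro trig_poly_sum trig_poly_cmult p)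
  ultimately show ?thesis using that by blast
qed

text \<open>Completeness of the characters: \<open>\<parallel>f\<parallel>\<^sup>2\<close> is the integral of \<open>f\<close> times \<open>cnj f\<close> minus any trigonometric
  polynomial, and the latter difference can be made small.\<close>

lemma L2_eq_0_if_orthogonal_characters:
  assumes ab: "\<And>i. i \<in> Basis \<Longrightarrow> a \<bullet> i < b \<bullet> i" and f: "f \<in> L2 (box a b)"
    and orth: "\<And>\<omega>. \<omega> \<in> dual_lattice a b \<Longrightarrow> (LINT x|lebesgue_on (box a b). f x * character \<omega> x) = 0"
  shows "AE x in lebesgue_on (box a b). f x = 0"
proof -
  have orth_p: "(LINT x|lebesgue_on (box a b). f x * p x) = 0" if p: "trig_poly a b p" for p
  proof -
    obtain K c where K: "finite K" "K \<subseteq> dual_lattice a b" "p = (\<lambda>x. \<Sum>\<omega>\<in>K. c \<omega> * character \<omega> x)"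
      using p unfolding trig_poly_def by blast
    have "(LINT x|lebesgue_on (box a b). f x * p x)
        = (LINT x|lebesgue_on (box a b). (\<Sum>\<omega>\<in>K. c \<omega> * (f x * character \<omega> x)))"
      unfolding K(3) sum_distrib_left by (simp add: algebra_simps)
    also have "\<dots> = (\<Sum>\<omega>\<in>K. LINT x|lebesgue_on (box a b). c \<omega> * (f x * character \<omega> x))"
      by (intro Bochner_Integration.integral_sum integrable_mult_right L2_mult_integrable f L2_character)
    also have "\<dots> = 0" using K(2) orth by (intro sum.neutral) auto
    finally show ?thesis .
  qed
  note cf = L2_cnj[OF f]
  have cn: "L2_norm (box a b) (\<lambda>x. cnj (f x)) = L2_norm (box a b) f"
    by (simp add: L2_norm_def)
  have small: "(L2_norm (box a b) f)\<^sup>2 \<le> L2_norm (box a b) f * e" if e: "0 < e" for e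
  proof -
    obtain p where p: "trig_poly a b p" "L2_norm (box a b) (\<lambda>x. cnj (f x) - p x) < e"
      using trig_poly_dense[OF ab cf e] by blast
    have "complex_of_real ((L2_norm (box a b) f)\<^sup>2) = (LINT x|lebesgue_on (box a b). f x * cnj (f x))"
      unfolding L2_norm_sq integral_complex_of_real[symmetric] complex_norm_square ..
    also have "\<dots> = (LINT x|lebesgue_on (box a b). f x * (cnj (f x) - p x))"
      using orth_p[OF p(1)] L2_mult_integrable[OF f cf] L2_mult_integrable[OF f trig_poly_L2[OF p(1)]]
      by (simp add: right_diff_distrib)
    finally have "cmod (complex_of_real ((L2_norm (box a b) f)\<^sup>2))
        = cmod (LINT x|lebesgue_on (box a b). f x * (cnj (f x) - p x))" by (rule arg_cong)
    then have "(L2_norm (box a b) f)\<^sup>2 \<le> L2_norm (box a b) f * L2_norm (box a b) (\<lambda>x. cnj (f x) - p x)"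
      using L2_integral_mult_le[OF f L2_diff[OF cf trig_poly_L2[OF p(1)]]] by (simp add: norm_power)
    also have "\<dots> \<le> L2_norm (box a b) f * e"
      using p(2) by (intro mult_left_mono) auto
    finally show ?thesis .
  qed
  have "L2_norm (box a b) f = 0"
  proof (rule ccontr)
    assume n: "L2_norm (box a b) f \<noteq> 0"
    then have "0 < L2_norm (box a b) f" by (simp add: less_le)
    with small[of "L2_norm (box a b) f / 2"] show False
      by (simp add: power2_eq_square)
  qed
  then show ?thesis using L2_norm_eq_0_iff[OF f] by simp
qed

section \<open>Finite Fourier expansions\<close>

lemma box_measure_pos:
  assumes "\<And>i. i \<in> Basis \<Longrightarrow> a \<bullet> i < b \<bullet> i"
  shows "0 < measure lebesgue (box a b)"
proof -
  have "measure lborel (box a b) = (\<Prod>i\<in>Basis. (b - a) \<bullet> i)"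
    using less_imp_le[OF assms] by (intro measure_lborel_box) auto
  then show ?thesis
    using assms by (simp add: measure_completion inner_diff_left prod_pos)
qed

lemma LINT_box_1: "(LINT x|lebesgue_on (box a b). 1 :: complex) = of_real (measure lebesgue (box a b))"
  by (simp add: measure_restrict_space scaleR_conv_of_real)

lemma L2_norm_character: "L2_norm (box a b) (character \<omega>) = sqrt (measure lebesgue (box a b))"
  by (simp add: L2_norm_def measure_restrict_space)

lemma character_integral_mult:
  assumes "\<And>i. i \<in> Basis \<Longrightarrow> a \<bullet> i < b \<bullet> i" "\<omega> \<in> dual_lattice a b" "\<nu> \<in> dual_lattice a b"
  shows "(LINT x|lebesgue_on (box a b). character \<omega> x * character (- \<nu>) x)
    = (if \<omega> = \<nu> then of_real (measure lebesgue (box a b)) else 0)"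
proof (cases "\<omega> = \<nu>")
  case True
  then show ?thesis using LINT_box_1[of a b] by (simp add: character_mult)
next
  case False
  then show ?thesis
    using character_orthogonal[OF dual_lattice_diff[OF assms(2,3)] _ assms(1)]
    by (simp add: character_mult)
qed

definition fourier_coeff :: "'a::euclidean_space \<Rightarrow> 'a \<Rightarrow> ('a \<Rightarrow> complex) \<Rightarrow> 'a \<Rightarrow> complex" where
  "fourier_coeff a b f \<nu> =
     (LINT x|lebesgue_on (box a b). f x * character (- \<nu>) x) / of_real (measure lebesgue (box a b))"

lemma cmod_fourier_coeff_le:
  assumes ab: "\<And>i. i \<in> Basis \<Longrightarrow> a \<bullet> i < b \<bullet> i" and f: "f \<in> L2 (box a b)"
  shows "cmod (fourier_coeff a b f \<nu>) \<le> L2_norm (box a b) f / sqrt (measure lebesgue (box a b))"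
proof -
  define m where "m = measure lebesgue (box a b)"
  have m: "0 < m" unfolding m_def by (rule box_measure_pos[OF ab])
  have "cmod (fourier_coeff a b f \<nu>) \<le> (L2_norm (box a b) f * sqrt m) / m"
    using L2_integral_mult_le[OF f L2_character, of "-\<nu>"] m
    unfolding fourier_coeff_def L2_norm_character norm_divide m_def[symmetric]
    by (simp add: divide_right_mono)
  also have "\<dots> = L2_norm (box a b) f / sqrt m"
    using m by (simp add: field_simps)
  finally show ?thesis by (simp add: m_def)
qed

lemma fourier_coeff_trig_poly:
  assumes ab: "\<And>i. i \<in> Basis \<Longrightarrow> a \<bullet> i < b \<bullet> i"
    and K: "finite K" "K \<subseteq> dual_lattice a b" and \<nu>: "\<nu> \<in> dual_lattice a b"
  shows "fourier_coeff a b (\<lambda>x. \<Sum>\<omega>\<in>K. c \<omega> * character \<omega> x) \<nu> = (if \<nu> \<in> K then c \<nu> else 0)"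
proof -
  define m where "m = measure lebesgue (box a b)"
  have m: "0 < m" unfolding m_def by (rule box_measure_pos[OF ab])
  have "(LINT x|lebesgue_on (box a b). (\<Sum>\<omega>\<in>K. c \<omega> * character \<omega> x) * character (-\<nu>) x)
      = (LINT x|lebesgue_on (box a b). (\<Sum>\<omega>\<in>K. c \<omega> * (character \<omega> x * character (-\<nu>) x)))"
    by (simp add: sum_distrib_right mult.assoc)
  also have "\<dots> = (\<Sum>\<omega>\<in>K. c \<omega> * (LINT x|lebesgue_on (box a b). character \<omega> x * character (-\<nu>) x))"
    by (subst Bochner_Integration.integral_sum)
       (auto intro!: integrable_mult_right L2_mult_integrable L2_character)
  also have "\<dots> = (\<Sum>\<omega>\<in>K. if \<omega> = \<nu> then c \<omega> * of_real m else 0)"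
    using K(2) \<nu> by (intro sum.cong) (auto simp: character_integral_mult[OF ab] m_def)
  also have "\<dots> = (if \<nu> \<in> K then c \<nu> * of_real m else 0)"
    using K(1) by (simp add: sum.delta)
  finally show ?thesis
    using m by (simp add: fourier_coeff_def m_def)
qed

lemma fourier_expansion_finite:
  assumes ab: "\<And>i. i \<in> Basis \<Longrightarrow> a \<bullet> i < b \<bullet> i" and f: "f \<in> L2 (box a b)"
    and K: "finite K" "K \<subseteq> dual_lattice a b"
    and f0: "\<And>\<nu>. \<nu> \<in> dual_lattice a b \<Longrightarrow> \<nu> \<notin> K \<Longrightarrow> fourier_coeff a b f \<nu> = 0"
  shows "AE x in lebesgue_on (box a b). f x = (\<Sum>\<omega>\<in>K. fourier_coeff a b f \<omega> * character \<omega> x)"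
proof -
  define p where "p = (\<lambda>x. \<Sum>\<omega>\<in>K. fourier_coeff a b f \<omega> * character \<omega> x)"
  have p: "p \<in> L2 (box a b)"
    unfolding p_def by (intro L2_sum L2_cmult L2_character)
  have m: "0 < measure lebesgue (box a b)" by (rule box_measure_pos[OF ab])
  have "AE x in lebesgue_on (box a b). f x - p x = 0"
  proof (rule L2_eq_0_if_orthogonal_characters[OF ab L2_diff[OF f p]])
    fix \<omega> assume \<omega>: "\<omega> \<in> dual_lattice a b"
    have "fourier_coeff a b f (-\<omega>) = fourier_coeff a b p (-\<omega>)"
      using fourier_coeff_trig_poly[OF ab K dual_lattice_minus[OF \<omega>], of "fourier_coeff a b f"]
        f0[OF dual_lattice_minus[OF \<omega>]] unfolding p_def by (auto split: if_splits)
    then have "(LINT x|lebesgue_on (box a b). f x * character \<omega> x)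
        = (LINT x|lebesgue_on (box a b). p x * character \<omega> x)"
      using m by (simp add: fourier_coeff_def)
    then show "(LINT x|lebesgue_on (box a b). (f x - p x) * character \<omega> x) = 0"
      using L2_mult_integrable[OF f L2_character] L2_mult_integrable[OF p L2_character]
      by (simp add: left_diff_distrib)
  qed
  then show ?thesis by (simp add: p_def)
qed

lemma parseval_trig_poly:
  assumes ab: "\<And>i. i \<in> Basis \<Longrightarrow> a \<bullet> i < b \<bullet> i"
    and K: "finite K" "K \<subseteq> dual_lattice a b"
  shows "(L2_norm (box a b) (\<lambda>x. \<Sum>\<omega>\<in>K. c \<omega> * character \<omega> x))\<^sup>2
    = measure lebesgue (box a b) * (\<Sum>\<omega>\<in>K. (cmod (c \<omega>))\<^sup>2)"
proof -
  define m where "m = measure lebesgue (box a b)"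
  define p where "p = (\<lambda>x. \<Sum>\<omega>\<in>K. c \<omega> * character \<omega> x)"
  have p: "p \<in> L2 (box a b)"
    unfolding p_def by (intro L2_sum L2_cmult L2_character)
  have m: "0 < m" unfolding m_def by (rule box_measure_pos[OF ab])
  have "complex_of_real ((L2_norm (box a b) p)\<^sup>2) = (LINT x|lebesgue_on (box a b). p x * cnj (p x))"
    unfolding L2_norm_sq integral_complex_of_real[symmetric] complex_norm_square ..
  also have "\<dots> = (LINT x|lebesgue_on (box a b). (\<Sum>\<omega>\<in>K. cnj (c \<omega>) * (p x * character (-\<omega>) x)))"
  proof (rule Bochner_Integration.integral_cong[OF refl])
    fix x
    have "cnj (p x) = (\<Sum>\<omega>\<in>K. cnj (c \<omega>) * character (-\<omega>) x)"
      by (simp add: p_def cnj_character)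
    then show "p x * cnj (p x) = (\<Sum>\<omega>\<in>K. cnj (c \<omega>) * (p x * character (-\<omega>) x))"
      by (simp add: sum_distrib_left mult.left_commute)
  qed
  also have "\<dots> = (\<Sum>\<omega>\<in>K. cnj (c \<omega>) * (LINT x|lebesgue_on (box a b). p x * character (-\<omega>) x))"
    by (subst Bochner_Integration.integral_sum)
       (auto intro!: integrable_mult_right L2_mult_integrable L2_character p)
  also have "\<dots> = (\<Sum>\<omega>\<in>K. cnj (c \<omega>) * (of_real m * c \<omega>))"
  proof (rule sum.cong[OF refl])
    fix \<omega> assume "\<omega> \<in> K"
    then have "fourier_coeff a b p \<omega> = c \<omega>"
      unfolding p_def using fourier_coeff_trig_poly[OF ab K, of \<omega> c] K(2) by auto
    then show "cnj (c \<omega>) * (LINT x|lebesgue_on (box a b). p x * character (-\<omega>) x)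
        = cnj (c \<omega>) * (of_real m * c \<omega>)"
      using m by (auto simp: fourier_coeff_def m_def field_simps)
  qed
  also have "\<dots> = of_real (m * (\<Sum>\<omega>\<in>K. (cmod (c \<omega>))\<^sup>2))"
    by (simp add: sum_distrib_left complex_norm_square mult.left_commute mult.commute del: of_real_power)
  finally show ?thesis unfolding of_real_eq_iff m_def p_def .
qed

text \<open>The eigenspaces of the periodic Laplacian are finite-dimensional.\<close>

lemma finite_dual_lattice_sphere:
  assumes ab: "\<And>i. i \<in> Basis \<Longrightarrow> a \<bullet> i < b \<bullet> i"
  shows "finite {\<nu> \<in> dual_lattice a b. norm \<nu> = R}"
proof -
  define L where "L i = (b - a) \<bullet> i" for i
  have L: "0 < L i" if "i \<in> Basis" for i
    using ab[OF that] by (simp add: L_def inner_diff_left)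
  define N :: "'a \<Rightarrow> int" where "N i = \<lceil>R * L i\<rceil>" for i
  define F :: "('a \<Rightarrow> int) \<Rightarrow> 'a" where "F k = (\<Sum>i\<in>Basis. (2 * pi * k i / L i) *\<^sub>R i)" for k
  have "{\<nu> \<in> dual_lattice a b. norm \<nu> = R} \<subseteq> F ` (PiE Basis (\<lambda>i. {- N i..N i}))"
  proof clarify
    fix \<nu> assume \<nu>: "\<nu> \<in> dual_lattice a b" "R = norm \<nu>"
    then obtain k :: "'a \<Rightarrow> int" where k: "\<And>i. i \<in> Basis \<Longrightarrow> (\<nu> \<bullet> i) * L i = 2 * pi * k i"
      unfolding dual_lattice_def L_def by (auto simp: Bex_def) metis
    define k' where "k' = restrict k Basis"
    have "\<nu> = F k'"
    proof (rule euclidean_eqI)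
      fix i :: 'a assume i: "i \<in> Basis"
      then have "F k' \<bullet> i = 2 * pi * k i / L i"
        by (simp add: F_def k'_def)
      also have "\<dots> = \<nu> \<bullet> i"
        unfolding k[OF i, symmetric] using L[OF i] by simp
      finally show "\<nu> \<bullet> i = F k' \<bullet> i" ..
    qed
    moreover have "k' \<in> PiE Basis (\<lambda>i. {- N i..N i})"
    proof (rule PiE_I)
      fix i :: 'a assume i: "i \<in> Basis"
      have "\<bar>real_of_int (k i)\<bar> \<le> 2 * pi * \<bar>real_of_int (k i)\<bar>"
        using pi_gt3 by (intro mult_right_mono[of 1 "2 * pi" "\<bar>real_of_int (k i)\<bar>", simplified]) auto
      also have "\<dots> = \<bar>2 * pi * real_of_int (k i)\<bar>" by (simp add: abs_mult)
      also have "\<dots> = \<bar>\<nu> \<bullet> i\<bar> * L i"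
        unfolding k[OF i, symmetric] using L[OF i] by (simp add: abs_mult)
      also have "\<dots> \<le> R * L i"
        using Basis_le_norm[OF i, of \<nu>] L[OF i] \<nu>(2) by (intro mult_right_mono) auto
      finally have "\<bar>k i\<bar> \<le> N i" unfolding N_def by linarith
      then show "k' i \<in> {- N i..N i}" using i by (auto simp: k'_def)
    qed (simp add: k'_def)
    ultimately show "\<nu> \<in> F ` (PiE Basis (\<lambda>i. {- N i..N i}))" by blast
  qed
  moreover have "finite (F ` (PiE Basis (\<lambda>i. {- N i..N i})))"
    by (intro finite_imageI finite_PiE) auto
  ultimately show ?thesis by (rule finite_subset)
qed

section \<open>The heat semigroup on trigonometric polynomials\<close>

locale periodic_heat =
  fixes a b :: "'a::euclidean_space" and T :: "real \<Rightarrow> ('a \<Rightarrow> complex) \<Rightarrow> 'a \<Rightarrow> complex"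
  assumes ab: "\<And>i. i \<in> Basis \<Longrightarrow> a \<bullet> i < b \<bullet> i"
    and heat: "periodic_heat_semigroup a b T"
begin

abbreviation "D \<equiv> box a b"
abbreviation "\<mu> \<equiv> lebesgue_on (box a b)"

lemma
  shows T_L2: "0 \<le> t \<Longrightarrow> f \<in> L2 D \<Longrightarrow> T t f \<in> L2 D"
    and T_linear: "0 \<le> t \<Longrightarrow> f \<in> L2 D \<Longrightarrow> g \<in> L2 D \<Longrightarrow>
      AE x in \<mu>. T t (\<lambda>y. c * f y + g y) x = c * T t f x + T t g x"
    and T_bounded: "0 \<le> t \<Longrightarrow> \<exists>C. \<forall>f\<in>L2 D. L2_norm D (T t f) \<le> C * L2_norm D f"
    and T_0: "f \<in> L2 D \<Longrightarrow> AE x in \<mu>. T 0 f x = f x"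
    and T_semigroup: "0 \<le> s \<Longrightarrow> 0 \<le> t \<Longrightarrow> f \<in> L2 D \<Longrightarrow> AE x in \<mu>. T (s + t) f x = T s (T t f) x"
    and T_generator: "f \<in> L2 D \<Longrightarrow> g \<in> L2 D \<Longrightarrow> periodic_laplacian a b f g \<longleftrightarrow>
        ((\<lambda>h. L2_norm D (\<lambda>x. (T h f x - f x) / of_real h - g x)) \<longlongrightarrow> 0) (at_right 0)"
  using heat unfolding periodic_heat_semigroup_def strongly_continuous_semigroup_def has_generator_def
  by blast+

lemma T_bound:
  assumes "0 \<le> t"
  obtains C where "0 \<le> C" "\<And>f. f \<in> L2 D \<Longrightarrow> L2_norm D (T t f) \<le> C * L2_norm D f"
proof -
  obtain C where C: "\<And>f. f \<in> L2 D \<Longrightarrow> L2_norm D (T t f) \<le> C * L2_norm D f"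
    using T_bounded[OF assms] by blast
  have "L2_norm D (T t f) \<le> \<bar>C\<bar> * L2_norm D f" if "f \<in> L2 D" for f
    using C[OF that] mult_right_mono[OF abs_ge_self[of C] L2_norm_nonneg[of D f]] by linarith
  then show ?thesis using that[of "\<bar>C\<bar>"] by simp
qed

lemma T_zero: "0 \<le> t \<Longrightarrow> AE x in \<mu>. T t (\<lambda>_. 0) x = 0"
  using T_linear[of t "\<lambda>_. 0" "\<lambda>_. 0" 1] by (auto elim!: eventually_mono)

lemma T_cmult: "0 \<le> t \<Longrightarrow> f \<in> L2 D \<Longrightarrow> AE x in \<mu>. T t (\<lambda>y. c * f y) x = c * T t f x"
  using T_linear[of t f "\<lambda>_. 0" c] T_zero[of t] by (auto elim!: eventually_elim2)

lemma T_add: "0 \<le> t \<Longrightarrow> f \<in> L2 D \<Longrightarrow> g \<in> L2 D \<Longrightarrow> AE x in \<mu>. T t (\<lambda>y. f y + g y) x = T t f x + T t g x"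
  using T_linear[of t f g 1] by simp

lemma T_diff:
  assumes "0 \<le> t" "f \<in> L2 D" "g \<in> L2 D"
  shows "AE x in \<mu>. T t (\<lambda>y. f y - g y) x = T t f x - T t g x"
  using T_linear[of t g f "-1"] assms by (auto elim!: eventually_mono)

lemma T_cong:
  assumes t: "0 \<le> t" and f: "f \<in> L2 D" "g \<in> L2 D" and eq: "AE x in \<mu>. f x = g x"
  shows "AE x in \<mu>. T t f x = T t g x"
proof -
  obtain C where C: "\<And>f. f \<in> L2 D \<Longrightarrow> L2_norm D (T t f) \<le> C * L2_norm D f"
    using T_bound[OF t] by blast
  note d = L2_diff[OF f]
  have "L2_norm D (\<lambda>x. f x - g x) = 0"
    unfolding L2_norm_eq_0_iff[OF d] using eq by (auto elim!: eventually_mono)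
  then have "L2_norm D (T t (\<lambda>x. f x - g x)) = 0"
    using C[OF d] L2_norm_nonneg[of D "T t (\<lambda>x. f x - g x)"] by simp
  then have "AE x in \<mu>. T t (\<lambda>x. f x - g x) x = 0"
    using L2_norm_eq_0_iff[OF T_L2[OF t d]] by simp
  then show ?thesis using T_diff[OF t f] by eventually_elim simp
qed

lemma T_sum:
  assumes t: "0 \<le> t" and f: "\<And>i. i \<in> I \<Longrightarrow> f i \<in> L2 D"
  shows "AE x in \<mu>. T t (\<lambda>y. \<Sum>i\<in>I. c i * f i y) x = (\<Sum>i\<in>I. c i * T t (f i) x)"
  using f
proof (induction I rule: infinite_finite_induct)
  case (insert i I)
  have "AE x in \<mu>. T t (\<lambda>y. c i * f i y + (\<Sum>i\<in>I. c i * f i y)) x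
      = c i * T t (f i) x + T t (\<lambda>y. \<Sum>i\<in>I. c i * f i y) x"
    using insert by (intro T_linear t L2_sum L2_cmult) auto
  moreover have "AE x in \<mu>. T t (\<lambda>y. \<Sum>i\<in>I. c i * f i y) x = (\<Sum>i\<in>I. c i * T t (f i) x)"
    using insert by auto
  ultimately show ?case
    using insert by (auto elim!: eventually_elim2)
qed (use T_zero[OF t] in auto)

lemma T_norm_diff_le:
  assumes t: "0 \<le> t" and f: "f \<in> L2 D" "g \<in> L2 D" and C: "\<And>f. f \<in> L2 D \<Longrightarrow> L2_norm D (T t f) \<le> C * L2_norm D f"
  shows "L2_norm D (\<lambda>x. T t f x - T t g x) \<le> C * L2_norm D (\<lambda>x. f x - g x)"
proof -
  have "L2_norm D (\<lambda>x. T t f x - T t g x) = L2_norm D (T t (\<lambda>x. f x - g x))"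
    using T_diff[OF t f]
    by (intro L2_norm_cong_AE L2_measurable L2_diff T_L2 t f) (auto elim!: eventually_mono)
  then show ?thesis using C[OF L2_diff[OF f]] by simp
qed

text \<open>A semigroup maps the domain of its generator to itself and commutes with the generator there.\<close>

lemma T_eigenfunction:
  assumes t: "0 \<le> t" and f: "f \<in> L2 D" and eig: "periodic_laplacian a b f (\<lambda>x. z * f x)"
  shows "periodic_laplacian a b (T t f) (\<lambda>x. z * T t f x)"
proof -
  note Tf = T_L2[OF t f]
  obtain C where C: "0 \<le> C" "\<And>f. f \<in> L2 D \<Longrightarrow> L2_norm D (T t f) \<le> C * L2_norm D f"
    using T_bound[OF t] by blast
  define q where "q h = (\<lambda>x. (T h f x - f x) / of_real h - z * f x)" for h
  have lim: "((\<lambda>h. L2_norm D (q h)) \<longlongrightarrow> 0) (at_right 0)"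
    unfolding q_def using eig T_generator[OF f L2_cmult[OF f]] by simp
  have le: "L2_norm D (\<lambda>x. (T h (T t f) x - T t f x) / of_real h - z * T t f x) \<le> C * L2_norm D (q h)"
    if h: "0 < h" for h
  proof -
    note Th = T_L2[OF less_imp_le[OF h] f]
    define g where "g = (\<lambda>y. (- (1 / of_real h) - z) * f y)"
    have g2: "g \<in> L2 D" unfolding g_def by (intro L2_cmult f)
    have q_eq: "q h = (\<lambda>y. (1 / of_real h) * T h f y + g y)"
      by (auto simp: q_def g_def diff_divide_distrib algebra_simps)
    have q2: "q h \<in> L2 D"
      unfolding q_eq by (intro L2_add L2_cmult Th g2)
    have "AE x in \<mu>. T t (q h) x = (1 / of_real h) * T t (T h f) x + T t g x"
      unfolding q_eq by (intro T_linear t Th g2)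
    moreover have "AE x in \<mu>. T t g x = (- (1 / of_real h) - z) * T t f x"
      unfolding g_def by (intro T_cmult t f)
    moreover have "AE x in \<mu>. T (t + h) f x = T t (T h f) x" "AE x in \<mu>. T (t + h) f x = T h (T t f) x"
      using T_semigroup[of t h f] T_semigroup[of h t f] t h f by (simp_all add: add.commute)
    ultimately have "AE x in \<mu>. (T h (T t f) x - T t f x) / of_real h - z * T t f x = T t (q h) x"
      by eventually_elim (simp add: diff_divide_distrib algebra_simps)
    then have "L2_norm D (\<lambda>x. (T h (T t f) x - T t f x) / of_real h - z * T t f x) = L2_norm D (T t (q h))"
      using L2_diff[OF L2_cmult[OF L2_diff[OF T_L2[OF less_imp_le[OF h] Tf] Tf], of "1 / of_real h"] L2_cmult[OF Tf, of z]]
      by (intro L2_norm_cong_AE L2_measurable T_L2 t q2) simp_all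
    also have "\<dots> \<le> C * L2_norm D (q h)" by (rule C(2)[OF q2])
    finally show ?thesis .
  qed
  have "((\<lambda>h. L2_norm D (\<lambda>x. (T h (T t f) x - T t f x) / of_real h - z * T t f x)) \<longlongrightarrow> 0) (at_right 0)"
  proof (rule tendsto_sandwich[OF _ _ tendsto_const])
    show "((\<lambda>h. C * L2_norm D (q h)) \<longlongrightarrow> 0) (at_right 0)"
      using tendsto_mult_right_zero[OF lim] by simp
    show "\<forall>\<^sub>F h in at_right 0. L2_norm D (\<lambda>x. (T h (T t f) x - T t f x) / of_real h - z * T t f x) \<le> C * L2_norm D (q h)"
      using eventually_at_right_less[of 0] le by (auto elim!: eventually_mono)
  qed simp
  then show ?thesis
    using T_generator[OF Tf L2_cmult[OF Tf]] by simp
qed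

text \<open>\<open>T t\<close> of a character is again an eigenfunction, and eigenfunctions for different eigenvalues are
  orthogonal. Hence \<open>T t\<close> maps the span of the characters on a sphere of frequencies into itself.\<close>

lemma fourier_coeff_T_character:
  assumes t: "0 \<le> t" and \<omega>: "\<omega> \<in> dual_lattice a b" "\<nu> \<in> dual_lattice a b" and ne: "norm \<nu> \<noteq> norm \<omega>"
  shows "fourier_coeff a b (T t (character \<omega>)) \<nu> = 0"
proof -
  define u where "u = T t (character \<omega>)"
  define I where "I = (LINT x|\<mu>. u x * character (-\<nu>) x)"
  have "periodic_laplacian a b u (\<lambda>x. - of_real ((norm \<omega>)\<^sup>2) * u x)"
    unfolding u_def by (intro T_eigenfunction t L2_character periodic_laplacian_character ab \<omega>)
  then have "(LINT x|\<mu>. u x * classical_laplacian (character (-\<nu>)) x)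
      = (LINT x|\<mu>. - of_real ((norm \<omega>)\<^sup>2) * u x * character (-\<nu>) x)"
    using smooth_character[of "-\<nu>"] character_periodic[OF dual_lattice_minus[OF \<omega>(2)]]
    unfolding periodic_laplacian_def by blast
  moreover have "(LINT x|\<mu>. u x * classical_laplacian (character (-\<nu>)) x) = - of_real ((norm \<nu>)\<^sup>2) * I"
    unfolding I_def integral_mult_right_zero[symmetric] classical_laplacian_character
    by (simp add: mult.left_commute)
  moreover have "(LINT x|\<mu>. - of_real ((norm \<omega>)\<^sup>2) * u x * character (-\<nu>) x) = - of_real ((norm \<omega>)\<^sup>2) * I"
    unfolding I_def integral_mult_right_zero[symmetric] by (simp add: mult.assoc)
  ultimately have "of_real ((norm \<nu>)\<^sup>2 - (norm \<omega>)\<^sup>2) * I = 0"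
    by (simp add: algebra_simps)
  moreover have "(norm \<nu>)\<^sup>2 - (norm \<omega>)\<^sup>2 \<noteq> 0"
    using ne by (simp add: power2_eq_iff_nonneg)
  ultimately have "I = 0" by (metis mult_eq_0_iff of_real_eq_0_iff)
  then show ?thesis by (simp add: fourier_coeff_def I_def u_def)
qed

text \<open>The right derivative of \<open>e\<^bsup>h|\<omega>|\<^sup>2\<^esup> T h\<close> at \<open>h = 0\<close>, applied to the character, vanishes.\<close>

lemma T_character_rate:
  assumes \<omega>: "\<omega> \<in> dual_lattice a b"
  shows "((\<lambda>h. L2_norm D (\<lambda>x. of_real (exp ((norm \<omega>)\<^sup>2 * h)) * T h (character \<omega>) x - character \<omega> x) / h)
    \<longlongrightarrow> 0) (at_right 0)"
proof -
  define r where "r = (norm \<omega>)\<^sup>2"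
  define q where "q h = (\<lambda>x. (T h (character \<omega>) x - character \<omega> x) / of_real h
      - (- of_real r) * character \<omega> x)" for h
  define c where "c h = (exp (r * h) - 1) / h - r * exp (r * h)" for h
  define m where "m = sqrt (measure lebesgue D)"
  have q0: "((\<lambda>h. L2_norm D (q h)) \<longlongrightarrow> 0) (at_right 0)"
    using periodic_laplacian_character[OF \<omega> ab] T_generator[OF L2_character L2_cmult[OF L2_character]]
    unfolding q_def r_def by blast
  have c0: "(c \<longlongrightarrow> 0) (at_right 0)"
  proof -
    have "((\<lambda>h. exp (r * h)) has_real_derivative r) (at 0)"
      by (auto intro!: derivative_eq_intros)
    then have "((\<lambda>h. (exp (r * h) - 1) / h) \<longlongrightarrow> r) (at 0)"
      by (simp add: DERIV_def)
    then have 1: "((\<lambda>h. (exp (r * h) - 1) / h) \<longlongrightarrow> r) (at_right 0)"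
      by (rule filterlim_mono) (auto simp: at_within_le_at)
    have "((\<lambda>h. r * exp (r * h)) \<longlongrightarrow> r * exp (r * 0)) (at_right 0)"
      by (intro tendsto_intros)
    from tendsto_diff[OF 1 this] show ?thesis by (simp add: c_def[abs_def])
  qed
  have le: "L2_norm D (\<lambda>x. of_real (exp (r * h)) * T h (character \<omega>) x - character \<omega> x) / h
      \<le> exp (r * h) * L2_norm D (q h) + \<bar>c h\<bar> * m" if h: "0 < h" for h
  proof -
    have q2: "q h \<in> L2 D"
      using L2_diff[OF L2_cmult[OF L2_diff[OF T_L2[OF less_imp_le[OF h] L2_character] L2_character],
            of "1 / of_real h"] L2_cmult[OF L2_character, of "- of_real r" \<omega>]]
      by (simp add: q_def)
    \<comment> \<open>The remainder splits into the defect \<open>q h\<close> of the difference quotient and a scalar defect \<open>c h\<close>.\<close>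
    have eq: "(\<lambda>x. of_real (exp (r * h)) * T h (character \<omega>) x - character \<omega> x)
        = (\<lambda>x. of_real h * (of_real (exp (r * h)) * q h x + of_real (c h) * character \<omega> x))"
    proof
      fix x
      have "h * c h = exp (r * h) - 1 - h * (r * exp (r * h))"
        using h by (simp add: c_def field_simps)
      from arg_cong[OF this, of complex_of_real]
      have "of_real h * of_real (c h) = (of_real (exp (r * h)) - 1 - of_real h * (of_real r * of_real (exp (r * h))) :: complex)"
        by (simp del: of_real_exp)
      moreover have "of_real h * q h x = T h (character \<omega>) x - character \<omega> x + of_real h * (of_real r * character \<omega> x)"
        using h by (simp add: q_def field_simps)
      ultimately show "of_real (exp (r * h)) * T h (character \<omega>) x - character \<omega> x
          = of_real h * (of_real (exp (r * h)) * q h x + of_real (c h) * character \<omega> x)"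
        by algebra
    qed
    have "L2_norm D (\<lambda>x. of_real (exp (r * h)) * T h (character \<omega>) x - character \<omega> x)
        = h * L2_norm D (\<lambda>x. of_real (exp (r * h)) * q h x + of_real (c h) * character \<omega> x)"
      unfolding eq L2_norm_cmult using h by simp
    also have "\<dots> \<le> h * (exp (r * h) * L2_norm D (q h) + \<bar>c h\<bar> * m)"
      using h L2_norm_triangle[OF L2_cmult[OF q2, of "of_real (exp (r * h))"] L2_cmult[OF L2_character, of "of_real (c h)" \<omega> a b]]
      unfolding L2_norm_cmult L2_norm_character m_def
      by (intro mult_left_mono) (simp_all del: of_real_exp)
    finally show ?thesis
      using h by (simp add: field_simps)
  qed
  show ?thesis
    unfolding r_def[symmetric]
  proof (rule tendsto_sandwich[OF _ _ tendsto_const])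
    have "((\<lambda>h. exp (r * h) * L2_norm D (q h) + \<bar>c h\<bar> * m) \<longlongrightarrow> exp (r * 0) * 0 + \<bar>0\<bar> * m) (at_right 0)"
      by (intro tendsto_intros q0 c0)
    then show "((\<lambda>h. exp (r * h) * L2_norm D (q h) + \<bar>c h\<bar> * m) \<longlongrightarrow> 0) (at_right 0)"
      by simp
    show "\<forall>\<^sub>F h in at_right 0. L2_norm D (\<lambda>x. of_real (exp (r * h)) * T h (character \<omega>) x - character \<omega> x) / h
        \<le> exp (r * h) * L2_norm D (q h) + \<bar>c h\<bar> * m"
      using eventually_at_right_less[of 0] le by (auto elim!: eventually_mono)
    show "\<forall>\<^sub>F h in at_right 0. 0 \<le> L2_norm D (\<lambda>x. of_real (exp (r * h)) * T h (character \<omega>) x - character \<omega> x) / h"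
      using eventually_at_right_less[of 0] by (auto elim!: eventually_mono)
  qed
qed

text \<open>A vanishing right derivative forces \<open>W t = e\<^bsup>t|\<omega>|\<^sup>2\<^esup> T t\<close> to fix the character only if the norms of \<open>W h\<close>
  are controlled for small \<open>h\<close>, and a bound for each single time does not give that. On the
  finite-dimensional invariant span of the sphere of frequencies, strong convergence does: there
  \<open>\<parallel>W h u - u\<parallel> \<le> R h \<parallel>u\<parallel>\<close> with \<open>R h = o(h)\<close>. Splitting \<open>[0, t]\<close> into \<open>n\<close> steps gives
  \<open>\<parallel>W t e - e\<parallel> \<le> ((1 + R (t/n))\<^sup>n - 1) \<parallel>e\<parallel>\<close>, which tends to \<open>0\<close>.\<close>

lemma T_character:
  assumes t: "0 \<le> t" and \<omega>: "\<omega> \<in> dual_lattice a b"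
  shows "AE x in \<mu>. T t (character \<omega>) x = of_real (exp (- t * (norm \<omega>)\<^sup>2)) * character \<omega> x"
proof -
  define e where "e = character \<omega>"
  define r where "r = (norm \<omega>)\<^sup>2"
  define K where "K = {\<nu> \<in> dual_lattice a b. norm \<nu> = norm \<omega>}"
  define m where "m = sqrt (measure lebesgue D)"
  define R where "R h = (\<Sum>\<nu>\<in>K. L2_norm D (\<lambda>x. of_real (exp (r * h)) * T h (character \<nu>) x - character \<nu> x) / m)" for h
  have m: "0 < m" using box_measure_pos[OF ab] by (simp add: m_def)
  have K: "finite K" "K \<subseteq> dual_lattice a b"
    unfolding K_def using finite_dual_lattice_sphere[OF ab] by auto
  have e2: "e \<in> L2 D" unfolding e_def by (rule L2_character)
  have R0: "0 \<le> R h" for h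
    unfolding R_def using m by (intro sum_nonneg) auto
  have step: "L2_norm D (\<lambda>x. of_real (exp (r * h)) * T h u x - u x) \<le> R h * L2_norm D u"
    if h: "0 \<le> h" and u: "u \<in> L2 D" and uK: "\<And>\<nu>. \<nu> \<in> dual_lattice a b \<Longrightarrow> \<nu> \<notin> K \<Longrightarrow> fourier_coeff a b u \<nu> = 0"
    for h u
  proof -
    define c where "c = fourier_coeff a b u"
    define p where "p = (\<lambda>x. \<Sum>\<nu>\<in>K. c \<nu> * character \<nu> x)"
    have p2: "p \<in> L2 D" unfolding p_def by (intro L2_sum L2_cmult L2_character)
    have up: "AE x in \<mu>. u x = p x"
      unfolding p_def c_def by (rule fourier_expansion_finite[OF ab u K uK])
    have d2: "(\<lambda>x. of_real (exp (r * h)) * T h (character \<nu>) x - character \<nu> x) \<in> L2 D" for \<nu>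
      by (intro L2_diff L2_cmult T_L2 h L2_character)
    have "AE x in \<mu>. T h p x = (\<Sum>\<nu>\<in>K. c \<nu> * T h (character \<nu>) x)"
      unfolding p_def by (intro T_sum h L2_character)
    with up T_cong[OF h u p2 up]
    have "AE x in \<mu>. of_real (exp (r * h)) * T h u x - u x
        = (\<Sum>\<nu>\<in>K. c \<nu> * (of_real (exp (r * h)) * T h (character \<nu>) x - character \<nu> x))"
      by eventually_elim (simp add: p_def sum_distrib_left sum_subtractf right_diff_distrib mult.left_commute)
    then have "L2_norm D (\<lambda>x. of_real (exp (r * h)) * T h u x - u x)
        = L2_norm D (\<lambda>x. \<Sum>\<nu>\<in>K. c \<nu> * (of_real (exp (r * h)) * T h (character \<nu>) x - character \<nu> x))"
      by (intro L2_norm_cong_AE L2_measurable L2_sum L2_diff L2_cmult T_L2 h u L2_character) auto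
    also have "\<dots> \<le> (\<Sum>\<nu>\<in>K. L2_norm D (\<lambda>x. c \<nu> * (of_real (exp (r * h)) * T h (character \<nu>) x - character \<nu> x)))"
      by (intro L2_norm_sum_le L2_cmult d2)
    also have "\<dots> \<le> (\<Sum>\<nu>\<in>K. (L2_norm D u / m) * L2_norm D (\<lambda>x. of_real (exp (r * h)) * T h (character \<nu>) x - character \<nu> x))"
      unfolding L2_norm_cmult c_def m_def
      by (intro sum_mono mult_right_mono cmod_fourier_coeff_le ab u L2_norm_nonneg)
    also have "\<dots> = R h * L2_norm D u"
      by (simp add: R_def sum_distrib_left mult.commute)
    finally show ?thesis .
  qed
  have iter: "L2_norm D (\<lambda>x. of_real (exp (r * (real j * h))) * T (real j * h) e x - e x) \<le> ((1 + R h) ^ j - 1) * L2_norm D e"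
    if h: "0 \<le> h" for h j
  proof (induction j)
    case 0
    have "L2_norm D (\<lambda>x. T 0 e x - e x) = 0"
      unfolding L2_norm_eq_0_iff[OF L2_diff[OF T_L2[OF order_refl e2] e2]]
      using T_0[OF e2] by (auto elim!: eventually_mono)
    then show ?case by simp
  next
    case (Suc j)
    define s where "s = real j * h"
    have s: "0 \<le> s" using h by (simp add: s_def)
    define u where "u = T s e"
    define p where "p = (\<lambda>x. of_real (exp (r * s)) * u x)"
    have u2: "u \<in> L2 D" unfolding u_def by (intro T_L2 s e2)
    have p2: "p \<in> L2 D" unfolding p_def by (intro L2_cmult u2)
    have uK: "fourier_coeff a b u \<nu> = 0" if "\<nu> \<in> dual_lattice a b" "\<nu> \<notin> K" for \<nu>
      unfolding u_def e_def by (rule fourier_coeff_T_character[OF s \<omega>]) (use that in \<open>auto simp: K_def\<close>)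
    have sj: "real (Suc j) * h = h + s" by (simp add: s_def algebra_simps)
    have "L2_norm D (\<lambda>x. of_real (exp (r * (h + s))) * T (h + s) e x - p x)
        = L2_norm D (\<lambda>x. of_real (exp (r * s)) * (of_real (exp (r * h)) * T h u x - u x))"
    proof (rule L2_norm_cong_AE)
      show "AE x in \<mu>. of_real (exp (r * (h + s))) * T (h + s) e x - p x
          = of_real (exp (r * s)) * (of_real (exp (r * h)) * T h u x - u x)"
        using T_semigroup[OF h s e2] unfolding u_def[symmetric]
        by eventually_elim (simp add: p_def exp_add algebra_simps)
    qed (intro L2_measurable L2_cmult L2_diff T_L2 add_nonneg_nonneg h s e2 u2 p2)+
    also have "\<dots> \<le> exp (r * s) * (R h * L2_norm D u)"
      unfolding L2_norm_cmult using step[OF h u2 uK] by (simp del: of_real_exp)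
    also have "\<dots> = R h * L2_norm D p"
      unfolding p_def L2_norm_cmult by (simp del: of_real_exp)
    finally have 1: "L2_norm D (\<lambda>x. of_real (exp (r * (h + s))) * T (h + s) e x - p x) \<le> R h * L2_norm D p" .
    have 2: "L2_norm D (\<lambda>x. p x - e x) \<le> ((1 + R h) ^ j - 1) * L2_norm D e"
      using Suc unfolding p_def u_def s_def .
    have "L2_norm D p \<le> L2_norm D (\<lambda>x. p x - e x) + L2_norm D e"
      using L2_norm_triangle[OF L2_diff[OF p2 e2] e2] by simp
    with 2 have "L2_norm D p \<le> (1 + R h) ^ j * L2_norm D e"
      by (simp add: algebra_simps)
    then have "R h * L2_norm D p \<le> R h * ((1 + R h) ^ j * L2_norm D e)"
      by (intro mult_left_mono R0)
    moreover have "L2_norm D (\<lambda>x. of_real (exp (r * (h + s))) * T (h + s) e x - e x)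
        \<le> L2_norm D (\<lambda>x. of_real (exp (r * (h + s))) * T (h + s) e x - p x) + L2_norm D (\<lambda>x. p x - e x)"
      by (intro L2_norm_triangle_diff L2_cmult T_L2 add_nonneg_nonneg h s e2 p2)
    ultimately have "L2_norm D (\<lambda>x. of_real (exp (r * (h + s))) * T (h + s) e x - e x)
        \<le> R h * ((1 + R h) ^ j * L2_norm D e) + ((1 + R h) ^ j - 1) * L2_norm D e"
      using 1 2 by linarith
    then show ?case unfolding sj by (simp add: algebra_simps)
  qed
  define W where "W = L2_norm D (\<lambda>x. of_real (exp (r * t)) * T t e x - e x)"
  have "W = 0"
  proof (cases "t = 0")
    case True
    then have "W \<le> 0" using iter[of 0 0] by (simp add: W_def)
    then show ?thesis unfolding W_def by (rule antisym) (rule L2_norm_nonneg)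
  next
    case False
    with t have t: "0 < t" by simp
    have "((\<lambda>h. \<Sum>\<nu>\<in>K. L2_norm D (\<lambda>x. of_real (exp (r * h)) * T h (character \<nu>) x - character \<nu> x) / h / m)
        \<longlongrightarrow> (\<Sum>\<nu>\<in>K. 0 / m)) (at_right 0)"
    proof (intro tendsto_sum tendsto_divide tendsto_const)
      fix \<nu> assume "\<nu> \<in> K"
      then have "\<nu> \<in> dual_lattice a b" "r = (norm \<nu>)\<^sup>2" by (auto simp: K_def r_def)
      then show "((\<lambda>h. L2_norm D (\<lambda>x. of_real (exp (r * h)) * T h (character \<nu>) x - character \<nu> x) / h) \<longlongrightarrow> 0) (at_right 0)"
        using T_character_rate by simp
    qed (use m in simp)
    then have R_lim: "((\<lambda>h. R h / h) \<longlongrightarrow> 0) (at_right 0)"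
      by (simp add: R_def sum_divide_distrib mult.commute)
    have "filterlim (\<lambda>n. t / real n) (at_right 0) sequentially"
      by (rule tendsto_imp_filterlim_at_right)
        (use t in \<open>auto intro!: lim_const_over_n eventually_sequentiallyI[of 1]\<close>)
    from filterlim_compose[OF R_lim this]
    have "(\<lambda>n. R (t / real n) / (t / real n)) \<longlonglongrightarrow> 0" .
    then have "(\<lambda>n. (exp (t * (R (t / real n) / (t / real n))) - 1) * L2_norm D e) \<longlonglongrightarrow> (exp (t * 0) - 1) * L2_norm D e"
      by (intro tendsto_intros)
    moreover have "eventually (\<lambda>n. W \<le> (exp (t * (R (t / real n) / (t / real n))) - 1) * L2_norm D e) sequentially"
      using eventually_gt_at_top[of 0]
    proof eventually_elim
      case (elim n)
      have "W \<le> ((1 + R (t / real n)) ^ n - 1) * L2_norm D e"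
        using iter[of "t / real n" n] t elim by (simp add: W_def)
      also have "(1 + R (t / real n)) ^ n \<le> exp (R (t / real n)) ^ n"
        using R0[of "t / real n"] by (intro power_mono exp_ge_add_one_self) auto
      also have "\<dots> = exp (t * (R (t / real n) / (t / real n)))"
        using t elim by (simp add: exp_of_nat_mult[symmetric])
      finally show ?case by (simp add: mult_right_mono)
    qed
    ultimately have "W \<le> (exp (t * 0) - 1) * L2_norm D e"
      by (intro tendsto_lowerbound) auto
    moreover have "0 \<le> W" by (simp add: W_def)
    ultimately show ?thesis by simp
  qed
  then have "AE x in \<mu>. of_real (exp (r * t)) * T t e x - e x = 0"
    unfolding W_def using L2_norm_eq_0_iff[OF L2_diff[OF L2_cmult[OF T_L2[OF t e2]] e2]] by simp
  then show ?thesis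
  proof eventually_elim
    case (elim x)
    have "T t e x = of_real (exp (- t * r)) * (of_real (exp (r * t)) * T t e x)"
      unfolding mult.assoc[symmetric] of_real_mult[symmetric] exp_add[symmetric] by simp
    also have "of_real (exp (r * t)) * T t e x = e x" using elim by simp
    finally show ?case by (simp add: e_def r_def)
  qed
qed

lemma T_trig_poly:
  assumes t: "0 \<le> t" and K: "K \<subseteq> dual_lattice a b"
  shows "AE x in \<mu>. T t (\<lambda>y. \<Sum>\<omega>\<in>K. c \<omega> * character \<omega> y) x
    = (\<Sum>\<omega>\<in>K. c \<omega> * of_real (exp (- t * (norm \<omega>)\<^sup>2)) * character \<omega> x)"
proof (cases "finite K")
  case True
  have "AE x in \<mu>. \<forall>\<omega>\<in>K. T t (character \<omega>) x = of_real (exp (- t * (norm \<omega>)\<^sup>2)) * character \<omega> x"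
    using T_character[OF t] K by (intro AE_finite_allI True) auto
  with T_sum[OF t, of K character c, OF L2_character] show ?thesis
    by eventually_elim (simp add: mult.assoc)
qed (use T_zero[OF t] in auto)

end

section \<open>Positivity and contractivity of the heat semigroup\<close>

text \<open>Multiplying coefficients by \<open>m\<close> preserves nonnegativity of every finite sum of characters. All
  frequencies are admitted, not just those of a lattice, which makes translations by arbitrary
  vectors available.\<close>

definition positive_multiplier :: "('a::euclidean_space \<Rightarrow> real) \<Rightarrow> bool" where
  "positive_multiplier m \<longleftrightarrow> (\<forall>K c. finite K \<longrightarrow>
     (\<forall>x. (\<Sum>\<omega>\<in>K. c \<omega> * character \<omega> x) \<in> \<real>\<^sub>\<ge>\<^sub>0) \<longrightarrow>
     (\<forall>x. (\<Sum>\<omega>\<in>K. c \<omega> * of_real (m \<omega>) * character \<omega> x) \<in> \<real>\<^sub>\<ge>\<^sub>0))"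

lemma positive_multiplierD:
  "positive_multiplier m \<Longrightarrow> finite K \<Longrightarrow> (\<And>x. (\<Sum>\<omega>\<in>K. c \<omega> * character \<omega> x) \<in> \<real>\<^sub>\<ge>\<^sub>0)
    \<Longrightarrow> (\<Sum>\<omega>\<in>K. c \<omega> * of_real (m \<omega>) * character \<omega> x) \<in> \<real>\<^sub>\<ge>\<^sub>0"
  unfolding positive_multiplier_def by blast

lemma positive_multiplier_1: "positive_multiplier (\<lambda>_. 1)"
  by (simp add: positive_multiplier_def)

lemma positive_multiplier_mult:
  assumes m: "positive_multiplier m" and n: "positive_multiplier n"
  shows "positive_multiplier (\<lambda>\<omega>. m \<omega> * n \<omega>)"
  unfolding positive_multiplier_def
proof (intro allI impI)
  fix K :: "'a set" and c x
  assume K: "finite K" "\<forall>x. (\<Sum>\<omega>\<in>K. c \<omega> * character \<omega> x) \<in> \<real>\<^sub>\<ge>\<^sub>0"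
  have "(\<Sum>\<omega>\<in>K. (c \<omega> * of_real (m \<omega>)) * of_real (n \<omega>) * character \<omega> x) \<in> \<real>\<^sub>\<ge>\<^sub>0"
    using K by (intro positive_multiplierD[OF n] positive_multiplierD[OF m]) auto
  then show "(\<Sum>\<omega>\<in>K. c \<omega> * of_real (m \<omega> * n \<omega>) * character \<omega> x) \<in> \<real>\<^sub>\<ge>\<^sub>0"
    by (simp add: mult.assoc)
qed

lemma positive_multiplier_power:
  "positive_multiplier m \<Longrightarrow> positive_multiplier (\<lambda>\<omega>. m \<omega> ^ n)"
  by (induction n) (auto intro: positive_multiplier_1 positive_multiplier_mult)

lemma positive_multiplier_prod:
  "(\<And>i. i \<in> I \<Longrightarrow> positive_multiplier (m i)) \<Longrightarrow> positive_multiplier (\<lambda>\<omega>. \<Prod>i\<in>I. m i \<omega>)"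
  by (induction I rule: infinite_finite_induct) (auto intro: positive_multiplier_1 positive_multiplier_mult)

lemma positive_multiplier_limit:
  assumes m: "\<And>n. positive_multiplier (m n)" and lim: "\<And>\<omega>. (\<lambda>n::nat. m n \<omega>) \<longlonglongrightarrow> l \<omega>"
  shows "positive_multiplier l"
  unfolding positive_multiplier_def
proof (intro allI impI)
  fix K :: "'a set" and c x
  assume K: "finite K" "\<forall>x. (\<Sum>\<omega>\<in>K. c \<omega> * character \<omega> x) \<in> \<real>\<^sub>\<ge>\<^sub>0"
  have "(\<lambda>n. \<Sum>\<omega>\<in>K. c \<omega> * of_real (m n \<omega>) * character \<omega> x)
      \<longlonglongrightarrow> (\<Sum>\<omega>\<in>K. c \<omega> * of_real (l \<omega>) * character \<omega> x)"
    by (intro tendsto_intros lim)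
  then show "(\<Sum>\<omega>\<in>K. c \<omega> * of_real (l \<omega>) * character \<omega> x) \<in> \<real>\<^sub>\<ge>\<^sub>0"
    by (rule closed_sequentially[OF closed_nonneg_Reals_complex, rotated])
      (use K positive_multiplierD[OF m K(1)] in blast)
qed

text \<open>This multiplier averages the translations by \<open>h i\<close> and \<open>- h i\<close>.\<close>

lemma positive_multiplier_cos: "positive_multiplier (\<lambda>\<omega>. cos (h * (\<omega> \<bullet> i)))"
  unfolding positive_multiplier_def
proof (intro allI impI)
  fix K :: "'a set" and c x
  assume K: "finite K" "\<forall>x. (\<Sum>\<omega>\<in>K. c \<omega> * character \<omega> x) \<in> \<real>\<^sub>\<ge>\<^sub>0"
  have avg: "of_real (cos (h * (\<omega> \<bullet> i))) * character \<omega> x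
      = 1/2 * (character \<omega> (x + h *\<^sub>R i) + character \<omega> (x + (- h) *\<^sub>R i))" for \<omega>
  proof -
    have "character \<omega> (h *\<^sub>R i) + character \<omega> ((- h) *\<^sub>R i) = 2 * of_real (cos (h * (\<omega> \<bullet> i)))"
      by (simp add: character_def complex_eq_iff)
    then show ?thesis unfolding character_add by (simp add: distrib_left[symmetric])
  qed
  have "(\<Sum>\<omega>\<in>K. c \<omega> * of_real (cos (h * (\<omega> \<bullet> i))) * character \<omega> x)
      = of_real (1/2) * ((\<Sum>\<omega>\<in>K. c \<omega> * character \<omega> (x + h *\<^sub>R i)) + (\<Sum>\<omega>\<in>K. c \<omega> * character \<omega> (x + (- h) *\<^sub>R i)))"
    unfolding mult.assoc avg sum.distrib[symmetric] sum_distrib_left by (simp add: algebra_simps)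
  also have "\<dots> \<in> \<real>\<^sub>\<ge>\<^sub>0"
    using K(2) by (intro nonneg_Reals_mult_I nonneg_Reals_add_I) auto
  finally show "(\<Sum>\<omega>\<in>K. c \<omega> * of_real (cos (h * (\<omega> \<bullet> i))) * character \<omega> x) \<in> \<real>\<^sub>\<ge>\<^sub>0" .
qed

lemma cos_power_tendsto_exp: "(\<lambda>n. cos (s / sqrt (real n)) ^ n) \<longlonglongrightarrow> exp (- (s\<^sup>2 / 2))"
proof (cases "s = 0")
  case False
  define r where "r = \<bar>s\<bar>"
  have r: "r > 0" using False by (simp add: r_def)
  have "(\<lambda>n. cos (r / sqrt (real n)) ^ n) \<longlonglongrightarrow> exp (- (r * r / 2))"
    using r by real_asymp
  moreover have "cos (r / sqrt (real n)) = cos (s / sqrt (real n))" for n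
    by (cases "s \<ge> 0") (auto simp: r_def)
  moreover have "r * r = s\<^sup>2" by (simp add: r_def power2_eq_square)
  ultimately show ?thesis by simp
qed simp

text \<open>Symmetric random walks in the coordinate directions: \<open>n\<close> steps of length \<open>(2t/n)\<^bsup>1/2\<^esup>\<close> have the
  multiplier \<open>cos ((2t/n)\<^bsup>1/2\<^esup> \<omega>\<^sub>i)\<^sup>n\<close>, which converges to \<open>e\<^bsup>-t\<omega>\<^sub>i\<^sup>2\<^esup>\<close>.\<close>

lemma positive_multiplier_heat:
  assumes t: "0 \<le> t"
  shows "positive_multiplier (\<lambda>\<omega>::'a::euclidean_space. exp (- t * (norm \<omega>)\<^sup>2))"
proof -
  have "positive_multiplier (\<lambda>\<omega>::'a. exp (- t * (\<omega> \<bullet> i)\<^sup>2))" for i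
  proof (rule positive_multiplier_limit)
    fix n :: nat and \<omega> :: 'a
    show "positive_multiplier (\<lambda>\<omega>::'a. cos ((sqrt (2 * t) / sqrt (real n)) * (\<omega> \<bullet> i)) ^ n)" for n
      by (intro positive_multiplier_power positive_multiplier_cos)
    show "(\<lambda>n. cos ((sqrt (2 * t) / sqrt (real n)) * (\<omega> \<bullet> i)) ^ n) \<longlonglongrightarrow> exp (- t * (\<omega> \<bullet> i)\<^sup>2)"
      using cos_power_tendsto_exp[of "sqrt (2 * t) * (\<omega> \<bullet> i)"] t
      by (simp add: power_mult_distrib)
  qed
  then have "positive_multiplier (\<lambda>\<omega>::'a. \<Prod>i\<in>Basis. exp (- t * (\<omega> \<bullet> i)\<^sup>2))"
    by (rule positive_multiplier_prod)
  also have "(\<lambda>\<omega>::'a. \<Prod>i\<in>Basis. exp (- t * (\<omega> \<bullet> i)\<^sup>2)) = (\<lambda>\<omega>. exp (- t * (norm \<omega>)\<^sup>2))"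
    by (simp add: exp_sum[symmetric] sum_distrib_left[symmetric] sum_negf sum_inner_Basis_sq)
  finally show ?thesis .
qed

lemma cmod_le_if_rational_rotations_le:
  assumes "\<And>q::rat. Re (cis (of_rat q) * z) \<le> r"
  shows "cmod z \<le> r"
proof (rule ccontr)
  assume "\<not> cmod z \<le> r"
  define g where "g s = Re (cis s * z)" for s
  have cont: "continuous_on UNIV g"
    unfolding g_def cis_conv_exp by (intro continuous_intros)
  have "cis (- Arg z) * z = cis (- Arg z) * (of_real (cmod z) * cis (Arg z))"
    by (simp add: rcis_cmod_Arg[unfolded rcis_def])
  also have "\<dots> = of_real (cmod z)" by (simp add: cis_mult mult.left_commute)
  finally have "g (- Arg z) > r"
    using \<open>\<not> cmod z \<le> r\<close> by (simp add: g_def)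
  moreover have "open (g -` {r<..})"
    using cont by (intro open_vimage) auto
  ultimately obtain e where e: "e > 0" "ball (- Arg z) e \<subseteq> g -` {r<..}"
    by (meson greaterThan_iff openE vimage_eq)
  obtain q where "- Arg z < of_rat q" "of_rat q < - Arg z + e"
    using of_rat_dense[of "- Arg z" "- Arg z + e"] e(1) by auto
  then have "of_rat q \<in> ball (- Arg z) e" by (simp add: dist_real_def)
  then have "g (of_rat q) > r" using e(2) by auto
  then show False using assms[of q] by (simp add: g_def)
qed

text \<open>The positive part of the real part is the nearest point on the nonnegative half-line.\<close>

lemma cmod_diff_nonneg_part_le:
  assumes "q \<in> \<real>\<^sub>\<ge>\<^sub>0"
  shows "cmod (u - of_real (max (Re u) 0)) \<le> cmod (u - q)"
proof -
  have q: "Im q = 0" "0 \<le> Re q" using assms by (auto simp: complex_nonneg_Reals_iff)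
  have "(Re u - max (Re u) 0)\<^sup>2 \<le> (Re u - Re q)\<^sup>2"
    unfolding abs_le_square_iff[symmetric] using q(2) by (auto simp: max_def abs_if)
  then show ?thesis
    unfolding cmod_def using q(1) by simp
qed

context periodic_heat begin

text \<open>\<open>T t\<close> of a nonnegative trigonometric polynomial is nonnegative, and the distance of \<open>T t f\<close> to the
  nonnegative functions is at most its distance to these images.\<close>

lemma T_nonneg:
  assumes t: "0 \<le> t" and f: "f \<in> L2 D" and pos: "AE x in \<mu>. f x \<in> \<real>\<^sub>\<ge>\<^sub>0"
  shows "AE x in \<mu>. T t f x \<in> \<real>\<^sub>\<ge>\<^sub>0"
proof -
  obtain C where C: "0 \<le> C" "\<And>f. f \<in> L2 D \<Longrightarrow> L2_norm D (T t f) \<le> C * L2_norm D f"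
    using T_bound[OF t] by blast
  define g where "g x = max (Re (f x)) 0" for x
  have fg: "AE x in \<mu>. complex_of_real (g x) = f x"
    using pos by eventually_elim (auto simp: g_def complex_eq_iff complex_nonneg_Reals_iff)
  note [measurable] = L2_measurable[OF f]
  have g2: "(\<lambda>x. of_real (g x)) \<in> L2 D"
    by (rule L2_cong_AE[OF _ f fg]) (simp add: g_def)
  define u where "u = T t (\<lambda>x. of_real (g x))"
  have u2: "u \<in> L2 D" unfolding u_def by (intro T_L2 t g2)
  note [measurable] = L2_measurable[OF u2]
  define w where "w x = u x - of_real (max (Re (u x)) 0)" for x
  have wm: "w \<in> borel_measurable \<mu>" unfolding w_def by measurable
  have w2: "w \<in> L2 D"
    by (rule L2_dominated[OF u2 wm]) (use cmod_diff_nonneg_part_le[of 0] in \<open>auto simp: w_def\<close>)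
  have le: "L2_norm D w \<le> e" if e: "0 < e" for e
  proof -
    have "0 < e / (C + 1)" using e C(1) by simp
    then obtain p where p: "trig_poly a b p" "\<And>x. p x \<in> \<real>\<^sub>\<ge>\<^sub>0"
      "L2_norm D (\<lambda>x. of_real (g x) - p x) < e / (C + 1)"
      using trig_poly_dense_nonneg[OF ab g2, of "e / (C + 1)"] unfolding g_def by auto
    obtain K c where K: "finite K" "K \<subseteq> dual_lattice a b" "p = (\<lambda>x. \<Sum>\<omega>\<in>K. c \<omega> * character \<omega> x)"
      using p(1) unfolding trig_poly_def by blast
    note p2 = trig_poly_L2[OF p(1)]
    have Tp_eq: "AE x in \<mu>. T t p x = (\<Sum>\<omega>\<in>K. c \<omega> * of_real (exp (- t * (norm \<omega>)\<^sup>2)) * character \<omega> x)"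
      unfolding K(3) by (rule T_trig_poly[OF t K(2)])
    have Tp_pos: "(\<Sum>\<omega>\<in>K. c \<omega> * of_real (exp (- t * (norm \<omega>)\<^sup>2)) * character \<omega> x) \<in> \<real>\<^sub>\<ge>\<^sub>0" for x
      using p(2) unfolding K(3) by (rule positive_multiplierD[OF positive_multiplier_heat[OF t] K(1)])
    have "AE x in \<mu>. cmod (w x) \<le> cmod (u x - T t p x)"
      using Tp_eq by eventually_elim (use Tp_pos in \<open>simp add: w_def cmod_diff_nonneg_part_le\<close>)
    then have "L2_norm D w \<le> L2_norm D (\<lambda>x. u x - T t p x)"
      by (intro L2_norm_mono L2_diff u2 T_L2 t p2 L2_measurable[OF w2])
    also have "\<dots> \<le> C * L2_norm D (\<lambda>x. of_real (g x) - p x)"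
      unfolding u_def by (rule T_norm_diff_le[OF t g2 p2 C(2)])
    also have "\<dots> \<le> C * (e / (C + 1))"
      using p(3) C(1) by (intro mult_left_mono) auto
    also have "\<dots> \<le> e" using C(1) e by (simp add: field_simps)
    finally show ?thesis .
  qed
  have "L2_norm D w \<le> 0"
    by (rule field_le_epsilon) (simp add: le)
  then have "L2_norm D w = 0"
    by (rule antisym) (rule L2_norm_nonneg)
  then have "AE x in \<mu>. w x = 0" using L2_norm_eq_0_iff[OF w2] by simp
  moreover have "AE x in \<mu>. u x = T t f x"
    unfolding u_def by (rule T_cong[OF t g2 f fg])
  ultimately show ?thesis
  proof eventually_elim
    case (elim x)
    then have "T t f x = of_real (max (Re (u x)) 0)" by (simp add: w_def)
    then show ?case by simp
  qed
qed

lemma L2_of_real_dominated: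
  assumes "f \<in> L2 D" "g \<in> borel_measurable \<mu>" "\<And>x. \<bar>g x\<bar> \<le> cmod (f x)"
  shows "(\<lambda>x. of_real (g x)) \<in> L2 D"
  by (rule L2_dominated[OF assms(1)]) (use assms in auto)

lemma T_real:
  assumes t: "0 \<le> t" and f: "(\<lambda>x. of_real (f x)) \<in> L2 D"
  shows "AE x in \<mu>. Im (T t (\<lambda>x. of_real (f x)) x) = 0"
proof -
  have [measurable]: "f \<in> borel_measurable \<mu>"
    using measurable_compose[OF L2_measurable[OF f] borel_measurable_Re] by simp
  have pn: "(\<lambda>x. of_real (max (f x) 0)) \<in> L2 D" "(\<lambda>x. of_real (max (- f x) 0)) \<in> L2 D"
    by (rule L2_of_real_dominated[OF f]; simp)+
  have eq: "(\<lambda>x. complex_of_real (f x)) = (\<lambda>x. of_real (max (f x) 0) - of_real (max (- f x) 0))"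
    by (auto simp: max_def)
  have "AE x in \<mu>. T t (\<lambda>x. of_real (max (f x) 0)) x \<in> \<real>\<^sub>\<ge>\<^sub>0"
    "AE x in \<mu>. T t (\<lambda>x. of_real (max (- f x) 0)) x \<in> \<real>\<^sub>\<ge>\<^sub>0"
    by (rule T_nonneg[OF t pn(1)], simp) (rule T_nonneg[OF t pn(2)], simp)
  with T_diff[OF t pn] show ?thesis
    unfolding eq by eventually_elim (auto simp: complex_nonneg_Reals_iff)
qed

lemma T_Re:
  assumes t: "0 \<le> t" and f: "f \<in> L2 D"
  shows "AE x in \<mu>. Re (T t f x) = Re (T t (\<lambda>x. of_real (Re (f x))) x)"
proof -
  note [measurable] = L2_measurable[OF f]
  have r: "(\<lambda>x. of_real (Re (f x))) \<in> L2 D" "(\<lambda>x. of_real (Im (f x))) \<in> L2 D"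
    by (rule L2_of_real_dominated[OF f]; simp add: abs_Re_le_cmod abs_Im_le_cmod)+
  have eq: "f = (\<lambda>x. \<i> * of_real (Im (f x)) + of_real (Re (f x)))"
    by (auto simp: complex_eq_iff)
  have "AE x in \<mu>. T t (\<lambda>x. \<i> * of_real (Im (f x)) + of_real (Re (f x))) x
      = \<i> * T t (\<lambda>x. of_real (Im (f x))) x + T t (\<lambda>x. of_real (Re (f x))) x"
    by (rule T_linear[OF t r(2,1)])
  with T_real[OF t r(2)] show ?thesis
    unfolding eq[symmetric] by eventually_elim simp
qed

text \<open>Positivity gives \<open>Re (z T t f) \<le> T t |f|\<close> almost everywhere for each fixed unit \<open>z\<close>; countably many
  \<open>z\<close>, dense in the circle, give one common null set.\<close>

lemma T_cmod_le:
  assumes t: "0 \<le> t" and f: "f \<in> L2 D"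
  shows "AE x in \<mu>. cmod (T t f x) \<le> Re (T t (\<lambda>x. of_real (cmod (f x))) x)"
proof -
  note [measurable] = L2_measurable[OF f]
  note af = L2_cmod[OF f]
  have "AE x in \<mu>. Re (cis (of_rat q) * T t f x) \<le> Re (T t (\<lambda>x. of_real (cmod (f x))) x)" for q :: rat
  proof -
    define z where "z = cis (of_rat q)"
    note zf = L2_cmult[OF f, of z]
    have Re_le: "Re (z * f x) \<le> cmod (f x)" for x
      using complex_Re_le_cmod[of "z * f x"] by (simp add: z_def norm_mult)
    have r: "(\<lambda>x. of_real (Re (z * f x))) \<in> L2 D"
      by (rule L2_of_real_dominated[OF zf]) (simp_all only: abs_Re_le_cmod, measurable)
    have "AE x in \<mu>. T t (\<lambda>x. of_real (cmod (f x)) - of_real (Re (z * f x))) x \<in> \<real>\<^sub>\<ge>\<^sub>0"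
    proof (rule T_nonneg[OF t L2_diff[OF af r]])
      have "complex_of_real (cmod (f x)) - of_real (Re (z * f x)) \<in> \<real>\<^sub>\<ge>\<^sub>0" for x
        unfolding of_real_diff[symmetric] nonneg_Reals_of_real_iff using Re_le[of x] by linarith
      then show "AE x in \<mu>. complex_of_real (cmod (f x)) - of_real (Re (z * f x)) \<in> \<real>\<^sub>\<ge>\<^sub>0" by simp
    qed
    with T_diff[OF t af r] T_Re[OF t zf] T_cmult[OF t f, of z]
    show ?thesis
      unfolding z_def[symmetric] by eventually_elim (auto simp: complex_nonneg_Reals_iff)
  qed
  then have "AE x in \<mu>. \<forall>q::rat. Re (cis (of_rat q) * T t f x) \<le> Re (T t (\<lambda>x. of_real (cmod (f x))) x)"
    by (simp add: AE_all_countable)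
  then show ?thesis
    by eventually_elim (rule cmod_le_if_rational_rotations_le, blast)
qed

lemma T_norm_cmod_le:
  assumes t: "0 \<le> t" and f: "f \<in> L2 D"
  shows "L2_norm D (T t f) \<le> L2_norm D (T t (\<lambda>x. of_real (cmod (f x))))"
  using T_cmod_le[OF t f] complex_Re_le_cmod order_trans
  by (intro L2_norm_mono T_L2 t L2_cmod f L2_measurable[OF T_L2[OF t f]])
    (auto elim!: eventually_mono intro: order_trans)

text \<open>For \<open>h = f + ig\<close> the modulus of \<open>T t h\<close> is \<open>((T t f)\<^sup>2 + (T t g)\<^sup>2)\<^bsup>1/2\<^esup>\<close>, since \<open>T t f\<close> and \<open>T t g\<close> are real. So
  \<open>\<parallel>T t \<phi>\<parallel>\<^sup>2\<close> is superadditive, hence concave, as a function of the density \<open>|\<phi>|\<^sup>2\<close>.\<close>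

lemma T_norm_sqrt_sum_squares:
  assumes t: "0 \<le> t" and f: "(\<lambda>x. of_real (f x)) \<in> L2 D" and g: "(\<lambda>x. of_real (g x)) \<in> L2 D"
  shows "(L2_norm D (T t (\<lambda>x. of_real (f x))))\<^sup>2 + (L2_norm D (T t (\<lambda>x. of_real (g x))))\<^sup>2
    \<le> (L2_norm D (T t (\<lambda>x. of_real (sqrt ((f x)\<^sup>2 + (g x)\<^sup>2)))))\<^sup>2"
proof -
  define F where "F = T t (\<lambda>x. of_real (f x))"
  define G where "G = T t (\<lambda>x. of_real (g x))"
  define h where "h = (\<lambda>x. \<i> * of_real (g x) + of_real (f x))"
  have h2: "h \<in> L2 D" unfolding h_def by (intro L2_add L2_cmult f g)
  have FG: "F \<in> L2 D" "G \<in> L2 D" unfolding F_def G_def by (intro T_L2 t f g)+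
  have hm: "(\<lambda>x. complex_of_real (cmod (h x))) = (\<lambda>x. of_real (sqrt ((f x)\<^sup>2 + (g x)\<^sup>2)))"
    by (simp add: h_def cmod_def)
  have "AE x in \<mu>. T t h x = \<i> * G x + F x"
    unfolding h_def F_def G_def by (rule T_linear[OF t g f])
  then have "AE x in \<mu>. (cmod (T t h x))\<^sup>2 = (cmod (F x))\<^sup>2 + (cmod (G x))\<^sup>2"
    using T_real[OF t f] T_real[OF t g] unfolding F_def[symmetric] G_def[symmetric]
    by eventually_elim (simp add: cmod_power2)
  then have "(L2_norm D (T t h))\<^sup>2 = (LINT x|\<mu>. (cmod (F x))\<^sup>2 + (cmod (G x))\<^sup>2)"
    unfolding L2_norm_sq using L2_measurable[OF T_L2[OF t h2]] FG[THEN L2_measurable]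
    by (intro integral_cong_AE) auto
  also have "\<dots> = (L2_norm D F)\<^sup>2 + (L2_norm D G)\<^sup>2"
    unfolding L2_norm_sq using FG[THEN L2_integrable] by simp
  finally have "(L2_norm D F)\<^sup>2 + (L2_norm D G)\<^sup>2 = (L2_norm D (T t h))\<^sup>2" ..
  also have "\<dots> \<le> (L2_norm D (T t (\<lambda>x. of_real (cmod (h x)))))\<^sup>2"
    by (intro power_mono T_norm_cmod_le t h2 L2_norm_nonneg)
  finally show ?thesis unfolding hm F_def G_def .
qed

lemma T_const:
  assumes t: "0 \<le> t"
  shows "AE x in \<mu>. T t (\<lambda>_. c) x = c"
  using T_trig_poly[OF t, of "{0}" "\<lambda>_. c"] by simp

text \<open>Parseval's identity on trigonometric polynomials, since all multipliers are at most \<open>1\<close>.\<close>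

lemma T_contraction:
  assumes t: "0 \<le> t" and f: "f \<in> L2 D"
  shows "L2_norm D (T t f) \<le> L2_norm D f"
proof -
  obtain C where C: "0 \<le> C" "\<And>f. f \<in> L2 D \<Longrightarrow> L2_norm D (T t f) \<le> C * L2_norm D f"
    using T_bound[OF t] by blast
  have "L2_norm D (T t f) \<le> L2_norm D f + e" if e: "0 < e" for e
  proof -
    have "0 < e / (C + 1)" using e C(1) by simp
    then obtain p where p: "trig_poly a b p" "L2_norm D (\<lambda>x. f x - p x) < e / (C + 1)"
      using trig_poly_dense[OF ab f] by blast
    obtain K c where K: "finite K" "K \<subseteq> dual_lattice a b" "p = (\<lambda>x. \<Sum>\<omega>\<in>K. c \<omega> * character \<omega> x)"
      using p(1) unfolding trig_poly_def by blast
    note p2 = trig_poly_L2[OF p(1)]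
    define q where "q = (\<lambda>x. \<Sum>\<omega>\<in>K. c \<omega> * of_real (exp (- t * (norm \<omega>)\<^sup>2)) * character \<omega> x)"
    have q2: "q \<in> L2 D" unfolding q_def by (intro L2_sum L2_cmult L2_character)
    have "AE x in \<mu>. T t p x = q x"
      unfolding K(3) q_def by (rule T_trig_poly[OF t K(2)])
    then have "(L2_norm D (T t p))\<^sup>2 = (L2_norm D q)\<^sup>2"
      using L2_norm_cong_AE[OF L2_measurable[OF T_L2[OF t p2]] L2_measurable[OF q2]] by simp
    also have "\<dots> = measure lebesgue D * (\<Sum>\<omega>\<in>K. (cmod (c \<omega> * of_real (exp (- t * (norm \<omega>)\<^sup>2))))\<^sup>2)"
      unfolding q_def by (rule parseval_trig_poly[OF ab K(1,2)])
    also have "\<dots> \<le> measure lebesgue D * (\<Sum>\<omega>\<in>K. (cmod (c \<omega>))\<^sup>2)"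
    proof (intro mult_left_mono sum_mono power_mono)
      fix \<omega>
      show "cmod (c \<omega> * of_real (exp (- t * (norm \<omega>)\<^sup>2))) \<le> cmod (c \<omega>)"
        using t by (simp add: norm_mult mult_left_le del: of_real_exp)
    qed auto
    also have "\<dots> = (L2_norm D p)\<^sup>2"
      unfolding K(3) by (rule parseval_trig_poly[OF ab K(1,2), symmetric])
    finally have Tp: "L2_norm D (T t p) \<le> L2_norm D p"
      by (rule power2_le_imp_le) simp
    have "L2_norm D (T t f) \<le> L2_norm D (\<lambda>x. T t f x - T t p x) + L2_norm D (T t p)"
      using L2_norm_triangle[OF L2_diff[OF T_L2[OF t f] T_L2[OF t p2]] T_L2[OF t p2]] by simp
    also have "\<dots> \<le> C * L2_norm D (\<lambda>x. f x - p x) + L2_norm D p"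
      using T_norm_diff_le[OF t f p2 C(2)] Tp by simp
    also have "L2_norm D p \<le> L2_norm D (\<lambda>x. f x - p x) + L2_norm D f"
      using L2_norm_triangle[OF L2_diff[OF p2 f] f] by (simp add: L2_norm_minus_commute[of D p f])
    also have "C * L2_norm D (\<lambda>x. f x - p x) + (L2_norm D (\<lambda>x. f x - p x) + L2_norm D f)
        = (C + 1) * L2_norm D (\<lambda>x. f x - p x) + L2_norm D f"
      by (simp add: algebra_simps)
    also have "\<dots> \<le> (C + 1) * (e / (C + 1)) + L2_norm D f"
      using p(2) C(1) by (intro add_right_mono mult_left_mono) auto
    also have "\<dots> = L2_norm D f + e" using C(1) by simp
    finally show ?thesis by simp
  qed
  then show ?thesis by (rule field_le_epsilon)
qed

lemma L2_const: "(\<lambda>_. c) \<in> L2 D"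
  by (rule L2_bounded[where B="cmod c"]) auto

text \<open>Conservation of mass: the frequency \<open>0\<close> has the multiplier \<open>1\<close>.\<close>

lemma T_integral:
  assumes t: "0 \<le> t" and f: "f \<in> L2 D"
  shows "(LINT x|\<mu>. T t f x) = (LINT x|\<mu>. f x)"
proof -
  define m where "m = L2_norm D (\<lambda>_. 1)"
  have int: "integrable \<mu> g" "cmod (LINT x|\<mu>. g x) \<le> L2_norm D g * m" if "g \<in> L2 D" for g
    using L2_mult_integrable[OF that L2_const[of 1]] L2_integral_mult_le[OF that L2_const[of 1]]
    by (simp_all add: m_def)
  have "cmod ((LINT x|\<mu>. T t f x) - (LINT x|\<mu>. f x)) \<le> e" if e: "0 < e" for e
  proof -
    have m: "0 \<le> m" by (simp add: m_def)
    then have "0 < e / (2 * (m + 1))" using e by simp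
    then obtain p where p: "trig_poly a b p" "L2_norm D (\<lambda>x. f x - p x) < e / (2 * (m + 1))"
      using trig_poly_dense[OF ab f] by blast
    obtain K c where K: "finite K" "K \<subseteq> dual_lattice a b" "p = (\<lambda>x. \<Sum>\<omega>\<in>K. c \<omega> * character \<omega> x)"
      using p(1) unfolding trig_poly_def by blast
    note p2 = trig_poly_L2[OF p(1)]
    have mean: "(LINT x|\<mu>. (\<Sum>\<omega>\<in>K. d \<omega> * character \<omega> x)) = (if 0 \<in> K then d 0 * of_real (measure lebesgue D) else 0)" for d
      using fourier_coeff_trig_poly[OF ab K(1,2) dual_lattice_0, of d] box_measure_pos[OF ab]
      by (auto simp: fourier_coeff_def field_simps split: if_splits)
    have "AE x in \<mu>. T t p x = (\<Sum>\<omega>\<in>K. c \<omega> * of_real (exp (- t * (norm \<omega>)\<^sup>2)) * character \<omega> x)"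
      unfolding K(3) by (rule T_trig_poly[OF t K(2)])
    then have "(LINT x|\<mu>. T t p x) = (LINT x|\<mu>. (\<Sum>\<omega>\<in>K. c \<omega> * of_real (exp (- t * (norm \<omega>)\<^sup>2)) * character \<omega> x))"
      by (intro integral_cong_AE L2_measurable T_L2 t p2 L2_sum L2_cmult L2_character)
    also have "\<dots> = (LINT x|\<mu>. p x)" unfolding K(3) mean by simp
    finally have Tp: "(LINT x|\<mu>. T t p x) = (LINT x|\<mu>. p x)" .
    have "(LINT x|\<mu>. T t f x) - (LINT x|\<mu>. f x) = (LINT x|\<mu>. T t f x - T t p x) - (LINT x|\<mu>. f x - p x)"
      using int(1)[OF f] int(1)[OF p2] int(1)[OF T_L2[OF t f]] int(1)[OF T_L2[OF t p2]] Tp by simp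
    then have "cmod ((LINT x|\<mu>. T t f x) - (LINT x|\<mu>. f x))
        \<le> cmod (LINT x|\<mu>. T t f x - T t p x) + cmod (LINT x|\<mu>. f x - p x)"
      by (simp add: norm_triangle_ineq4)
    also have "\<dots> \<le> L2_norm D (\<lambda>x. T t f x - T t p x) * m + L2_norm D (\<lambda>x. f x - p x) * m"
      by (intro add_mono int(2) L2_diff T_L2 t f p2)
    also have "\<dots> \<le> L2_norm D (\<lambda>x. f x - p x) * m + L2_norm D (\<lambda>x. f x - p x) * m"
      using T_norm_diff_le[OF t f p2, of 1] T_contraction[OF t] m
      by (intro add_right_mono mult_right_mono) auto
    also have "\<dots> \<le> e / (2 * (m + 1)) * m + e / (2 * (m + 1)) * m"
      using p(2) m by (intro add_mono mult_right_mono) auto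
    also have "\<dots> = e * (m / (m + 1))" using m by (simp add: divide_simps)
    also have "\<dots> \<le> e" using m e by (intro mult_left_le) auto
    finally show ?thesis .
  qed
  then have "cmod ((LINT x|\<mu>. T t f x) - (LINT x|\<mu>. f x)) \<le> 0"
    by (rule field_le_epsilon) simp
  then show ?thesis by simp
qed

text \<open>Write \<open>f = g + h\<close>. Since \<open>T t g \<le> T t M = M\<close> and \<open>T t h \<ge> 0\<close>, the mixed term satisfies
  \<open>\<langle>T t g, T t h\<rangle> \<le> M \<integral>T t h = M \<integral>h = \<langle>g, h\<rangle>\<close>; the last equality holds because \<open>g = M\<close> wherever \<open>h \<noteq> 0\<close>.
  Contractivity handles \<open>\<parallel>T t h\<parallel>\<close>.\<close>

lemma T_truncation:
  fixes f :: "'a \<Rightarrow> real"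
  assumes t: "0 \<le> t" and f: "(\<lambda>x. of_real (f x)) \<in> L2 D" "\<And>x. 0 \<le> f x" and M: "0 \<le> M"
  defines "g \<equiv> \<lambda>x. min (f x) M"
  shows "(L2_norm D (T t (\<lambda>x. of_real (f x))))\<^sup>2 - (L2_norm D (T t (\<lambda>x. of_real (g x))))\<^sup>2
    \<le> (L2_norm D (\<lambda>x. of_real (f x)))\<^sup>2 - (L2_norm D (\<lambda>x. of_real (g x)))\<^sup>2"
proof -
  define h where "h x = f x - g x" for x
  have [measurable]: "f \<in> borel_measurable \<mu>"
    using measurable_compose[OF L2_measurable[OF f(1)] borel_measurable_Re] by simp
  have g2: "(\<lambda>x. of_real (g x)) \<in> L2 D"
    by (rule L2_of_real_dominated[OF f(1)]) (use f(2) M in \<open>auto simp: g_def\<close>)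
  have h2: "(\<lambda>x. of_real (h x)) \<in> L2 D"
    using L2_diff[OF f(1) g2] by (simp add: h_def)
  have Mg2: "(\<lambda>x. of_real M - of_real (g x)) \<in> L2 D"
    by (rule L2_diff[OF L2_const g2])
  define G where "G = T t (\<lambda>x. of_real (g x))"
  define H where "H = T t (\<lambda>x. of_real (h x))"
  have GH: "G \<in> L2 D" "H \<in> L2 D" unfolding G_def H_def by (intro T_L2 t g2 h2)+
  have F: "AE x in \<mu>. T t (\<lambda>x. of_real (f x)) x = G x + H x"
    using T_add[OF t g2 h2] by (simp add: h_def G_def H_def)
  have H0: "AE x in \<mu>. H x \<in> \<real>\<^sub>\<ge>\<^sub>0"
    unfolding H_def
  proof (rule T_nonneg[OF t h2])
    have "complex_of_real (h x) \<in> \<real>\<^sub>\<ge>\<^sub>0" for x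
      unfolding nonneg_Reals_of_real_iff by (simp add: h_def g_def)
    then show "AE x in \<mu>. complex_of_real (h x) \<in> \<real>\<^sub>\<ge>\<^sub>0" by simp
  qed
  have "AE x in \<mu>. T t (\<lambda>x. of_real M - of_real (g x)) x \<in> \<real>\<^sub>\<ge>\<^sub>0"
    by (rule T_nonneg[OF t Mg2]) (simp add: g_def of_real_diff[symmetric] del: of_real_diff)
  with T_diff[OF t L2_const g2, of "of_real M"] T_const[OF t, of "of_real M"] T_real[OF t g2]
  have GM: "AE x in \<mu>. Im (G x) = 0 \<and> Re (G x) \<le> M"
    unfolding G_def by eventually_elim (auto simp: complex_nonneg_Reals_iff)
  have intH: "integrable \<mu> (\<lambda>x. Re (H x))"
    using integrable_Re[OF L2_mult_integrable[OF GH(2) L2_const[of 1]]] by simp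
  have inth: "integrable \<mu> h"
    using integrable_Re[OF L2_mult_integrable[OF h2 L2_const[of 1]]] by simp
  have hH: "(LINT x|\<mu>. Re (H x)) = (LINT x|\<mu>. h x)"
  proof -
    have "integrable \<mu> H" "integrable \<mu> (\<lambda>x. complex_of_real (h x))"
      using L2_mult_integrable[OF GH(2) L2_const[of 1]] L2_mult_integrable[OF h2 L2_const[of 1]] by simp_all
    then show ?thesis
      using arg_cong[OF T_integral[OF t h2], of Re] by (simp add: H_def)
  qed
  have "(L2_norm D (T t (\<lambda>x. of_real (f x))))\<^sup>2
      \<le> (LINT x|\<mu>. (cmod (G x))\<^sup>2 + (2 * M * Re (H x) + (cmod (H x))\<^sup>2))"
    unfolding L2_norm_sq
  proof (rule integral_mono_AE)
    show "AE x in \<mu>. (cmod (T t (\<lambda>x. of_real (f x)) x))\<^sup>2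
        \<le> (cmod (G x))\<^sup>2 + (2 * M * Re (H x) + (cmod (H x))\<^sup>2)"
      using F GM H0
    proof eventually_elim
      case (elim x)
      have "Re (G x) * Re (H x) \<le> M * Re (H x)"
        using elim by (intro mult_right_mono) (auto simp: complex_nonneg_Reals_iff)
      then show ?case
        using elim by (simp add: cmod_power2 complex_nonneg_Reals_iff power2_sum)
    qed
  qed (use L2_integrable[OF T_L2[OF t f(1)]] GH[THEN L2_integrable] intH in auto)
  also have "\<dots> = (L2_norm D G)\<^sup>2 + (2 * M * (LINT x|\<mu>. h x) + (L2_norm D H)\<^sup>2)"
    unfolding L2_norm_sq hH[symmetric] using GH[THEN L2_integrable] intH by simp
  also have "\<dots> \<le> (L2_norm D G)\<^sup>2 + (2 * M * (LINT x|\<mu>. h x) + (L2_norm D (\<lambda>x. of_real (h x)))\<^sup>2)"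
    unfolding H_def by (intro add_left_mono power_mono T_contraction t h2 L2_norm_nonneg)
  also have "2 * M * (LINT x|\<mu>. h x) + (L2_norm D (\<lambda>x. of_real (h x)))\<^sup>2
      = (LINT x|\<mu>. 2 * M * h x + (cmod (of_real (h x)))\<^sup>2)"
    unfolding L2_norm_sq using L2_integrable[OF h2] inth by simp
  also have "\<dots> = (LINT x|\<mu>. (cmod (of_real (f x)))\<^sup>2 - (cmod (of_real (g x)))\<^sup>2)"
    unfolding norm_of_real power2_abs
    by (intro Bochner_Integration.integral_cong refl)
      (auto simp: h_def g_def min_def power2_eq_square algebra_simps)
  also have "\<dots> = (L2_norm D (\<lambda>x. of_real (f x)))\<^sup>2 - (L2_norm D (\<lambda>x. of_real (g x)))\<^sup>2"
    unfolding L2_norm_sq using L2_integrable[OF f(1)] L2_integrable[OF g2] by simp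
  finally show ?thesis by (simp add: G_def)
qed

end

section \<open>The truncated nonlinearity\<close>

lemma trunc_F_nonneg_le:
  assumes M: "0 < M"
  shows "0 \<le> trunc_F M z" "trunc_F M z \<le> 6 * M\<^sup>2 * (cmod z)\<^sup>2"
proof -
  define r where "r = cmod z"
  have r: "0 \<le> r" by (simp add: r_def)
  have 1: "0 \<le> 6 * M\<^sup>2 * r\<^sup>2 - 8 * M ^ 3 * r + 3 * M ^ 4 \<and> 6 * M\<^sup>2 * r\<^sup>2 - 8 * M ^ 3 * r + 3 * M ^ 4 \<le> 6 * M\<^sup>2 * r\<^sup>2"
    if "r > M"
  proof -
    have "6 * M\<^sup>2 * r\<^sup>2 - 8 * M ^ 3 * r + 3 * M ^ 4 = M\<^sup>2 * (2 * (r\<^sup>2 - M * M) + 4 * (r - M)\<^sup>2 + M\<^sup>2)"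
      by (simp add: algebra_simps power2_eq_square power3_eq_cube power4_eq_xxxx)
    moreover have "M * M \<le> r\<^sup>2" using that M by (simp add: power2_eq_square mult_mono)
    moreover have "3 * M ^ 4 \<le> 8 * M ^ 3 * r"
    proof -
      have "3 * M ^ 4 \<le> 8 * M ^ 3 * M" using M by (simp add: power3_eq_cube power4_eq_xxxx)
      also have "\<dots> \<le> 8 * M ^ 3 * r" using that M by (intro mult_left_mono) auto
      finally show ?thesis .
    qed
    ultimately show ?thesis by auto
  qed
  have 2: "r ^ 4 \<le> 6 * M\<^sup>2 * r\<^sup>2" if "r \<le> M"
  proof -
    have "r ^ 4 = r\<^sup>2 * r\<^sup>2" by (simp add: power4_eq_xxxx power2_eq_square)
    also have "\<dots> \<le> (6 * M\<^sup>2) * r\<^sup>2"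
      using power_mono[OF that r, of 2] zero_le_power2[of M] zero_le_power2[of r]
      by (intro mult_right_mono) linarith+
    finally show ?thesis .
  qed
  show "0 \<le> trunc_F M z" "trunc_F M z \<le> 6 * M\<^sup>2 * (cmod z)\<^sup>2"
    using 1 2 unfolding trunc_F_def r_def[symmetric] by auto
qed

text \<open>Above the truncation level the difference is \<open>(r - M)\<^sup>3 (r + 3M)\<close>.\<close>

lemma trunc_F_le_quartic:
  assumes M: "0 < M"
  shows "trunc_F M z \<le> cmod z ^ 4"
proof (cases "cmod z \<le> M")
  case False
  define r where "r = cmod z"
  have "r ^ 4 - (6 * M\<^sup>2 * r\<^sup>2 - 8 * M ^ 3 * r + 3 * M ^ 4) = (r - M) ^ 3 * (r + 3 * M)"
    by (simp add: algebra_simps power2_eq_square power3_eq_cube power4_eq_xxxx)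
  moreover have "0 \<le> (r - M) ^ 3 * (r + 3 * M)"
    using False M by (simp add: r_def)
  ultimately show ?thesis using False by (simp add: trunc_F_def r_def)
qed (simp add: trunc_F_def)

text \<open>Above the truncation level the left-hand side is, in the variable \<open>r\<^sup>2\<close>, the tangent at \<open>M\<^sup>2\<close>, and the
  difference is \<open>(2M (r - M))\<^sup>2\<close>.\<close>

lemma trunc_F_ge_truncated:
  assumes M: "0 < M"
  shows "min (cmod z) M ^ 4 + 2 * M\<^sup>2 * ((cmod z)\<^sup>2 - (min (cmod z) M)\<^sup>2) \<le> trunc_F M z"
proof (cases "cmod z \<le> M")
  case False
  define r where "r = cmod z"
  have "6 * M\<^sup>2 * r\<^sup>2 - 8 * M ^ 3 * r + 3 * M ^ 4 - (M ^ 4 + 2 * M\<^sup>2 * (r\<^sup>2 - M\<^sup>2)) = (2 * M * (r - M))\<^sup>2"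
    by (simp add: algebra_simps power2_eq_square power3_eq_cube power4_eq_xxxx)
  moreover have "0 \<le> (2 * M * (r - M))\<^sup>2" by simp
  ultimately have "M ^ 4 + 2 * M\<^sup>2 * (r\<^sup>2 - M\<^sup>2) \<le> 6 * M\<^sup>2 * r\<^sup>2 - 8 * M ^ 3 * r + 3 * M ^ 4" by linarith
  then show ?thesis using False by (simp add: trunc_F_def r_def min_def)
qed (simp add: trunc_F_def)

text \<open>The function \<open>g r = 6M\<^sup>2r\<^sup>2 - F r\<close> is nondecreasing below \<open>M\<close> and affine with positive slope above.\<close>

lemma trunc_F_diff_le:
  assumes M: "0 < M" and le: "cmod z \<le> cmod w"
  shows "trunc_F M w - trunc_F M z \<le> 6 * M\<^sup>2 * ((cmod w)\<^sup>2 - (cmod z)\<^sup>2)"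
proof -
  define g where "g r = 6 * M\<^sup>2 * r\<^sup>2 - (if r \<le> M then r ^ 4 else 6 * M\<^sup>2 * r\<^sup>2 - 8 * M ^ 3 * r + 3 * M ^ 4)" for r
  have low: "g r \<le> g s" if "0 \<le> r" "r \<le> s" "s \<le> M" for r s
  proof -
    have sq: "r\<^sup>2 \<le> s\<^sup>2" "r\<^sup>2 \<le> M\<^sup>2" "s\<^sup>2 \<le> M\<^sup>2" using that by (auto intro: power_mono)
    have "0 \<le> (s\<^sup>2 - r\<^sup>2) * (6 * M\<^sup>2 - s\<^sup>2 - r\<^sup>2)"
      using sq zero_le_power2[of M] by (intro mult_nonneg_nonneg) linarith+
    also have "\<dots> = g s - g r"
      using that by (simp add: g_def algebra_simps power2_eq_square power4_eq_xxxx)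
    finally show ?thesis by simp
  qed
  have high: "g r \<le> g s" if "M \<le> r" "r \<le> s" for r s
  proof -
    have g_high: "g x = 8 * M ^ 3 * x - 3 * M ^ 4" if "M \<le> x" for x
      using that by (cases "x = M") (simp_all add: g_def power2_eq_square power3_eq_cube power4_eq_xxxx)
    have "8 * M ^ 3 * r \<le> 8 * M ^ 3 * s" using that M by (intro mult_left_mono) auto
    then show ?thesis using that g_high[of r] g_high[of s] by simp
  qed
  have "g (cmod z) \<le> g (cmod w)"
    using low[of "cmod z" "cmod w"] high[of "cmod z" "cmod w"]
      order_trans[OF low[of "cmod z" M] high[of M "cmod w"]] le M
    by (meson linorder_le_cases norm_ge_zero order_refl)
  then show ?thesis
    by (simp add: g_def trunc_F_def algebra_simps split: if_splits)
qed

lemma trunc_F_measurable [measurable]: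
  assumes [measurable]: "f \<in> borel_measurable N"
  shows "(\<lambda>x. trunc_F M (f x)) \<in> borel_measurable N"
  unfolding trunc_F_def by measurable

section \<open>Moving mass without raising the energy\<close>

locale truncated_energy = periodic_heat +
  fixes V :: "'a \<Rightarrow> real" and \<beta> \<kappa> \<tau> :: real
  assumes tau: "\<tau> > 0" and beta: "\<beta> > 0"
    and V_Linf: "V \<in> Linf D" and V_nonneg: "\<And>x. x \<in> D \<Longrightarrow> V x \<ge> 0"
    and kappa: "ereal \<kappa> \<ge> Linf_norm D V + ereal (3 * \<beta> * (trunc_level D \<beta> V)\<^sup>2)"
begin

abbreviation "M \<equiv> trunc_level D \<beta> V"
abbreviation "m \<equiv> measure lebesgue D"
abbreviation "E \<equiv> trunc_energy D T V \<beta> \<kappa> \<tau>"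
abbreviation "S \<equiv> T (\<tau> / 2)"

lemma tau2: "0 \<le> \<tau> / 2" using tau by simp

lemma m_pos: "0 < m" by (rule box_measure_pos[OF ab])

lemma V_measurable [measurable]: "V \<in> borel_measurable \<mu>"
  using V_Linf by (simp add: Linf_def)

lemma V_AE: "AE x in \<mu>. 0 \<le> V x \<and> V x \<le> \<kappa> - 3 * \<beta> * M\<^sup>2"
proof -
  have "AE x in \<mu>. ereal \<bar>V x\<bar> \<le> Linf_norm D V"
    unfolding Linf_norm_def by (rule esssup_AE)
  with AE_space show ?thesis
  proof eventually_elim
    case (elim x)
    have "ereal \<bar>V x\<bar> + ereal (3 * \<beta> * M\<^sup>2) \<le> ereal \<kappa>"
      using add_right_mono[OF elim(2)] kappa by (rule order_trans)
    then show ?case using elim(1) V_nonneg[of x] by simp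
  qed
qed

lemma integrable_const: "integrable \<mu> (\<lambda>_. c :: real)"
proof -
  interpret finite_measure \<mu> by (rule finite_measure_lebesgue_on) simp
  show ?thesis by simp
qed

lemma integral_const: "(LINT x|\<mu>. c :: real) = m * c"
  by (simp add: measure_restrict_space)

lemma V_mult_integrable:
  assumes "integrable \<mu> g"
  shows "integrable \<mu> (\<lambda>x. V x * g x)"
proof (rule Bochner_Integration.integrable_bound)
  show "integrable \<mu> (\<lambda>x. (\<kappa> - 3 * \<beta> * M\<^sup>2) * g x)" using assms by simp
  show "AE x in \<mu>. norm (V x * g x) \<le> norm ((\<kappa> - 3 * \<beta> * M\<^sup>2) * g x)"
    using V_AE by eventually_elim (auto simp: abs_mult intro!: mult_right_mono)
qed (use assms in measurable)

lemma V_integrable: "integrable \<mu> V"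
  using V_mult_integrable[OF integrable_const[of 1]] by simp

lemma V_integral: "0 \<le> (LINT x|\<mu>. V x)" "(LINT x|\<mu>. V x) \<le> m * (\<kappa> - 3 * \<beta> * M\<^sup>2)"
proof -
  show "0 \<le> (LINT x|\<mu>. V x)"
    using V_AE by (intro integral_nonneg_AE) (auto elim!: eventually_mono)
  show "(LINT x|\<mu>. V x) \<le> m * (\<kappa> - 3 * \<beta> * M\<^sup>2)"
    unfolding integral_const[symmetric] using V_AE
    by (intro integral_mono_AE V_integrable integrable_const) (auto elim!: eventually_mono)
qed

lemma M_sq: "\<beta> * (m * M\<^sup>2) = \<beta> + 2 * (LINT x|\<mu>. V x)"
proof -
  have "M\<^sup>2 = (\<beta> + 2 * (LINT x|\<mu>. V x)) / (\<beta> * m)"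
    unfolding trunc_level_def using beta m_pos V_integral(1) by simp
  then show ?thesis using beta m_pos by (simp add: field_simps)
qed

lemma M_pos: "0 < M"
  unfolding trunc_level_def using beta m_pos V_integral(1) by (simp add: add_pos_nonneg)

lemma F_integrable:
  assumes "f \<in> L2 D"
  shows "integrable \<mu> (\<lambda>x. trunc_F M (f x))"
proof (rule Bochner_Integration.integrable_bound)
  show "integrable \<mu> (\<lambda>x. 6 * M\<^sup>2 * (cmod (f x))\<^sup>2)" using L2_integrable[OF assms] by simp
  show "AE x in \<mu>. norm (trunc_F M (f x)) \<le> norm (6 * M\<^sup>2 * (cmod (f x))\<^sup>2)"
    using trunc_F_nonneg_le[OF M_pos] by (intro AE_I2) simp
qed (use L2_measurable[OF assms] in measurable)

lemma energy_eq:
  assumes f: "f \<in> L2 D"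
  shows "E f = (1 - (L2_norm D (S f))\<^sup>2) / (2 * \<tau>) + (LINT x|\<mu>. V x * (cmod (f x))\<^sup>2)
    + \<beta> / 2 * (LINT x|\<mu>. trunc_F M (f x)) + \<kappa> * (1 - (L2_norm D f)\<^sup>2)"
proof -
  have "(LINT x|\<mu>. - (1 / (2 * \<tau>)) * (cmod (S f x))\<^sup>2 + V x * (cmod (f x))\<^sup>2
          + \<beta> / 2 * trunc_F M (f x) - \<kappa> * (cmod (f x))\<^sup>2)
    = - (1 / (2 * \<tau>)) * (LINT x|\<mu>. (cmod (S f x))\<^sup>2) + (LINT x|\<mu>. V x * (cmod (f x))\<^sup>2)
      + \<beta> / 2 * (LINT x|\<mu>. trunc_F M (f x)) - \<kappa> * (LINT x|\<mu>. (cmod (f x))\<^sup>2)"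
    using L2_integrable[OF f] L2_integrable[OF T_L2[OF tau2 f]] F_integrable[OF f]
      V_mult_integrable[OF L2_integrable[OF f]] by simp
  then show ?thesis
    unfolding trunc_energy_def L2_norm_sq using tau by (simp add: field_simps)
qed

lemma S_norm_const: "(L2_norm D (S (\<lambda>_. c)))\<^sup>2 = m * (cmod c)\<^sup>2"
proof -
  have "L2_norm D (S (\<lambda>_. c)) = L2_norm D (\<lambda>_. c)"
    by (intro L2_norm_cong_AE T_const tau2 L2_measurable T_L2 L2_const)
  then have "(L2_norm D (S (\<lambda>_. c)))\<^sup>2 = (L2_norm D (\<lambda>_. c))\<^sup>2" by (rule arg_cong)
  also have "\<dots> = m * (cmod c)\<^sup>2" unfolding L2_norm_sq by (rule integral_const)
  finally show ?thesis .
qed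

text \<open>Adding the mass \<open>d\<close> uniformly. The heat term gains at least \<open>d\<close>, because \<open>S\<close> fixes constants.\<close>

lemma spread_mass:
  assumes g: "(\<lambda>x. complex_of_real (g x)) \<in> L2 D" and d: "0 \<le> d"
  defines "h \<equiv> \<lambda>x. sqrt ((g x)\<^sup>2 + d / m)"
  shows "(\<lambda>x. complex_of_real (h x)) \<in> L2 D"
    and "(L2_norm D (\<lambda>x. of_real (h x)))\<^sup>2 = (L2_norm D (\<lambda>x. of_real (g x)))\<^sup>2 + d"
    and "(L2_norm D (S (\<lambda>x. of_real (g x))))\<^sup>2 + d \<le> (L2_norm D (S (\<lambda>x. of_real (h x))))\<^sup>2"
    and "(LINT x|\<mu>. V x * (h x)\<^sup>2) = (LINT x|\<mu>. V x * (g x)\<^sup>2) + d / m * (LINT x|\<mu>. V x)"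
proof -
  have [measurable]: "g \<in> borel_measurable \<mu>"
    using measurable_compose[OF L2_measurable[OF g] borel_measurable_Re] by simp
  have hh: "(h x)\<^sup>2 = (g x)\<^sup>2 + d / m" for x
    unfolding h_def using d m_pos by simp
  have g_int: "integrable \<mu> (\<lambda>x. (g x)\<^sup>2)" using L2_integrable[OF g] by simp
  have "integrable \<mu> (\<lambda>x. (h x)\<^sup>2)"
    unfolding hh using g_int integrable_const by simp
  then show h2: "(\<lambda>x. complex_of_real (h x)) \<in> L2 D"
    unfolding L2_def h_def by simp
  show "(L2_norm D (\<lambda>x. of_real (h x)))\<^sup>2 = (L2_norm D (\<lambda>x. of_real (g x)))\<^sup>2 + d"
    unfolding L2_norm_sq norm_of_real power2_abs hh using g_int integrable_const[of "d / m"] integral_const[of "d / m"] m_pos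
    by simp
  have "(L2_norm D (S (\<lambda>x. of_real (sqrt (d / m)))))\<^sup>2 = d"
    using S_norm_const[of "of_real (sqrt (d / m))"] d m_pos by simp
  moreover have "h = (\<lambda>x. sqrt ((g x)\<^sup>2 + (sqrt (d / m))\<^sup>2))"
    unfolding h_def using d m_pos by simp
  ultimately show "(L2_norm D (S (\<lambda>x. of_real (g x))))\<^sup>2 + d \<le> (L2_norm D (S (\<lambda>x. of_real (h x))))\<^sup>2"
    using T_norm_sqrt_sum_squares[OF tau2 g L2_const[of "of_real (sqrt (d / m))"]] by simp
  show "(LINT x|\<mu>. V x * (h x)\<^sup>2) = (LINT x|\<mu>. V x * (g x)\<^sup>2) + d / m * (LINT x|\<mu>. V x)"
    unfolding hh distrib_left using V_mult_integrable[OF g_int] V_integrable by simp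
qed

text \<open>Spreading the missing mass \<open>d\<close> raises the potential energy by at most \<open>d(\<kappa> - 3\<beta>M\<^sup>2)\<close> and the
  nonlinear energy by at most \<open>3\<beta>M\<^sup>2d\<close>; together this is the gain \<open>\<kappa>d\<close>.\<close>

lemma energy_ball_ge_sphere:
  assumes u: "u \<in> L2 D" "L2_norm D u \<le> 1"
  obtains w where "w \<in> L2 D" "L2_norm D w = 1" "E w \<le> E u"
proof -
  define d where "d = 1 - (L2_norm D u)\<^sup>2"
  have d: "0 \<le> d" using u(2) by (simp add: d_def power_le_one)
  define h where "h x = sqrt ((cmod (u x))\<^sup>2 + d / m)" for x
  define w where "w = (\<lambda>x. complex_of_real (h x))"
  note sp = spread_mass[OF L2_cmod[OF u(1)] d, folded h_def]
  have un: "L2_norm D (\<lambda>x. of_real (cmod (u x))) = L2_norm D u" by (simp add: L2_norm_def)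
  have w2: "w \<in> L2 D" using sp(1) by (simp add: w_def)
  have wn: "(L2_norm D w)\<^sup>2 = 1" using sp(2) un by (simp add: w_def d_def)
  then have w1: "L2_norm D w = 1" by (simp add: power2_eq_1_iff) (use L2_norm_nonneg[of D w] in linarith)
  have hc: "(cmod (w x))\<^sup>2 = (cmod (u x))\<^sup>2 + d / m" for x
    using d m_pos by (simp add: w_def h_def)
  have Su: "(L2_norm D (S u))\<^sup>2 \<le> (L2_norm D (S w))\<^sup>2"
  proof -
    have "(L2_norm D (S u))\<^sup>2 \<le> (L2_norm D (S (\<lambda>x. of_real (cmod (u x)))))\<^sup>2"
      by (intro power_mono T_norm_cmod_le tau2 u L2_norm_nonneg)
    then show ?thesis using sp(3) d unfolding w_def by linarith
  qed
  have Vw: "(LINT x|\<mu>. V x * (cmod (w x))\<^sup>2) \<le> (LINT x|\<mu>. V x * (cmod (u x))\<^sup>2) + d * (\<kappa> - 3 * \<beta> * M\<^sup>2)"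
  proof -
    have "d / m * (LINT x|\<mu>. V x) \<le> d / m * (m * (\<kappa> - 3 * \<beta> * M\<^sup>2))"
      using d m_pos by (intro mult_left_mono V_integral) auto
    then show ?thesis using sp(4) m_pos by (simp add: w_def)
  qed
  have "(LINT x|\<mu>. trunc_F M (w x)) \<le> (LINT x|\<mu>. trunc_F M (u x) + 6 * M\<^sup>2 * (d / m))"
  proof (rule integral_mono)
    show "trunc_F M (w x) \<le> trunc_F M (u x) + 6 * M\<^sup>2 * (d / m)" for x
    proof -
      have "cmod (u x) \<le> cmod (w x)"
        by (rule power2_le_imp_le) (use hc[of x] d m_pos in auto)
      from trunc_F_diff_le[OF M_pos this] show ?thesis unfolding hc by simp
    qed
  qed (use F_integrable[OF w2] F_integrable[OF u(1)] integrable_const in auto)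
  also have "\<dots> = (LINT x|\<mu>. trunc_F M (u x)) + 6 * M\<^sup>2 * d"
    using F_integrable[OF u(1)] integrable_const integral_const[of "6 * M\<^sup>2 * (d / m)"] m_pos by simp
  finally have Fw: "\<beta> / 2 * (LINT x|\<mu>. trunc_F M (w x)) \<le> \<beta> / 2 * ((LINT x|\<mu>. trunc_F M (u x)) + 6 * M\<^sup>2 * d)"
    using beta by (intro mult_left_mono) auto
  have Sw: "(1 - (L2_norm D (S w))\<^sup>2) / (2 * \<tau>) \<le> (1 - (L2_norm D (S u))\<^sup>2) / (2 * \<tau>)"
    using Su tau by (intro divide_right_mono) auto
  have "E w \<le> E u"
    unfolding energy_eq[OF w2] energy_eq[OF u(1)] wn
    using Vw Fw Sw by (simp add: algebra_simps d_def)
  then show ?thesis using that w2 w1 by blast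
qed

section \<open>Existence of a minimiser\<close>

text \<open>On functions of norm one this is the energy with \<open>|\<phi>|\<^sup>4\<close> in place of the truncated nonlinearity.\<close>

definition quartic_energy :: "('a \<Rightarrow> real) \<Rightarrow> real" where
  "quartic_energy f = (1 - (L2_norm D (S (\<lambda>x. of_real (f x))))\<^sup>2) / (2 * \<tau>)
    + (LINT x|\<mu>. V x * (f x)\<^sup>2) + \<beta> / 2 * (LINT x|\<mu>. f x ^ 4)"

text \<open>Height \<open>M\<close> together with all of the unit mass spread over the domain.\<close>

definition height :: real where "height = sqrt (M\<^sup>2 + 1 / m)"

definition profiles :: "('a \<Rightarrow> real) set" where
  "profiles = {f \<in> borel_measurable \<mu>. (\<forall>x. 0 \<le> f x \<and> f x \<le> height) \<and> (LINT x|\<mu>. (f x)\<^sup>2) = 1}"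

lemma height_pos: "0 < height"
  unfolding height_def using m_pos M_pos by (simp add: add_nonneg_pos)

lemma bounded_integrable:
  assumes [measurable]: "f \<in> borel_measurable \<mu>" and f: "\<And>x. \<bar>f x\<bar> \<le> B"
  shows "integrable \<mu> (f :: 'a \<Rightarrow> real)"
proof -
  interpret finite_measure \<mu> by (rule finite_measure_lebesgue_on) simp
  show ?thesis by (rule integrable_const_bound[of _ B]) (use f in auto)
qed

lemma bounded_L2:
  assumes "f \<in> borel_measurable \<mu>" and f: "\<And>x. \<bar>f x\<bar> \<le> B"
  shows "(\<lambda>x. complex_of_real (f x)) \<in> L2 D"
  by (rule L2_bounded[where B=B]) (use assms in auto)

lemma profilesD:
  assumes "f \<in> profiles"
  shows "f \<in> borel_measurable \<mu>" "\<And>x. 0 \<le> f x" "\<And>x. f x \<le> height" "(\<lambda>x. complex_of_real (f x)) \<in> L2 D"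
    "L2_norm D (\<lambda>x. complex_of_real (f x)) = 1" "\<And>k. integrable \<mu> (\<lambda>x. f x ^ k)"
proof -
  show f: "f \<in> borel_measurable \<mu>" "\<And>x. 0 \<le> f x" "\<And>x. f x \<le> height"
    using assms by (auto simp: profiles_def)
  then show "(\<lambda>x. complex_of_real (f x)) \<in> L2 D"
    by (intro bounded_L2[where B=height]) auto
  show "L2_norm D (\<lambda>x. complex_of_real (f x)) = 1"
    using assms by (simp add: profiles_def L2_norm_def)
  show "integrable \<mu> (\<lambda>x. f x ^ k)" for k
    using f by (intro bounded_integrable[where B="height ^ k"]) (auto simp: power_abs intro!: power_mono)
qed

lemma energy_le_quartic_energy:
  assumes f: "f \<in> profiles"
  shows "E (\<lambda>x. of_real (f x)) \<le> quartic_energy f"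
proof -
  note Y = profilesD[OF f]
  have "(LINT x|\<mu>. trunc_F M (of_real (f x))) \<le> (LINT x|\<mu>. f x ^ 4)"
  proof (rule integral_mono)
    show "trunc_F M (of_real (f x)) \<le> f x ^ 4" for x
      using trunc_F_le_quartic[OF M_pos, of "of_real (f x)"] Y(2)[of x] by simp
  qed (use F_integrable[OF Y(4)] Y(6) in auto)
  then show ?thesis
    unfolding energy_eq[OF Y(4)] quartic_energy_def Y(5) using beta by simp
qed

text \<open>Cutting off at height \<open>M\<close> and spreading the mass \<open>d\<close> that was cut off. The nonlinear energy drops by
  \<open>\<beta>M\<^sup>2d\<close> at the cut and grows by at most \<open>\<beta>d/|D|\<close> through the spreading, the potential energy grows by at most
  \<open>d \<integral>V / |D|\<close>, and \<open>\<beta>M\<^sup>2 = (\<beta> + 2\<integral>V)/|D|\<close>.\<close>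

lemma quartic_energy_le_energy:
  assumes u: "u \<in> L2 D" "L2_norm D u = 1"
  obtains f where "f \<in> profiles" "quartic_energy f \<le> E u"
proof -
  note [measurable] = L2_measurable[OF u(1)]
  define g where "g = (\<lambda>x. min (cmod (u x)) M)"
  have [measurable]: "g \<in> borel_measurable \<mu>" unfolding g_def by measurable
  have gb: "0 \<le> g x" "g x \<le> cmod (u x)" "g x \<le> M" for x
    using M_pos by (auto simp: g_def)
  have g2: "(\<lambda>x. complex_of_real (g x)) \<in> L2 D"
    by (rule bounded_L2[where B=M]) (use gb in auto)
  have un: "L2_norm D (\<lambda>x. of_real (cmod (u x))) = 1" using u(2) by (simp add: L2_norm_def)
  have gi: "integrable \<mu> (\<lambda>x. g x ^ k)" for k
    using gb by (intro bounded_integrable[where B="M ^ k"]) (auto simp: power_abs intro!: power_mono)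
  define d where "d = 1 - (LINT x|\<mu>. (g x)\<^sup>2)"
  have gd: "(LINT x|\<mu>. (g x)\<^sup>2) = 1 - d" by (simp add: d_def)
  have gn: "(L2_norm D (\<lambda>x. of_real (g x)))\<^sup>2 = 1 - d"
    unfolding L2_norm_sq using gd by simp
  have u_int: "(LINT x|\<mu>. (cmod (u x))\<^sup>2) = 1" using u(2) L2_norm_sq[of D u] by simp
  have "(LINT x|\<mu>. (g x)\<^sup>2) \<le> (LINT x|\<mu>. (cmod (u x))\<^sup>2)"
    using gi L2_integrable[OF u(1)] gb by (intro integral_mono power_mono) auto
  then have d: "0 \<le> d" using u_int by (simp add: d_def)
  have d1: "d \<le> 1" using gn zero_le_power2[of "L2_norm D (\<lambda>x. of_real (g x))"] by linarith
  define f where "f x = sqrt ((g x)\<^sup>2 + d / m)" for x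
  note sp = spread_mass[OF g2 d, folded f_def]
  have ff: "(f x)\<^sup>2 = (g x)\<^sup>2 + d / m" for x unfolding f_def using d m_pos by simp
  have fY: "f \<in> profiles"
    unfolding profiles_def mem_Collect_eq
  proof (intro conjI allI)
    show "f \<in> borel_measurable \<mu>" unfolding f_def by measurable
    show "0 \<le> f x" for x unfolding f_def using d m_pos by simp
    show "f x \<le> height" for x
      unfolding f_def height_def
      using gb[of x] d1 m_pos by (intro real_sqrt_le_mono add_mono power_mono divide_right_mono) auto
    show "(LINT x|\<mu>. (f x)\<^sup>2) = 1"
      using sp(2) gn unfolding L2_norm_sq by simp
  qed
  have Sf: "(L2_norm D (S u))\<^sup>2 \<le> (L2_norm D (S (\<lambda>x. of_real (f x))))\<^sup>2"
  proof -
    have "(L2_norm D (S u))\<^sup>2 \<le> (L2_norm D (S (\<lambda>x. of_real (cmod (u x)))))\<^sup>2"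
      by (intro power_mono T_norm_cmod_le tau2 u L2_norm_nonneg)
    also have "\<dots> \<le> (L2_norm D (S (\<lambda>x. of_real (g x))))\<^sup>2 + d"
      using T_truncation[OF tau2 L2_cmod[OF u(1)] _ less_imp_le[OF M_pos]] gn un by (simp add: g_def)
    also have "\<dots> \<le> (L2_norm D (S (\<lambda>x. of_real (f x))))\<^sup>2" by (rule sp(3))
    finally show ?thesis .
  qed
  have Vf: "(LINT x|\<mu>. V x * (f x)\<^sup>2) \<le> (LINT x|\<mu>. V x * (cmod (u x))\<^sup>2) + d / m * (LINT x|\<mu>. V x)"
  proof -
    have "(LINT x|\<mu>. V x * (g x)\<^sup>2) \<le> (LINT x|\<mu>. V x * (cmod (u x))\<^sup>2)"
    proof (rule integral_mono_AE)
      show "AE x in \<mu>. V x * (g x)\<^sup>2 \<le> V x * (cmod (u x))\<^sup>2"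
        using V_AE by eventually_elim (use gb in \<open>auto intro!: mult_left_mono power_mono\<close>)
    qed (intro V_mult_integrable gi L2_integrable u)+
    then show ?thesis using sp(4) by simp
  qed
  have f4: "(LINT x|\<mu>. f x ^ 4) \<le> (LINT x|\<mu>. g x ^ 4) + 2 * (d / m)"
  proof -
    have "f x ^ 4 = g x ^ 4 + 2 * (d / m) * (g x)\<^sup>2 + (d / m)\<^sup>2" for x
    proof -
      have "f x ^ 4 = ((f x)\<^sup>2)\<^sup>2" by simp
      also have "\<dots> = ((g x)\<^sup>2)\<^sup>2 + 2 * (d / m) * (g x)\<^sup>2 + (d / m)\<^sup>2"
        unfolding ff by (simp add: power2_sum)
      finally show ?thesis by simp
    qed
    then have "(LINT x|\<mu>. f x ^ 4) = (LINT x|\<mu>. g x ^ 4) + 2 * (d / m) * (1 - d) + m * (d / m)\<^sup>2"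
      using gi integrable_const integral_const[of "(d / m)\<^sup>2"] gd by simp
    also have "\<dots> = (LINT x|\<mu>. g x ^ 4) + 2 * (d / m) - d * (d / m)"
      using m_pos by (simp add: power2_eq_square field_simps)
    also have "\<dots> \<le> (LINT x|\<mu>. g x ^ 4) + 2 * (d / m)"
      using d m_pos by simp
    finally show ?thesis .
  qed
  have Fu: "(LINT x|\<mu>. g x ^ 4) + 2 * M\<^sup>2 * d \<le> (LINT x|\<mu>. trunc_F M (u x))"
  proof -
    have "(LINT x|\<mu>. g x ^ 4) + 2 * M\<^sup>2 * d = (LINT x|\<mu>. g x ^ 4 + 2 * M\<^sup>2 * ((cmod (u x))\<^sup>2 - (g x)\<^sup>2))"
      using gi L2_integrable[OF u(1)] gd u_int by simp
    also have "\<dots> \<le> (LINT x|\<mu>. trunc_F M (u x))"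
      using gi L2_integrable[OF u(1)] F_integrable[OF u(1)] trunc_F_ge_truncated[OF M_pos]
      by (intro integral_mono) (auto simp: g_def)
    finally show ?thesis .
  qed
  have balance: "d / m * (LINT x|\<mu>. V x) + \<beta> / 2 * (2 * (d / m)) \<le> \<beta> / 2 * (2 * M\<^sup>2 * d)"
  proof -
    have "d / m * (LINT x|\<mu>. V x) + \<beta> / 2 * (2 * (d / m)) = d / m * ((LINT x|\<mu>. V x) + \<beta>)"
      by (simp add: algebra_simps)
    also have "\<dots> \<le> d / m * (\<beta> * (m * M\<^sup>2))"
      unfolding M_sq using d m_pos V_integral(1) by (intro mult_left_mono) auto
    also have "\<dots> = \<beta> / 2 * (2 * M\<^sup>2 * d)" using m_pos by simp
    finally show ?thesis .
  qed
  have "\<beta> / 2 * (LINT x|\<mu>. f x ^ 4) \<le> \<beta> / 2 * (LINT x|\<mu>. g x ^ 4) + \<beta> / 2 * (2 * (d / m))"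
    unfolding distrib_left[symmetric] using f4 beta by (intro mult_left_mono) auto
  moreover have "\<beta> / 2 * (LINT x|\<mu>. g x ^ 4) + \<beta> / 2 * (2 * M\<^sup>2 * d) \<le> \<beta> / 2 * (LINT x|\<mu>. trunc_F M (u x))"
    unfolding distrib_left[symmetric] using Fu beta by (intro mult_left_mono) auto
  moreover have "(1 - (L2_norm D (S (\<lambda>x. of_real (f x))))\<^sup>2) / (2 * \<tau>) \<le> (1 - (L2_norm D (S u))\<^sup>2) / (2 * \<tau>)"
    using Sf tau by (intro divide_right_mono) auto
  moreover have combine: "wf \<le> wg + s \<Longrightarrow> wg + c \<le> wu \<Longrightarrow> kf \<le> ku \<Longrightarrow> vf \<le> vu + e \<Longrightarrow> e + s \<le> c
      \<Longrightarrow> kf + vf + wf \<le> ku + vu + wu + \<kappa> * (1 - 1)" for wf wg s c wu kf ku vf vu e :: real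
    by simp
  ultimately have "quartic_energy f \<le> E u"
    unfolding energy_eq[OF u(1)] quartic_energy_def u(2) power_one using Vf balance by (intro combine)
  then show ?thesis using that fY by blast
qed

text \<open>The midpoint is taken between the densities \<open>p\<^sup>2\<close> and \<open>q\<^sup>2\<close>: the heat term is convex, the potential linear,
  and the quartic term quadratic in the density, so the parallelogram identity applies to it.\<close>

lemma quartic_energy_midpoint:
  assumes p: "p \<in> profiles" and q: "q \<in> profiles"
  defines "h \<equiv> \<lambda>x. sqrt (((p x)\<^sup>2 + (q x)\<^sup>2) / 2)"
  shows "h \<in> profiles" "quartic_energy h \<le> (quartic_energy p + quartic_energy q) / 2 - \<beta> / 8 * (LINT x|\<mu>. ((p x)\<^sup>2 - (q x)\<^sup>2)\<^sup>2)"
proof -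
  note P = profilesD[OF p] and QQ = profilesD[OF q]
  note [measurable] = P(1) QQ(1)
  have hh: "(h x)\<^sup>2 = ((p x)\<^sup>2 + (q x)\<^sup>2) / 2" for x unfolding h_def by simp
  show hY: "h \<in> profiles"
    unfolding profiles_def mem_Collect_eq
  proof (intro conjI allI)
    show "h \<in> borel_measurable \<mu>" unfolding h_def by measurable
    show "0 \<le> h x" for x unfolding h_def by simp
    show "h x \<le> height" for x
    proof -
      have "(p x)\<^sup>2 \<le> height\<^sup>2" "(q x)\<^sup>2 \<le> height\<^sup>2"
        using P(2,3) QQ(2,3) by (auto intro: power_mono)
      then have "(h x)\<^sup>2 \<le> height\<^sup>2" unfolding hh by simp
      then show ?thesis by (rule power2_le_imp_le) (use height_pos in simp)
    qed
    show "(LINT x|\<mu>. (h x)\<^sup>2) = 1"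
      unfolding hh using P(6) QQ(6) p q by (simp add: profiles_def)
  qed
  define c where "c = sqrt (1 / 2)"
  have c: "c\<^sup>2 = 1 / 2" by (simp add: c_def)
  have Sc: "(L2_norm D (S (\<lambda>x. of_real (c * f x))))\<^sup>2 = (L2_norm D (S (\<lambda>x. of_real (f x))))\<^sup>2 / 2"
    "(\<lambda>x. of_real (c * f x)) \<in> L2 D" if "(\<lambda>x. complex_of_real (f x)) \<in> L2 D" for f
  proof -
    note cf = L2_cmult[OF that, of "of_real c"]
    then show "(\<lambda>x. of_real (c * f x)) \<in> L2 D" by simp
    have "L2_norm D (S (\<lambda>x. of_real c * of_real (f x))) = L2_norm D (\<lambda>x. of_real c * S (\<lambda>x. of_real (f x)) x)"
      by (intro L2_norm_cong_AE T_cmult tau2 that L2_measurable T_L2 cf L2_cmult)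
    then show "(L2_norm D (S (\<lambda>x. of_real (c * f x))))\<^sup>2 = (L2_norm D (S (\<lambda>x. of_real (f x))))\<^sup>2 / 2"
      unfolding L2_norm_cmult using c by (simp add: power_mult_distrib)
  qed
  have "h = (\<lambda>x. sqrt ((c * p x)\<^sup>2 + (c * q x)\<^sup>2))"
    unfolding h_def power_mult_distrib c by (simp add: add_divide_distrib)
  then have "(L2_norm D (S (\<lambda>x. of_real (p x))))\<^sup>2 / 2 + (L2_norm D (S (\<lambda>x. of_real (q x))))\<^sup>2 / 2
      \<le> (L2_norm D (S (\<lambda>x. of_real (h x))))\<^sup>2"
    using T_norm_sqrt_sum_squares[OF tau2 Sc(2)[OF P(4)] Sc(2)[OF QQ(4)]] Sc(1)[OF P(4)] Sc(1)[OF QQ(4)] by simp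
  then have "(1 - (L2_norm D (S (\<lambda>x. of_real (h x))))\<^sup>2) / (2 * \<tau>)
      \<le> (1 - ((L2_norm D (S (\<lambda>x. of_real (p x))))\<^sup>2 / 2 + (L2_norm D (S (\<lambda>x. of_real (q x))))\<^sup>2 / 2)) / (2 * \<tau>)"
    using tau by (intro divide_right_mono) auto
  also have "\<dots> = ((1 - (L2_norm D (S (\<lambda>x. of_real (p x))))\<^sup>2) / (2 * \<tau>)
      + (1 - (L2_norm D (S (\<lambda>x. of_real (q x))))\<^sup>2) / (2 * \<tau>)) / 2"
    using tau by (simp add: field_simps)
  finally have 1: "(1 - (L2_norm D (S (\<lambda>x. of_real (h x))))\<^sup>2) / (2 * \<tau>) \<le> \<dots>" .
  have "(LINT x|\<mu>. V x * (h x)\<^sup>2) = (LINT x|\<mu>. (V x * (p x)\<^sup>2 + V x * (q x)\<^sup>2) / 2)"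
    unfolding hh by (simp add: algebra_simps)
  then have 2: "(LINT x|\<mu>. V x * (h x)\<^sup>2) = ((LINT x|\<mu>. V x * (p x)\<^sup>2) + (LINT x|\<mu>. V x * (q x)\<^sup>2)) / 2"
    using V_mult_integrable[OF P(6)] V_mult_integrable[OF QQ(6)] by simp
  have d_int: "integrable \<mu> (\<lambda>x. ((p x)\<^sup>2 - (q x)\<^sup>2)\<^sup>2)"
  proof (rule bounded_integrable[where B="(height\<^sup>2)\<^sup>2"])
    fix x
    have "0 \<le> (p x)\<^sup>2" "(p x)\<^sup>2 \<le> height\<^sup>2" "0 \<le> (q x)\<^sup>2" "(q x)\<^sup>2 \<le> height\<^sup>2"
      using P(2,3) QQ(2,3) by (auto intro: power_mono)
    then have "\<bar>(p x)\<^sup>2 - (q x)\<^sup>2\<bar> \<le> height\<^sup>2" by linarith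
    from power_mono[OF this, of 2] show "\<bar>((p x)\<^sup>2 - (q x)\<^sup>2)\<^sup>2\<bar> \<le> (height\<^sup>2)\<^sup>2" by simp
  qed measurable
  have "h x ^ 4 = (p x ^ 4 + q x ^ 4) / 2 - ((p x)\<^sup>2 - (q x)\<^sup>2)\<^sup>2 / 4" for x
  proof -
    have "h x ^ 4 = ((h x)\<^sup>2)\<^sup>2" by simp
    also have "\<dots> = (((p x)\<^sup>2)\<^sup>2 + ((q x)\<^sup>2)\<^sup>2) / 2 - ((p x)\<^sup>2 - (q x)\<^sup>2)\<^sup>2 / 4"
      unfolding hh by (simp add: power2_eq_square field_simps)
    finally show ?thesis by simp
  qed
  then have 3: "(LINT x|\<mu>. h x ^ 4) = ((LINT x|\<mu>. p x ^ 4) + (LINT x|\<mu>. q x ^ 4)) / 2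
      - (LINT x|\<mu>. ((p x)\<^sup>2 - (q x)\<^sup>2)\<^sup>2) / 4"
    using P(6) QQ(6) d_int by simp
  show "quartic_energy h \<le> (quartic_energy p + quartic_energy q) / 2 - \<beta> / 8 * (LINT x|\<mu>. ((p x)\<^sup>2 - (q x)\<^sup>2)\<^sup>2)"
  proof -
    have dist: "\<beta> / 2 * ((A + B) / 2 - C / 4) = (\<beta> / 2 * A + \<beta> / 2 * B) / 2 - \<beta> / 8 * C" for A B C
      by (simp add: field_simps)
    have combine: "kh \<le> (kp + kq) / 2 \<Longrightarrow>
        kh + (vp + vq) / 2 + ((wp + wq) / 2 - c) \<le> ((kp + vp + wp) + (kq + vq + wq)) / 2 - c"
      for kh kp kq vp vq wp wq c :: real
      by (simp add: field_simps)
    show ?thesis unfolding quartic_energy_def 2 3 dist by (rule combine[OF 1])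
  qed
qed

lemma quartic_energy_nonneg:
  assumes "f \<in> profiles"
  shows "0 \<le> quartic_energy f"
proof -
  note Y = profilesD[OF assms]
  have "L2_norm D (S (\<lambda>x. of_real (f x))) \<le> 1"
    using T_contraction[OF tau2 Y(4)] Y(5) by simp
  then have "(L2_norm D (S (\<lambda>x. of_real (f x))))\<^sup>2 \<le> 1"
    by (simp add: power_le_one)
  moreover have "0 \<le> (LINT x|\<mu>. V x * (f x)\<^sup>2)"
    using V_AE by (intro integral_nonneg_AE) (auto elim!: eventually_mono)
  moreover have "0 \<le> (LINT x|\<mu>. f x ^ 4)"
    by (intro integral_nonneg_AE) auto
  ultimately show ?thesis
    unfolding quartic_energy_def using tau beta by (intro add_nonneg_nonneg mult_nonneg_nonneg divide_nonneg_nonneg) auto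
qed

lemma const_in_profiles: "(\<lambda>_. 1 / sqrt m) \<in> profiles"
  unfolding profiles_def mem_Collect_eq
proof (intro conjI allI)
  show "1 / sqrt m \<le> height"
  proof -
    have "1 / sqrt m = sqrt (1 / m)" by (simp add: real_sqrt_divide)
    also have "\<dots> \<le> height" unfolding height_def by (rule real_sqrt_le_mono) simp
    finally show ?thesis .
  qed
  show "(LINT x|\<mu>. (1 / sqrt m)\<^sup>2) = 1"
    using integral_const[of "(1 / sqrt m)\<^sup>2"] m_pos by (simp add: power_divide)
qed (use m_pos in auto)

text \<open>By uniform convexity the densities of a minimising sequence are Cauchy in \<open>L\<^sup>2\<close>, hence in \<open>L\<^sup>1\<close>, and a subsequence
  converges almost everywhere. The common bound on the profiles is inherited by the limit and
  dominates all terms of the energy.\<close>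

lemma quartic_energy_minimizer:
  obtains f where "f \<in> profiles" "\<And>g. g \<in> profiles \<Longrightarrow> quartic_energy f \<le> quartic_energy g"
proof -
  define I where "I = Inf (quartic_energy ` profiles)"
  have bdd: "bdd_below (quartic_energy ` profiles)" using quartic_energy_nonneg by (auto intro!: bdd_belowI[of _ 0])
  have I_le: "I \<le> quartic_energy g" if "g \<in> profiles" for g
    unfolding I_def using bdd that by (intro cInf_lower) auto
  have "\<exists>f\<in>profiles. quartic_energy f < I + 1 / real (Suc n)" for n
    using cInf_lessD[of "quartic_energy ` profiles" "I + 1 / real (Suc n)"] const_in_profiles by (auto simp: I_def)
  then obtain s where s: "\<And>n. s n \<in> profiles" "\<And>n. quartic_energy (s n) < I + 1 / real (Suc n)" by metis
  note prof = profilesD[OF s(1)]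
  note [measurable] = prof(1)
  define e where "e N = sqrt (8 / \<beta> * (1 / real (Suc N)))" for N
  have close: "(LINT x|\<mu>. \<bar>(s i x)\<^sup>2 - (s j x)\<^sup>2\<bar>) \<le> e N * sqrt m" if ij: "N \<le> i" "N \<le> j" for N i j
  proof -
    define d where "d = (\<lambda>x. complex_of_real ((s i x)\<^sup>2 - (s j x)\<^sup>2))"
    have d2: "d \<in> L2 D"
      unfolding d_def
    proof (rule bounded_L2[where B="height\<^sup>2"])
      fix x
      have "0 \<le> (s i x)\<^sup>2" "(s i x)\<^sup>2 \<le> height\<^sup>2" "0 \<le> (s j x)\<^sup>2" "(s j x)\<^sup>2 \<le> height\<^sup>2"
        using prof(2,3) by (auto intro: power_mono)
      then show "\<bar>(s i x)\<^sup>2 - (s j x)\<^sup>2\<bar> \<le> height\<^sup>2" by linarith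
    qed measurable
    have "quartic_energy (s k) \<le> I + 1 / real (Suc N)" if "N \<le> k" for k
    proof -
      have "1 / real (Suc k) \<le> 1 / real (Suc N)" using that by (intro divide_left_mono) auto
      then show ?thesis using s(2)[of k] by linarith
    qed
    from this[OF ij(1)] this[OF ij(2)] I_le[OF quartic_energy_midpoint(1)[OF s(1)[of i] s(1)[of j]]]
      quartic_energy_midpoint(2)[OF s(1)[of i] s(1)[of j]]
    have "\<beta> / 8 * (LINT x|\<mu>. ((s i x)\<^sup>2 - (s j x)\<^sup>2)\<^sup>2) \<le> 1 / real (Suc N)" by argo
    then have "(LINT x|\<mu>. ((s i x)\<^sup>2 - (s j x)\<^sup>2)\<^sup>2) \<le> 8 / \<beta> * (1 / real (Suc N))"
      using beta mult_left_mono[of "\<beta> / 8 * (LINT x|\<mu>. ((s i x)\<^sup>2 - (s j x)\<^sup>2)\<^sup>2)" "1 / real (Suc N)" "8 / \<beta>"]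
      by simp
    then have dN: "L2_norm D d \<le> e N"
      unfolding L2_norm_def e_def d_def norm_of_real power2_abs by (rule real_sqrt_le_mono)
    have "(LINT x|\<mu>. cmod (d x) * cmod 1) \<le> L2_norm D d * L2_norm D (\<lambda>_. 1)"
      by (rule L2_Cauchy_Schwarz[OF d2 L2_const])
    moreover have "L2_norm D (\<lambda>_. 1) = sqrt m"
      by (simp add: L2_norm_def measure_restrict_space)
    moreover have "cmod (d x) * cmod 1 = \<bar>(s i x)\<^sup>2 - (s j x)\<^sup>2\<bar>" for x
      unfolding d_def norm_of_real by simp
    ultimately have "(LINT x|\<mu>. \<bar>(s i x)\<^sup>2 - (s j x)\<^sup>2\<bar>) \<le> L2_norm D d * sqrt m" by simp
    also have "\<dots> \<le> e N * sqrt m" using dN m_pos by (intro mult_right_mono) auto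
    finally show ?thesis .
  qed
  have e0: "(\<lambda>N. e N * sqrt m) \<longlonglongrightarrow> 0"
  proof -
    have "(\<lambda>N. sqrt (8 / \<beta> * (1 / real (Suc N))) * sqrt m) \<longlonglongrightarrow> sqrt (8 / \<beta> * 0) * sqrt m"
      by (intro tendsto_intros LIMSEQ_inverse_real_of_nat[unfolded inverse_eq_divide])
    then show ?thesis by (simp add: e_def)
  qed
  obtain r :: "nat \<Rightarrow> nat" where r: "strict_mono r" "AE x in \<mu>. Cauchy (\<lambda>n. (s (r n) x)\<^sup>2)"
  proof (rule cauchy_L1_AE_cauchy_subseq[of \<mu> "\<lambda>n x. (s n x)\<^sup>2"])
    show "integrable \<mu> (\<lambda>x. (s n x)\<^sup>2)" for n by (rule prof(6))
    show "\<exists>N. \<forall>i\<ge>N. \<forall>j\<ge>N. (LINT x|\<mu>. norm ((s i x)\<^sup>2 - (s j x)\<^sup>2)) < \<epsilon>" if \<epsilon>: "\<epsilon> > 0" for \<epsilon>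
    proof -
      obtain N where "e N * sqrt m < \<epsilon>"
        using order_tendstoD(2)[OF e0 \<epsilon>] by (auto simp: eventually_sequentially)
      then show ?thesis using close[of N] by (intro exI[of _ N]) (auto intro: le_less_trans)
    qed
  qed blast
  \<comment> \<open>Clipping keeps the profile bounds also where the subsequence does not converge.\<close>
  define f where "f x = min (max (sqrt (lim (\<lambda>n. (s (r n) x)\<^sup>2))) 0) height" for x
  have fm [measurable]: "f \<in> borel_measurable \<mu>" unfolding f_def by measurable
  have fb: "0 \<le> f x" "f x \<le> height" for x
    using height_pos by (auto simp: f_def)
  have lim: "AE x in \<mu>. (\<lambda>n. s (r n) x) \<longlonglongrightarrow> f x"
    using r(2)
  proof eventually_elim
    case (elim x)
    define l where "l = lim (\<lambda>n. (s (r n) x)\<^sup>2)"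
    have "(\<lambda>n. (s (r n) x)\<^sup>2) \<longlonglongrightarrow> l"
      unfolding l_def using elim by (simp add: Cauchy_convergent convergent_LIMSEQ_iff[symmetric])
    then have "(\<lambda>n. sqrt ((s (r n) x)\<^sup>2)) \<longlonglongrightarrow> sqrt l" by (rule tendsto_real_sqrt)
    then have *: "(\<lambda>n. s (r n) x) \<longlonglongrightarrow> sqrt l" using prof(2) by simp
    have "0 \<le> sqrt l" by (rule LIMSEQ_le_const[OF *]) (use prof(2) in auto)
    moreover have "sqrt l \<le> height" by (rule LIMSEQ_le_const2[OF *]) (use prof(3) in auto)
    ultimately have "f x = sqrt l" by (simp add: f_def l_def)
    then show ?case using * by simp
  qed
  have lim_pow: "(\<lambda>n. LINT x|\<mu>. W x * s (r n) x ^ k) \<longlonglongrightarrow> (LINT x|\<mu>. W x * f x ^ k)"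
    if W: "integrable \<mu> W" for W :: "'a \<Rightarrow> real" and k
  proof (rule integral_dominated_convergence[where w="\<lambda>x. \<bar>W x\<bar> * height ^ k"])
    note [measurable] = borel_measurable_integrable[OF W]
    show "(\<lambda>x. W x * f x ^ k) \<in> borel_measurable \<mu>" by measurable
    show "(\<lambda>x. W x * s (r n) x ^ k) \<in> borel_measurable \<mu>" for n by measurable
    show "integrable \<mu> (\<lambda>x. \<bar>W x\<bar> * height ^ k)" using W by simp
    show "AE x in \<mu>. (\<lambda>n. W x * s (r n) x ^ k) \<longlonglongrightarrow> W x * f x ^ k"
      using lim by eventually_elim (intro tendsto_intros)
    show "AE x in \<mu>. norm (W x * s (r n) x ^ k) \<le> \<bar>W x\<bar> * height ^ k" for n
      using prof(2,3) by (intro AE_I2) (auto simp: abs_mult power_abs intro!: mult_left_mono power_mono)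
  qed
  have "(\<lambda>n. LINT x|\<mu>. (s (r n) x)\<^sup>2) \<longlonglongrightarrow> (LINT x|\<mu>. (f x)\<^sup>2)"
    using lim_pow[OF integrable_const[of 1], of 2] by simp
  moreover have "(LINT x|\<mu>. (s (r n) x)\<^sup>2) = 1" for n using s(1) by (auto simp: profiles_def)
  ultimately have "(LINT x|\<mu>. (f x)\<^sup>2) = 1" by (simp add: LIMSEQ_const_iff)
  then have fY: "f \<in> profiles" using fm fb by (simp add: profiles_def)
  note Yf = profilesD[OF fY]
  have L2lim: "(\<lambda>n. L2_norm D (\<lambda>x. of_real (s (r n) x) - complex_of_real (f x))) \<longlonglongrightarrow> 0"
  proof (rule L2_dominated_convergence(2)[where w="\<lambda>_. of_real height"])
    show "AE x in \<mu>. (\<lambda>n. complex_of_real (s (r n) x)) \<longlonglongrightarrow> of_real (f x)"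
      using lim by eventually_elim (rule tendsto_of_real)
    show "AE x in \<mu>. cmod (of_real (s (r n) x)) \<le> cmod (of_real height)" for n
      using prof(2,3) height_pos by (intro AE_I2) simp
  qed (use L2_const in measurable)
  have Slim: "(\<lambda>n. L2_norm D (S (\<lambda>x. of_real (s (r n) x)))) \<longlonglongrightarrow> L2_norm D (S (\<lambda>x. of_real (f x)))"
  proof (rule Lim_transform2[OF tendsto_const])
    show "(\<lambda>n. L2_norm D (S (\<lambda>x. of_real (f x))) - L2_norm D (S (\<lambda>x. of_real (s (r n) x)))) \<longlonglongrightarrow> 0"
    proof (rule Lim_null_comparison[OF always_eventually L2lim], intro allI)
      fix n
      let ?u = "\<lambda>x. complex_of_real (f x)" and ?v = "\<lambda>x. complex_of_real (s (r n) x)"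
      note v = prof(4)[of "r n"]
      have "L2_norm D (S ?u) \<le> L2_norm D (\<lambda>x. S ?u x - S ?v x) + L2_norm D (S ?v)"
        "L2_norm D (S ?v) \<le> L2_norm D (\<lambda>x. S ?v x - S ?u x) + L2_norm D (S ?u)"
        using L2_norm_triangle[OF L2_diff[OF T_L2[OF tau2 Yf(4)] T_L2[OF tau2 v]] T_L2[OF tau2 v]]
          L2_norm_triangle[OF L2_diff[OF T_L2[OF tau2 v] T_L2[OF tau2 Yf(4)]] T_L2[OF tau2 Yf(4)]] by simp_all
      moreover have "L2_norm D (\<lambda>x. S ?v x - S ?u x) \<le> L2_norm D (\<lambda>x. ?v x - ?u x)"
        using T_norm_diff_le[OF tau2 v Yf(4), of 1] T_contraction[OF tau2] by simp
      moreover have "L2_norm D (\<lambda>x. S ?u x - S ?v x) = L2_norm D (\<lambda>x. S ?v x - S ?u x)"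
        by (rule L2_norm_minus_commute)
      ultimately show "norm (L2_norm D (S ?u) - L2_norm D (S ?v)) \<le> L2_norm D (\<lambda>x. ?v x - ?u x)"
        unfolding real_norm_def by linarith
    qed
  qed
  have "(\<lambda>n. quartic_energy (s (r n))) \<longlonglongrightarrow> quartic_energy f"
    unfolding quartic_energy_def using tau lim_pow[OF V_integrable, of 2] lim_pow[OF integrable_const[of 1], of 4]
    by (intro tendsto_intros Slim) auto
  moreover have "(\<lambda>n. quartic_energy (s (r n))) \<longlonglongrightarrow> I"
  proof (rule tendsto_sandwich[OF _ _ tendsto_const])
    have "(\<lambda>n. I + 1 / real (Suc n)) \<longlonglongrightarrow> I + 0"
      by (intro tendsto_intros LIMSEQ_inverse_real_of_nat[unfolded inverse_eq_divide])
    then show "(\<lambda>n. I + 1 / real (Suc (r n))) \<longlonglongrightarrow> I"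
      using LIMSEQ_subseq_LIMSEQ[OF _ r(1), of "\<lambda>n. I + 1 / real (Suc n)" I] by (simp add: o_def)
    show "\<forall>\<^sub>F n in sequentially. I \<le> quartic_energy (s (r n))"
      using I_le s(1) by simp
    show "\<forall>\<^sub>F n in sequentially. quartic_energy (s (r n)) \<le> I + 1 / real (Suc (r n))"
      using less_imp_le[OF s(2)] by (simp del: of_nat_Suc)
  qed
  ultimately have "quartic_energy f = I" by (rule LIMSEQ_unique)
  then show ?thesis using that fY I_le by simp
qed

lemma common_minimizer:
  obtains u where "u \<in> L2 D" "L2_norm D u = 1" "\<And>v. v \<in> L2 D \<Longrightarrow> L2_norm D v \<le> 1 \<Longrightarrow> E u \<le> E v"
proof -
  obtain f where f: "f \<in> profiles" "\<And>g. g \<in> profiles \<Longrightarrow> quartic_energy f \<le> quartic_energy g" using quartic_energy_minimizer by blast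
  note Y = profilesD[OF f(1)]
  have "E (\<lambda>x. of_real (f x)) \<le> E v" if v: "v \<in> L2 D" "L2_norm D v \<le> 1" for v
  proof -
    obtain w where w: "w \<in> L2 D" "L2_norm D w = 1" "E w \<le> E v"
      by (rule energy_ball_ge_sphere[OF v])
    obtain g where g: "g \<in> profiles" "quartic_energy g \<le> E w" by (rule quartic_energy_le_energy[OF w(1,2)])
    show ?thesis using energy_le_quartic_energy[OF f(1)] f(2)[OF g(1)] g(2) w(3) by linarith
  qed
  then show ?thesis using that Y(4,5) by blast
qed

end

theorem corollary2p7:
  fixes a b :: "'a::euclidean_space"
    and D :: "'a set"
    and T :: "real \<Rightarrow> ('a \<Rightarrow> complex) \<Rightarrow> 'a \<Rightarrow> complex"
    and V :: "'a \<Rightarrow> real"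
    and \<beta> \<kappa> \<tau> :: real
  assumes dim: "DIM('a) \<in> {1, 2, 3}"
    and ab: "\<And>i. i \<in> Basis \<Longrightarrow> a \<bullet> i < b \<bullet> i"
    and D: "D = box a b"
    and heat: "periodic_heat_semigroup a b T"
    and tau: "\<tau> > 0"
    and beta: "\<beta> > 0"
    and V_Linf: "V \<in> Linf D"
    and V_nonneg: "\<And>x. x \<in> D \<Longrightarrow> V x \<ge> 0"
    and kappa: "ereal \<kappa> \<ge> Linf_norm D V + ereal (3 * \<beta> * (trunc_level D \<beta> V)\<^sup>2)"
  shows "\<exists>\<phi> \<psi>.
      is_arg_min (trunc_energy D T V \<beta> \<kappa> \<tau>) (\<lambda>u. u \<in> L2 D \<and> L2_norm D u \<le> 1) \<phi> \<and>
      is_arg_min (trunc_energy D T V \<beta> \<kappa> \<tau>) (\<lambda>u. u \<in> L2 D \<and> L2_norm D u = 1) \<psi> \<and>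
      trunc_energy D T V \<beta> \<kappa> \<tau> \<phi> = trunc_energy D T V \<beta> \<kappa> \<tau> \<psi>"
proof -
  interpret truncated_energy a b T V \<beta> \<kappa> \<tau>
    using assms by unfold_locales auto
  obtain u where "u \<in> L2 D" "L2_norm D u = 1"
    "\<And>v. v \<in> L2 D \<Longrightarrow> L2_norm D v \<le> 1 \<Longrightarrow> trunc_energy D T V \<beta> \<kappa> \<tau> u \<le> trunc_energy D T V \<beta> \<kappa> \<tau> v"
    using common_minimizer unfolding D by blast
  then show ?thesis
    by (intro exI[of _ u]) (auto simp: is_arg_min_linorder)
qed

end
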